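(* Let $T>0$, let $X_0$ be $\mathcal F_0$-measurable with $\mathbb E|X_0|^2<\infty$, and suppose that the coefficients $b,\sigma$ satisfy Assumptions 1, 2 and 3 (stated in the context). Let $(X_t)_{t\in[0,T]}$ be the solution of the McKean-Vlasov SDE $\mathrm dX_t=b(X_t,\mathcal L_{X_t})\,\mathrm dt+\sigma(X_t,\mathcal L_{X_t})\,\mathrm dW_t$ with initial value $X_0$, and for $h\in(0,1)$ let $(\hat X_{kh})_{k\ge 0}$ be its Euler-Maruyama approximation with step size $h$ and $\hat X_0=X_0$. Then there is a constant $C>0$, independent of $h$, such that for all $h\in(0,1)$ $$\sup_{k=1,2,\dots,\lfloor T/h\rfloor}\mathbb E\big|X_{kh}-\hat X_{kh}\big|^2\le C\,h .$$
   Context: Notation: $\mathcal P_2=\mathcal P_2(\mathbb R^d)$ is the set of probability measures on $\mathbb R^d$ with finite second moment; $\mu(|\cdot|^2):=\int|x|^2\mu(\mathrm dx)$; $\mathcal W_2$ is the 2-Wasserstein distance; $\|\cdot\|_{\mathrm{HS}}$ is the Hilbert-Schmidt norm; $\mathcal L_\xi$ is the law of $\xi$. $W$ is a standard $d$-dimensional Brownian motion on a complete filtered probability space $(\Omega,\mathcal F,(\mathcal F_t),\mathbb P)$. The coefficients are $b:\mathbb R^d\times\mathcal P_2\to\mathbb R^d$ and $\sigma:\mathbb R^d\times\mathcal P_2\to\mathbb R^{d\times d}$. Assumption 1: $b$ and $\sigma$ are continuous on $\mathbb R^d\times\mathcal P_2$. Assumption 2: there are constants $\alpha>\beta\ge0$,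 $\gamma>\kappa\ge0$, $\rho>0$ such that for all $x,y\in\mathbb R^d$, $\mu,\nu\in\mathcal P_2$, $$2\langle b(x,\mu)-b(y,\nu),x-y\rangle+\|\sigma(x,\mu)-\sigma(y,\nu)\|_{\mathrm{HS}}^2\le-\alpha|x-y|^2+\beta\,\mathcal W_2(\mu,\nu)^2,$$ $$2\langle b(x,\mu),x\rangle+(1+\rho)\|\sigma(x,\mu)\|_{\mathrm{HS}}^2\le-\gamma|x|^2+\kappa\big(1+\rho+\mu(|\cdot|^2)\big).$$ Assumption 3: there are positive constants $c_0,a,\bar b$ such that for all $x,y\in\mathbb R^d$, $\mu,\nu\in\mathcal P_2$, $$|b(x,\mu)|^2\vee\|\sigma(x,\mu)\|_{\mathrm{HS}}^2\le c_0\big(1+|x|^2+\mu(|\cdot|^2)\big),$$ $$|b(x,\mu)-b(y,\nu)|^2\vee\|\sigma(x,\mu)-\sigma(y,\nu)\|_{\mathrm{HS}}^2\le a|x-y|^2+\bar b\,\mathcal W_2(\mu,\nu)^2.$$ Euler-Maruyama scheme with step size $h\in(0,1)$: $\hat X_0=X_0$ and, for $k\ge0$, $$\hat X_{(k+1)h}=\hat X_{kh}+h\,b(\hat X_{kh},\mathcal L_{\hat X_{kh}})+\sigma(\hat X_{kh},\mathcal L_{\hat X_{kh}})\,(W_{(k+1)h}-W_{kh}),$$ driven by the same Brownian motion $W$ as the SDE. *)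

theory Defs
  imports "HOL-Probability.Probability"
begin

section \<open>The space of probability measures with finite second moment\<close>

definition P2 :: "('a::euclidean_space) measure set" where
  "P2 = {\<mu>. prob_space \<mu> \<and> sets \<mu> = sets borel \<and> integrable \<mu> (\<lambda>x. (norm x)\<^sup>2)}"

definition second_moment :: "('a::euclidean_space) measure \<Rightarrow> real" where
  "second_moment \<mu> = (\<integral>x. (norm x)\<^sup>2 \<partial>\<mu>)"

definition couplings ::
  "('a::euclidean_space) measure \<Rightarrow> 'a measure \<Rightarrow> ('a \<times> 'a) measure set" where
  "couplings \<mu> \<nu> = {\<pi>. prob_space \<pi> \<and> sets \<pi> = sets (borel \<Otimes>\<^sub>M borel) \<and>
     distr \<pi> borel fst = \<mu> \<and> distr \<pi> borel snd = \<nu>}"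

text \<open>Only used for measures in \<^const>\<open>P2\<close>: then the set of couplings is nonempty and the cost is
  integrable for every coupling, so neither the infimum nor the integral takes a default value.\<close>

definition W2 :: "('a::euclidean_space) measure \<Rightarrow> 'a measure \<Rightarrow> real" where
  "W2 \<mu> \<nu> = sqrt (INF \<pi>\<in>couplings \<mu> \<nu>. \<integral>z. (norm (fst z - snd z))\<^sup>2 \<partial>\<pi>)"


section \<open>Assumptions on the coefficients\<close>

text \<open>Coefficients are functions of an arbitrary measure, but every condition only concerns their
  values at measures in \<^const>\<open>P2\<close>. The norm of \<open>real^'n^'n\<close> is the square root of the sum of the
  squared entries, that is, the Hilbert-Schmidt norm.\<close>

definition continuous_coeff ::
  "(('a::euclidean_space) \<Rightarrow> 'a measure \<Rightarrow> 'b::real_normed_vector) \<Rightarrow> bool" where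
  "continuous_coeff f \<longleftrightarrow>
     (\<forall>x. \<forall>\<mu>\<in>P2. \<forall>\<epsilon>>0. \<exists>\<delta>>0. \<forall>y. \<forall>\<nu>\<in>P2.
        norm (x - y) < \<delta> \<and> W2 \<mu> \<nu> < \<delta> \<longrightarrow> norm (f x \<mu> - f y \<nu>) < \<epsilon>)"

definition dissipative_coeffs ::
  "(real^'n \<Rightarrow> (real^'n) measure \<Rightarrow> real^'n) \<Rightarrow> (real^'n \<Rightarrow> (real^'n) measure \<Rightarrow> real^'n^'n) \<Rightarrow> bool"
where
  "dissipative_coeffs b \<sigma> \<longleftrightarrow>
     (\<exists>\<alpha> \<beta> \<gamma> \<kappa> \<rho> :: real. \<alpha> > \<beta> \<and> \<beta> \<ge> 0 \<and> \<gamma> > \<kappa> \<and> \<kappa> \<ge> 0 \<and> \<rho> > 0 \<and>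
       (\<forall>x y. \<forall>\<mu>\<in>P2. \<forall>\<nu>\<in>P2.
          2 * ((b x \<mu> - b y \<nu>) \<bullet> (x - y)) + (norm (\<sigma> x \<mu> - \<sigma> y \<nu>))\<^sup>2
            \<le> - \<alpha> * (norm (x - y))\<^sup>2 + \<beta> * (W2 \<mu> \<nu>)\<^sup>2) \<and>
       (\<forall>x. \<forall>\<mu>\<in>P2.
          2 * (b x \<mu> \<bullet> x) + (1 + \<rho>) * (norm (\<sigma> x \<mu>))\<^sup>2
            \<le> - \<gamma> * (norm x)\<^sup>2 + \<kappa> * (1 + \<rho> + second_moment \<mu>)))"

definition growth_lipschitz_coeffs ::
  "(real^'n \<Rightarrow> (real^'n) measure \<Rightarrow> real^'n) \<Rightarrow> (real^'n \<Rightarrow> (real^'n) measure \<Rightarrow> real^'n^'n) \<Rightarrow> bool"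
where
  "growth_lipschitz_coeffs b \<sigma> \<longleftrightarrow>
     (\<exists>c\<^sub>0 a b' :: real. c\<^sub>0 > 0 \<and> a > 0 \<and> b' > 0 \<and>
       (\<forall>x. \<forall>\<mu>\<in>P2.
          max ((norm (b x \<mu>))\<^sup>2) ((norm (\<sigma> x \<mu>))\<^sup>2)
            \<le> c\<^sub>0 * (1 + (norm x)\<^sup>2 + second_moment \<mu>)) \<and>
       (\<forall>x y. \<forall>\<mu>\<in>P2. \<forall>\<nu>\<in>P2.
          max ((norm (b x \<mu> - b y \<nu>))\<^sup>2) ((norm (\<sigma> x \<mu> - \<sigma> y \<nu>))\<^sup>2)
            \<le> a * (norm (x - y))\<^sup>2 + b' * (W2 \<mu> \<nu>)\<^sup>2))"


section \<open>Filtered probability spaces and Brownian motion\<close>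

text \<open>Time is indexed by all reals in order to use \<^locale>\<open>filtration\<close>; only times \<open>t \<ge> 0\<close> matter,
  since a filtration on \<open>[0, \<infinity>)\<close> extends by \<open>F t = F 0\<close> for \<open>t < 0\<close>.\<close>

locale complete_filtered_prob_space =
  prob_space M + complete_measure M + filtration "space M" F
  for M :: "'w measure" and F :: "real \<Rightarrow> 'w measure" +
  assumes sets_F_subset: "\<And>t. sets (F t) \<subseteq> sets M"
    and null_sets_F0: "null_sets M \<subseteq> sets (F 0)"

definition brownian_motion ::
  "'w measure \<Rightarrow> (real \<Rightarrow> 'w measure) \<Rightarrow> (real \<Rightarrow> 'w \<Rightarrow> real^'n) \<Rightarrow> bool" where
  "brownian_motion M F W \<longleftrightarrow>
     (\<forall>t\<ge>0. W t \<in> borel_measurable (F t)) \<and>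
     (AE \<omega> in M. W 0 \<omega> = 0) \<and>
     (AE \<omega> in M. continuous_on {0..} (\<lambda>t. W t \<omega>)) \<and>
     (\<forall>s t. 0 \<le> s \<and> s < t \<longrightarrow>
        prob_space.indep_set M (sets (F s))
          {(\<lambda>\<omega>. W t \<omega> - W s \<omega>) -` A \<inter> space M | A. A \<in> sets borel} \<and>
        distributed M lborel (\<lambda>\<omega>. W t \<omega> - W s \<omega>)
          (\<lambda>x. ennreal (\<Prod>i\<in>UNIV. normal_density 0 (sqrt (t - s)) (x $ i))))"


section \<open>The Ito integral\<close>

text \<open>A simple process on \<open>[0, t]\<close> is given by \<open>n\<close>, a partition \<open>\<tau> 0 \<le> \<dots> \<le> \<tau> n\<close> and the values
  \<open>\<xi> i\<close> on \<open>(\<tau> i, \<tau> (i + 1)]\<close>, bounded and \<open>F (\<tau> i)\<close>-measurable.\<close>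

definition simple_process ::
  "'w measure \<Rightarrow> (real \<Rightarrow> 'w measure) \<Rightarrow> real \<Rightarrow> nat \<Rightarrow> (nat \<Rightarrow> real) \<Rightarrow> (nat \<Rightarrow> 'w \<Rightarrow> real^'n^'n) \<Rightarrow> bool"
where
  "simple_process M F t n \<tau> \<xi> \<longleftrightarrow>
     0 \<le> \<tau> 0 \<and> \<tau> n \<le> t \<and> (\<forall>i<n. \<tau> i \<le> \<tau> (Suc i)) \<and>
     (\<forall>i<n. \<xi> i \<in> borel_measurable (F (\<tau> i))) \<and>
     (\<exists>B. \<forall>i<n. \<forall>\<omega>\<in>space M. norm (\<xi> i \<omega>) \<le> B)"

definition simple_process_val ::
  "nat \<Rightarrow> (nat \<Rightarrow> real) \<Rightarrow> (nat \<Rightarrow> 'w \<Rightarrow> real^'n^'n) \<Rightarrow> real \<Rightarrow> 'w \<Rightarrow> real^'n^'n" where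
  "simple_process_val n \<tau> \<xi> s \<omega> = (\<Sum>i<n. indicator {\<tau> i<..\<tau> (Suc i)} s *\<^sub>R \<xi> i \<omega>)"

definition simple_ito_integral ::
  "(real \<Rightarrow> 'w \<Rightarrow> real^'n) \<Rightarrow> nat \<Rightarrow> (nat \<Rightarrow> real) \<Rightarrow> (nat \<Rightarrow> 'w \<Rightarrow> real^'n^'n) \<Rightarrow> 'w \<Rightarrow> real^'n" where
  "simple_ito_integral W n \<tau> \<xi> \<omega> = (\<Sum>i<n. \<xi> i \<omega> *v (W (\<tau> (Suc i)) \<omega> - W (\<tau> i) \<omega>))"

definition progressively_measurable_upto ::
  "(real \<Rightarrow> 'w measure) \<Rightarrow> real \<Rightarrow> (real \<Rightarrow> 'w \<Rightarrow> 'b::topological_space) \<Rightarrow> bool" where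
  "progressively_measurable_upto F T H \<longleftrightarrow>
     (\<forall>t\<in>{0..T}. (\<lambda>(s, \<omega>). H s \<omega>) \<in> borel_measurable (restrict_space borel {0..t} \<Otimes>\<^sub>M F t))"

text \<open>The random variable \<open>I\<close> is (a version of) the Ito integral over \<open>[0, t]\<close> of the progressively
  measurable process \<open>H\<close> with \<open>E \<integral>\<^sub>0\<^sup>t |H s|\<^sup>2 ds < \<infinity>\<close>: the \<open>L\<^sup>2\<close>-limit of the integrals of simple
  processes that approximate \<open>H\<close> in \<open>L\<^sup>2\<close>. By the Ito isometry it depends, up to null sets, on
  \<open>H\<close> only and not on the approximating sequence.\<close>

definition has_ito_integral ::
  "'w measure \<Rightarrow> (real \<Rightarrow> 'w measure) \<Rightarrow> (real \<Rightarrow> 'w \<Rightarrow> real^'n) \<Rightarrow>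
     (real \<Rightarrow> 'w \<Rightarrow> real^'n^'n) \<Rightarrow> real \<Rightarrow> ('w \<Rightarrow> real^'n) \<Rightarrow> bool"
where
  "has_ito_integral M F W H t I \<longleftrightarrow>
     progressively_measurable_upto F t H \<and>
     (\<integral>\<^sup>+\<omega>. (\<integral>\<^sup>+s\<in>{0..t}. ennreal ((norm (H s \<omega>))\<^sup>2) \<partial>lborel) \<partial>M) < \<infinity> \<and>
     I \<in> borel_measurable M \<and>
     (\<exists>n \<tau> \<xi>.
        (\<forall>m. simple_process M F t (n m) (\<tau> m) (\<xi> m)) \<and>
        (\<lambda>m. \<integral>\<^sup>+\<omega>. (\<integral>\<^sup>+s\<in>{0..t}.
            ennreal ((norm (simple_process_val (n m) (\<tau> m) (\<xi> m) s \<omega> - H s \<omega>))\<^sup>2) \<partial>lborel) \<partial>M)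
          \<longlonglongrightarrow> 0 \<and>
        (\<lambda>m. \<integral>\<^sup>+\<omega>. ennreal ((norm (simple_ito_integral W (n m) (\<tau> m) (\<xi> m) \<omega> - I \<omega>))\<^sup>2) \<partial>M)
          \<longlonglongrightarrow> 0)"


section \<open>The McKean-Vlasov equation and its Euler-Maruyama scheme\<close>

abbreviation law :: "'w measure \<Rightarrow> ('w \<Rightarrow> 'a::topological_space) \<Rightarrow> 'a measure" where
  "law M \<xi> \<equiv> distr M borel \<xi>"

text \<open>The usual notion of solution for distribution dependent equations: an adapted process with
  continuous paths and laws in \<^const>\<open>P2\<close> such that
  \<open>E \<integral>\<^sub>0\<^sup>T (|b(X s, law (X s))| + |\<sigma>(X s, law (X s))|\<^sup>2) ds < \<infinity>\<close> and the equation holds in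
  integrated form. The bound on \<open>\<sigma>\<close> is part of \<^const>\<open>has_ito_integral\<close> (for \<open>t = T\<close>).\<close>

definition mckean_vlasov_solution ::
  "'w measure \<Rightarrow> (real \<Rightarrow> 'w measure) \<Rightarrow> (real \<Rightarrow> 'w \<Rightarrow> real^'n) \<Rightarrow>
     (real^'n \<Rightarrow> (real^'n) measure \<Rightarrow> real^'n) \<Rightarrow> (real^'n \<Rightarrow> (real^'n) measure \<Rightarrow> real^'n^'n) \<Rightarrow>
     real \<Rightarrow> ('w \<Rightarrow> real^'n) \<Rightarrow> (real \<Rightarrow> 'w \<Rightarrow> real^'n) \<Rightarrow> bool"
where
  "mckean_vlasov_solution M F W b \<sigma> T X\<^sub>0 X \<longleftrightarrow>
     (\<forall>t\<in>{0..T}. X t \<in> borel_measurable (F t)) \<and>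
     (AE \<omega> in M. continuous_on {0..T} (\<lambda>t. X t \<omega>)) \<and>
     (\<forall>t\<in>{0..T}. law M (X t) \<in> P2) \<and>
     (AE \<omega> in M. X 0 \<omega> = X\<^sub>0 \<omega>) \<and>
     set_integrable (lborel \<Otimes>\<^sub>M M) ({0..T} \<times> space M) (\<lambda>(s, \<omega>). b (X s \<omega>) (law M (X s))) \<and>
     (\<forall>t\<in>{0..T}. \<exists>I.
        has_ito_integral M F W (\<lambda>s \<omega>. \<sigma> (X s \<omega>) (law M (X s))) t I \<and>
        (AE \<omega> in M. X t \<omega> =
           X\<^sub>0 \<omega> + set_lebesgue_integral lborel {0..t} (\<lambda>s. b (X s \<omega>) (law M (X s))) + I \<omega>))"

text \<open>\<open>euler_maruyama M W b \<sigma> X\<^sub>0 h k\<close> is the value of the scheme at time \<open>k h\<close>.\<close>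

primrec euler_maruyama ::
  "'w measure \<Rightarrow> (real \<Rightarrow> 'w \<Rightarrow> real^'n) \<Rightarrow>
     (real^'n \<Rightarrow> (real^'n) measure \<Rightarrow> real^'n) \<Rightarrow> (real^'n \<Rightarrow> (real^'n) measure \<Rightarrow> real^'n^'n) \<Rightarrow>
     ('w \<Rightarrow> real^'n) \<Rightarrow> real \<Rightarrow> nat \<Rightarrow> 'w \<Rightarrow> real^'n"
where
  "euler_maruyama M W b \<sigma> X\<^sub>0 h 0 = X\<^sub>0"
| "euler_maruyama M W b \<sigma> X\<^sub>0 h (Suc k) =
     (let Y = euler_maruyama M W b \<sigma> X\<^sub>0 h k in
      (\<lambda>\<omega>. Y \<omega> + h *\<^sub>R b (Y \<omega>) (law M Y)
         + \<sigma> (Y \<omega>) (law M Y) *v (W (real (Suc k) * h) \<omega> - W (real k * h) \<omega>)))"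

end

(* The error e at the grid points satisfies e' = e + A + L, where A compares the drift of the solution
over one step with the frozen drift of the scheme, and L does the same for the stochastic integrals.
L is orthogonal to e, and by the Ito isometry and the Lipschitz condition
E|A|^2 + h E|L|^2 = O(h^2) (h + E|e|^2), since E|X r - X s|^2 = O(r - s) and since the law of a pair of
random variables is a coupling, so that W2 is bounded by their L2 distance. A discrete Gronwall argument
then gives E|e|^2 = O(h).

Only two facts about the Ito integral enter: orthogonality of its increments to the past, and the
isometry up to a constant. Both pass to the limit from elementary integrands. *)

theory Submission
  imports Defs
begin

text \<open>Orthogonality of \<open>L\<close> to the past is what makes the rate possible. Over one
  step \<open>L\<close> has second moment of order h Q and \<open>A\<close> only h^2 Q, with Q of
  order h + E|e|^2. Bounding the cross term with \<open>L\<close> by Young's inequality with weight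
  h would leave E|L|^2 / h, of order Q, in each of about T/h steps, and the resulting bound would
  not tend to 0; for \<open>A\<close> the same weight leaves h Q, which is harmless.

  Two obstacles shape the rest. The estimate of E|X r - X s|^2 needs second moments bounded
  uniformly in time, whereas a solution only has finite ones at each time; they are obtained along
  single paths, before taking expectations. And the stochastic integral is given at each fixed time
  only, with its own approximating sequence, so that an increment has to compare two unrelated
  sequences. A factor lost there changes C but not the rate, which is why an isometry up to the
  constant 4 is enough.\<close>

section \<open>Square integrable functions, Wasserstein distance and Gronwall inequalities\<close>

lemma norm_add_sq_le: "(norm (x + y :: 'a::real_inner))\<^sup>2 \<le> 2 * (norm x)\<^sup>2 + 2 * (norm y)\<^sup>2"
proof -
  have "0 \<le> (norm (x - y))\<^sup>2" by simp
  then show ?thesis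
    by (simp add: power2_norm_eq_inner inner_add_left inner_add_right inner_diff_left inner_diff_right inner_commute)
qed

text \<open>Young's inequality with a free weight, from expanding |c x - y|^2 / c. The weight is the
  step size in the error recursion and arbitrary in the proof of orthogonality.\<close>

lemma norm_add_sq_weighted_le:
  fixes x y :: "'a::real_inner"
  assumes "0 < c"
  shows "2 * (x \<bullet> y) \<le> c * (norm x)\<^sup>2 + (norm y)\<^sup>2 / c"
proof -
  have "0 \<le> (norm (c *\<^sub>R x - y))\<^sup>2 / c" using assms by simp
  also have "\<dots> = c * (norm x)\<^sup>2 + (norm y)\<^sup>2 / c - 2 * (x \<bullet> y)"
    using assms unfolding power2_norm_eq_inner
    by (simp add: inner_diff_left inner_diff_right inner_commute field_simps)
  finally show ?thesis by simp
qed

lemma sum4_sq_le: "(x + y + z + w)\<^sup>2 \<le> 4 * (x\<^sup>2 + y\<^sup>2 + z\<^sup>2 + (w::real)\<^sup>2)"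
proof -
  have "0 \<le> (x - y)\<^sup>2 + (x - z)\<^sup>2 + (x - w)\<^sup>2 + (y - z)\<^sup>2 + (y - w)\<^sup>2 + (z - w)\<^sup>2" by simp
  then show ?thesis by (simp add: power2_eq_square algebra_simps)
qed

section \<open>Square integrable functions\<close>

definition L2 :: "'w measure \<Rightarrow> ('w \<Rightarrow> 'b::euclidean_space) \<Rightarrow> bool" where
  "L2 M f \<longleftrightarrow> f \<in> borel_measurable M \<and> integrable M (\<lambda>\<omega>. (norm (f \<omega>))\<^sup>2)"

lemma L2_measurable: "L2 M f \<Longrightarrow> f \<in> borel_measurable M"
  and L2_integrable_norm_sq: "L2 M f \<Longrightarrow> integrable M (\<lambda>\<omega>. (norm (f \<omega>))\<^sup>2)"
  by (auto simp: L2_def)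

lemma L2_bound:
  assumes "f \<in> borel_measurable M" "integrable M g" "AE \<omega> in M. (norm (f \<omega>))\<^sup>2 \<le> g \<omega>"
  shows "L2 M f"
  unfolding L2_def
proof (intro conjI)
  show "integrable M (\<lambda>\<omega>. (norm (f \<omega>))\<^sup>2)"
    by (rule Bochner_Integration.integrable_bound[OF assms(2)])
       (use assms in \<open>auto elim!: eventually_mono\<close>)
qed fact

lemma L2_zero: "L2 M (\<lambda>_. 0)"
  by (simp add: L2_def)

lemma L2_add: assumes "L2 M f" "L2 M g" shows "L2 M (\<lambda>\<omega>. f \<omega> + g \<omega>)"
proof (rule L2_bound)
  show "integrable M (\<lambda>\<omega>. 2 * (norm (f \<omega>))\<^sup>2 + 2 * (norm (g \<omega>))\<^sup>2)"
    using assms by (simp add: L2_def)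
qed (use assms in \<open>auto simp: L2_def norm_add_sq_le\<close>)

lemma L2_scaleR: assumes "L2 M f" shows "L2 M (\<lambda>\<omega>. c *\<^sub>R f \<omega>)"
  using assms by (auto simp: L2_def power_mult_distrib)

lemma L2_uminus: "L2 M f \<Longrightarrow> L2 M (\<lambda>\<omega>. - f \<omega>)"
  by (simp add: L2_def)

lemma L2_diff: "L2 M f \<Longrightarrow> L2 M g \<Longrightarrow> L2 M (\<lambda>\<omega>. f \<omega> - g \<omega>)"
  using L2_add[of M f "\<lambda>\<omega>. - g \<omega>"] by (simp add: L2_uminus)

lemma L2_inner_integrable:
  assumes "L2 M f" "L2 M g" shows "integrable M (\<lambda>\<omega>. f \<omega> \<bullet> g \<omega>)"
proof (rule Bochner_Integration.integrable_bound)
  show "integrable M (\<lambda>\<omega>. (norm (f \<omega>))\<^sup>2 + (norm (g \<omega>))\<^sup>2)"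
    using assms by (simp add: L2_def)
  show "AE \<omega> in M. norm (f \<omega> \<bullet> g \<omega>) \<le> norm ((norm (f \<omega>))\<^sup>2 + (norm (g \<omega>))\<^sup>2)"
  proof (rule AE_I2)
    fix \<omega>
    have "\<bar>f \<omega> \<bullet> g \<omega>\<bar> \<le> norm (f \<omega>) * norm (g \<omega>)" by (rule Cauchy_Schwarz_ineq2)
    moreover have "2 * (norm (f \<omega>) * norm (g \<omega>)) \<le> (norm (f \<omega>))\<^sup>2 + (norm (g \<omega>))\<^sup>2"
      using sum_squares_bound[of "norm (f \<omega>)" "norm (g \<omega>)"] by (simp add: ac_simps)
    moreover have "0 \<le> norm (f \<omega>) * norm (g \<omega>)" by simp
    ultimately have "\<bar>f \<omega> \<bullet> g \<omega>\<bar> \<le> (norm (f \<omega>))\<^sup>2 + (norm (g \<omega>))\<^sup>2" by linarith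
    then show "norm (f \<omega> \<bullet> g \<omega>) \<le> norm ((norm (f \<omega>))\<^sup>2 + (norm (g \<omega>))\<^sup>2)" by simp
  qed
qed (use assms in \<open>auto simp: L2_def\<close>)

lemma L2_iff_inner_integrable:
  "L2 M f \<longleftrightarrow> f \<in> borel_measurable M \<and> integrable M (\<lambda>\<omega>. f \<omega> \<bullet> f \<omega>)"
  by (simp add: L2_def power2_norm_eq_inner)

lemma L2_component:
  assumes "L2 M (f :: 'w \<Rightarrow> ('b::euclidean_space)^'n)" shows "L2 M (\<lambda>\<omega>. f \<omega> $ i)"
proof (rule L2_bound)
  show "integrable M (\<lambda>\<omega>. (norm (f \<omega>))\<^sup>2)" using assms by (simp add: L2_def)
  show "AE \<omega> in M. (norm (f \<omega> $ i))\<^sup>2 \<le> (norm (f \<omega>))\<^sup>2"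
    by (intro AE_I2 power_mono) (auto simp: Finite_Cartesian_Product.norm_nth_le)
  show "(\<lambda>\<omega>. f \<omega> $ i) \<in> borel_measurable M"
    by (rule measurable_compose[OF L2_measurable[OF assms] borel_measurable_continuous_onI])
       (intro continuous_intros)
qed

lemma L2_real_mult_integrable:
  fixes f g :: "'w \<Rightarrow> real"
  assumes "L2 M f" "L2 M g" shows "integrable M (\<lambda>\<omega>. f \<omega> * g \<omega>)"
  using L2_inner_integrable[OF assms] by (simp add: mult.commute)

lemma L2_nn_integral:
  assumes "L2 M f"
  shows "(\<integral>\<^sup>+\<omega>. ennreal ((norm (f \<omega>))\<^sup>2) \<partial>M) = ennreal (\<integral>\<omega>. (norm (f \<omega>))\<^sup>2 \<partial>M)"
  using assms by (intro nn_integral_eq_integral) (auto simp: L2_def)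

lemma L2_I_nn_integral:
  assumes "f \<in> borel_measurable M" "(\<integral>\<^sup>+\<omega>. ennreal ((norm (f \<omega>))\<^sup>2) \<partial>M) < \<infinity>"
  shows "L2 M f"
  using assms unfolding L2_def by (auto intro!: integrableI_bounded)

lemma L2_integral_le_of_nn_integral_le:
  assumes "L2 M f" "(\<integral>\<^sup>+\<omega>. ennreal ((norm (f \<omega>))\<^sup>2) \<partial>M) \<le> ennreal c" "0 \<le> c"
  shows "(\<integral>\<omega>. (norm (f \<omega>))\<^sup>2 \<partial>M) \<le> c"
  using assms by (simp add: L2_nn_integral)

lemma nn_integral_norm_sq_add_le:
  assumes [measurable]: "f \<in> borel_measurable M" "g \<in> borel_measurable M"
  shows "(\<integral>\<^sup>+\<omega>. ennreal ((norm (f \<omega> + g \<omega> :: 'b::euclidean_space))\<^sup>2) \<partial>M) \<le>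
    2 * (\<integral>\<^sup>+\<omega>. ennreal ((norm (f \<omega>))\<^sup>2) \<partial>M) + 2 * (\<integral>\<^sup>+\<omega>. ennreal ((norm (g \<omega>))\<^sup>2) \<partial>M)"
proof -
  have "(\<integral>\<^sup>+\<omega>. ennreal ((norm (f \<omega> + g \<omega>))\<^sup>2) \<partial>M) \<le>
    (\<integral>\<^sup>+\<omega>. 2 * ennreal ((norm (f \<omega>))\<^sup>2) + 2 * ennreal ((norm (g \<omega>))\<^sup>2) \<partial>M)"
  proof (rule nn_integral_mono)
    fix \<omega>
    have "ennreal ((norm (f \<omega> + g \<omega>))\<^sup>2) \<le> ennreal (2 * (norm (f \<omega>))\<^sup>2 + 2 * (norm (g \<omega>))\<^sup>2)"
      by (intro ennreal_leI norm_add_sq_le)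
    also have "\<dots> = 2 * ennreal ((norm (f \<omega>))\<^sup>2) + 2 * ennreal ((norm (g \<omega>))\<^sup>2)"
      by (simp add: ennreal_plus ennreal_mult)
    finally show "ennreal ((norm (f \<omega> + g \<omega>))\<^sup>2) \<le> 2 * ennreal ((norm (f \<omega>))\<^sup>2) + 2 * ennreal ((norm (g \<omega>))\<^sup>2)" .
  qed
  also have "\<dots> = 2 * (\<integral>\<^sup>+\<omega>. ennreal ((norm (f \<omega>))\<^sup>2) \<partial>M) + 2 * (\<integral>\<^sup>+\<omega>. ennreal ((norm (g \<omega>))\<^sup>2) \<partial>M)"
    by (subst nn_integral_add) (auto simp: nn_integral_cmult)
  finally show ?thesis .
qed

lemma nn_integral_norm_sq_diff_le:
  assumes "f \<in> borel_measurable M" "g \<in> borel_measurable M"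
  shows "(\<integral>\<^sup>+\<omega>. ennreal ((norm (f \<omega> - g \<omega> :: 'b::euclidean_space))\<^sup>2) \<partial>M) \<le>
    2 * (\<integral>\<^sup>+\<omega>. ennreal ((norm (f \<omega>))\<^sup>2) \<partial>M) + 2 * (\<integral>\<^sup>+\<omega>. ennreal ((norm (g \<omega>))\<^sup>2) \<partial>M)"
  using nn_integral_norm_sq_add_le[of f M "\<lambda>\<omega>. - g \<omega>"] assms by simp

text \<open>Cauchy-Schwarz on a set of finite measure l, in a form that also covers f that is not
  square integrable on A: then the right-hand side is infinite because l > 0.\<close>

lemma norm_integral_sq_le:
  fixes f :: "'a \<Rightarrow> 'b::euclidean_space"
  assumes A[measurable]: "A \<in> sets M" and l: "emeasure M A = ennreal l" "0 < l"
    and f: "set_integrable M A f"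
  shows "ennreal ((norm (set_lebesgue_integral M A f))\<^sup>2) \<le>
    ennreal l * (\<integral>\<^sup>+x\<in>A. ennreal ((norm (f x))\<^sup>2) \<partial>M)"
proof (cases "(\<integral>\<^sup>+x\<in>A. ennreal ((norm (f x))\<^sup>2) \<partial>M) < \<infinity>")
  case False
  then have "(\<integral>\<^sup>+x\<in>A. ennreal ((norm (f x))\<^sup>2) \<partial>M) = top"
    by (simp add: less_top[symmetric])
  then show ?thesis using l by (simp add: ennreal_mult_top)
next
  case True
  define g where "g x = indicator A x *\<^sub>R f x" for x
  have g: "integrable M g" using f by (simp add: set_integrable_def g_def[abs_def])
  then have [measurable]: "g \<in> borel_measurable M" by auto
  have eq: "(\<integral>\<^sup>+x\<in>A. ennreal ((norm (f x))\<^sup>2) \<partial>M) = (\<integral>\<^sup>+x. ennreal ((norm (g x))\<^sup>2) \<partial>M)"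
    by (intro nn_integral_cong) (auto simp: g_def indicator_def)
  have g2: "L2 M g" by (rule L2_I_nn_integral) (use True eq in auto)
  define G where "G = (\<integral>x. norm (g x) \<partial>M)"
  \<comment> \<open>The mean of |f| over A. It minimises the integral of (|g| - c 1_A)^2, so
    nonnegativity of that integral is the sharp inequality.\<close>
  define c where "c = G / l"
  have ind: "integrable M (\<lambda>x. indicator A x :: real)"
    using l by (intro integrable_real_indicator) auto
  have "0 \<le> (\<integral>x. (norm (g x) - c * indicator A x)\<^sup>2 \<partial>M)"
    by simp
  also have "\<dots> = (\<integral>x. (norm (g x))\<^sup>2 + c\<^sup>2 * indicator A x - 2 * c * norm (g x) \<partial>M)"
    by (intro Bochner_Integration.integral_cong) (auto simp: g_def indicator_def power2_eq_square algebra_simps)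
  also have "\<dots> = (\<integral>x. (norm (g x))\<^sup>2 \<partial>M) + c\<^sup>2 * l - 2 * c * G"
    using ind g L2_integrable_norm_sq[OF g2] l by (simp add: G_def measure_def)
  also have "\<dots> = (\<integral>x. (norm (g x))\<^sup>2 \<partial>M) - G\<^sup>2 / l"
    using l by (simp add: c_def power2_eq_square field_simps)
  finally have "G\<^sup>2 \<le> l * (\<integral>x. (norm (g x))\<^sup>2 \<partial>M)" using l by (simp add: field_simps)
  moreover have "(norm (set_lebesgue_integral M A f))\<^sup>2 \<le> G\<^sup>2"
    unfolding set_lebesgue_integral_def G_def g_def[symmetric]
    by (intro power_mono) auto
  ultimately have "(norm (set_lebesgue_integral M A f))\<^sup>2 \<le> l * (\<integral>x. (norm (g x))\<^sup>2 \<partial>M)" by linarith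
  then have "ennreal ((norm (set_lebesgue_integral M A f))\<^sup>2) \<le> ennreal (l * (\<integral>x. (norm (g x))\<^sup>2 \<partial>M))"
    by (rule ennreal_leI)
  also have "\<dots> = ennreal l * (\<integral>\<^sup>+x\<in>A. ennreal ((norm (f x))\<^sup>2) \<partial>M)"
    using l L2_nn_integral[OF g2] eq by (simp add: ennreal_mult)
  finally show ?thesis .
qed

section \<open>Laws of random variables and their Wasserstein distance\<close>

lemma W2_sq_law_le:
  fixes \<xi> \<eta> :: "'w \<Rightarrow> 'a::euclidean_space"
  assumes "prob_space M" and [measurable]: "\<xi> \<in> borel_measurable M" "\<eta> \<in> borel_measurable M"
  shows "(W2 (law M \<xi>) (law M \<eta>))\<^sup>2 \<le> (\<integral>\<omega>. (norm (\<xi> \<omega> - \<eta> \<omega>))\<^sup>2 \<partial>M)"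
proof -
  interpret prob_space M by fact
  define \<pi> where "\<pi> = distr M (borel \<Otimes>\<^sub>M borel) (\<lambda>\<omega>. (\<xi> \<omega>, \<eta> \<omega>))"
  define c where "c \<pi> = (\<integral>z. (norm (fst z - snd z :: 'a))\<^sup>2 \<partial>\<pi>)" for \<pi> :: "('a \<times> 'a) measure"
  let ?C = "couplings (law M \<xi>) (law M \<eta>)"
  have \<pi>: "\<pi> \<in> ?C"
    unfolding couplings_def \<pi>_def
    by (auto intro!: prob_space_distr simp: distr_distr comp_def)
  have bdd: "bdd_below (c ` ?C)"
    by (intro bdd_belowI[of _ 0]) (auto simp: c_def)
  \<comment> \<open>Squaring \<open>W2\<close> returns the infimum only if it is nonnegative. The
    set of couplings contains \<pi>, so the real infimum is no default value.\<close>
  have "0 \<le> (INF \<pi>\<in>?C. c \<pi>)"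
    using \<pi> by (intro cINF_greatest) (auto simp: c_def)
  then have "(W2 (law M \<xi>) (law M \<eta>))\<^sup>2 = (INF \<pi>\<in>?C. c \<pi>)"
    by (simp add: W2_def c_def[abs_def])
  also have "\<dots> \<le> c \<pi>" by (rule cINF_lower[OF bdd \<pi>])
  also have "\<dots> = (\<integral>\<omega>. (norm (\<xi> \<omega> - \<eta> \<omega>))\<^sup>2 \<partial>M)"
    unfolding c_def \<pi>_def by (subst integral_distr) auto
  finally show ?thesis .
qed

lemma law_in_P2:
  assumes "prob_space M" "L2 M \<xi>" shows "law M \<xi> \<in> P2"
proof -
  have [measurable]: "\<xi> \<in> borel_measurable M" using assms(2) by (rule L2_measurable)
  show ?thesis
    using assms by (auto simp: P2_def L2_def integrable_distr_eq intro: prob_space.prob_space_distr)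
qed

lemma L2_of_law_in_P2:
  assumes [measurable]: "\<xi> \<in> borel_measurable M" and "law M \<xi> \<in> P2" shows "L2 M \<xi>"
  using assms by (auto simp: P2_def L2_def integrable_distr_eq)

lemma second_moment_law:
  assumes [measurable]: "\<xi> \<in> borel_measurable M"
  shows "second_moment (law M \<xi>) = (\<integral>\<omega>. (norm (\<xi> \<omega>))\<^sup>2 \<partial>M)"
  by (simp add: second_moment_def integral_distr)

text \<open>The function w = exp(- c t) u - v is nonincreasing, since its derivative is at most
  (exp(- c t) - 1) \<psi> \<le> 0. The bound concerns the integral of \<phi>; inserted once more
  into the hypothesis it keeps the term \<psi> t, which varies with time.\<close>

lemma gronwall_pathwise:
  fixes \<phi> \<psi> :: "real \<Rightarrow> real"
  assumes cont: "continuous_on {0..T} \<phi>" "continuous_on {0..T} \<psi>"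
    and nn: "\<And>t. t \<in> {0..T} \<Longrightarrow> 0 \<le> \<phi> t" "\<And>t. t \<in> {0..T} \<Longrightarrow> 0 \<le> \<psi> t" and "0 \<le> c"
    and le: "\<And>t. t \<in> {0..T} \<Longrightarrow> \<phi> t \<le> \<psi> t + c * integral {0..t} \<phi>"
    and t: "t \<in> {0..T}"
  shows "integral {0..t} \<phi> \<le> exp (c * T) * integral {0..T} \<psi>"
proof -
  define u where "u t = integral {0..t} \<phi>" for t
  define v where "v t = integral {0..t} \<psi>" for t
  define w where "w t = exp (- c * t) * u t - v t" for t
  have T: "0 \<le> T" using t by auto
  have u': "(u has_real_derivative \<phi> x) (at x within {0..T})"
    and v': "(v has_real_derivative \<psi> x) (at x within {0..T})" if "x \<in> {0..T}" for x
    unfolding u_def v_def has_real_derivative_iff_has_vector_derivative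
    by (rule integral_has_vector_derivative[OF cont(1) that], rule integral_has_vector_derivative[OF cont(2) that])
  have w': "(w has_real_derivative (exp (- c * x) * (\<phi> x - c * u x) - \<psi> x)) (at x within {0..T})"
    if "x \<in> {0..T}" for x
    unfolding w_def
    by (auto intro!: derivative_eq_intros u'[OF that] v'[OF that] simp: algebra_simps)
  have "w t \<le> w 0"
  proof (rule DERIV_nonpos_imp_decreasing_open[of 0 t w])
    show "0 \<le> t" using t by simp
    show "continuous_on {0..t} w"
      by (rule continuous_on_subset[OF DERIV_continuous_on[OF w']]) (use t in auto)
    fix x assume x: "0 < x" "x < t"
    have "(w has_real_derivative (exp (- c * x) * (\<phi> x - c * u x) - \<psi> x)) (at x)"
    proof -
      have "x \<in> {0..T}" and "at x within {0..T} = at x"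
        using x t by (auto intro!: at_within_Icc_at)
      with w' show ?thesis by metis
    qed
    moreover have "exp (- c * x) * (\<phi> x - c * u x) \<le> 1 * \<psi> x"
    proof -
      have "exp (- c * x) * (\<phi> x - c * u x) \<le> exp (- c * x) * \<psi> x"
      proof (rule mult_left_mono)
        have "x \<in> {0..T}" using x t by auto
        from le[OF this] show "\<phi> x - c * u x \<le> \<psi> x" by (simp add: u_def)
      qed simp
      also have "\<dots> \<le> 1 * \<psi> x"
      proof (rule mult_right_mono)
        have "x \<in> {0..T}" using x t by auto
        then show "0 \<le> \<psi> x" by (rule nn(2))
      qed (use x \<open>0 \<le> c\<close> in simp)
      finally show ?thesis .
    qed
    ultimately show "\<exists>y. (w has_real_derivative y) (at x) \<and> y \<le> 0"
      by (intro exI[of _ "exp (- c * x) * (\<phi> x - c * u x) - \<psi> x"]) linarith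
  qed
  then have "exp (- c * t) * u t \<le> v t" by (simp add: w_def u_def v_def)
  then have "exp (c * t) * (exp (- c * t) * u t) \<le> exp (c * t) * v t"
    by (intro mult_left_mono) auto
  then have "u t \<le> exp (c * t) * v t"
    by (simp add: mult.assoc[symmetric] exp_add[symmetric])
  also have "\<dots> \<le> exp (c * T) * v T"
  proof (rule mult_mono)
    have int: "\<psi> integrable_on {0..T}" "\<psi> integrable_on {0..t}"
      using t by (auto intro!: integrable_continuous_interval continuous_on_subset[OF cont(2)])
    show "v t \<le> v T" unfolding v_def
      using t nn(2) int by (intro integral_subset_le) auto
    show "0 \<le> v t" unfolding v_def
      using t nn(2) int by (intro integral_nonneg) auto
    show "exp (c * t) \<le> exp (c * T)" using t \<open>0 \<le> c\<close> by (simp add: mult_left_mono)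
  qed simp
  finally show ?thesis by (simp add: u_def v_def)
qed

text \<open>Uses 1 + p \<le> exp p at each step. The factor \<open>real k\<close> stays apart from
  q: with q of order h^2 and k h \<le> T it turns one-step errors of order h^2 into a global one of
  order h.\<close>

lemma gronwall_discrete:
  fixes u :: "nat \<Rightarrow> real"
  assumes "u 0 \<le> 0" "0 \<le> p" "0 \<le> q"
    and "\<And>k. k < n \<Longrightarrow> u (Suc k) \<le> (1 + p) * u k + q"
    and "k \<le> n"
  shows "u k \<le> real k * q * exp (p * real k)"
  using \<open>k \<le> n\<close>
proof (induction k)
  case (Suc k)
  have "u (Suc k) \<le> (1 + p) * u k + q" using assms Suc by simp
  also have "\<dots> \<le> (1 + p) * (real k * q * exp (p * real k)) + q"
    using Suc \<open>0 \<le> p\<close> by (intro add_right_mono mult_left_mono) auto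
  also have "\<dots> \<le> exp p * (real k * q * exp (p * real k)) + q * exp (p * real (Suc k))"
  proof (intro add_mono)
    show "(1 + p) * (real k * q * exp (p * real k)) \<le> exp p * (real k * q * exp (p * real k))"
      using assms by (intro mult_right_mono exp_ge_add_one_self) auto
    have "1 \<le> exp (p * real (Suc k))" using assms by simp
    then show "q \<le> q * exp (p * real (Suc k))"
      using mult_left_mono[of 1 _ q] assms by simp
  qed
  also have "\<dots> = real (Suc k) * q * exp (p * real (Suc k))"
    by (simp add: algebra_simps exp_add)
  finally show ?case .
qed (use assms in auto)

section \<open>Increments of Brownian motion\<close>

text \<open>Fubini for products of functions of one coordinate. \<open>lborel\<close> is the image
  of a product measure indexed by \<open>Basis\<close>, not by the coordinates, so \<open>ax\<close>
  identifies a coordinate with its unit vector and \<open>inv ax\<close> carries the factors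
  over.\<close>

lemma
  fixes f :: "'n::finite \<Rightarrow> real \<Rightarrow> real"
  assumes f: "\<And>i. integrable lborel (f i)"
  shows integrable_lborel_vec_prod: "integrable lborel (\<lambda>x::real^'n. \<Prod>i\<in>UNIV. f i (x $ i))"
    and integral_lborel_vec_prod:
      "(\<integral>x. (\<Prod>i\<in>UNIV. f i (x $ i)) \<partial>(lborel :: (real^'n) measure)) = (\<Prod>i\<in>UNIV. integral\<^sup>L lborel (f i))"
proof -
  interpret product_sigma_finite "\<lambda>_::real^'n. lborel :: real measure" ..
  define ax where "ax i = (axis i 1 :: real^'n)" for i
  have inj: "inj ax" by (auto simp: inj_def ax_def axis_eq_axis)
  have Basis: "Basis = range ax" by (auto simp: Basis_vec_def ax_def)
  define g where "g b = f (inv ax b)" for b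
  have g: "integrable lborel (g b)" for b by (simp add: g_def f)
  have [measurable]: "f i \<in> borel_measurable borel" for i
    using f[of i] by (auto dest: borel_measurable_integrable)
  have eq: "(\<Prod>i\<in>UNIV. f i ((\<Sum>b\<in>Basis. y b *\<^sub>R b) $ i)) = (\<Prod>b\<in>Basis. g b (y b))" for y :: "real^'n \<Rightarrow> real"
  proof -
    have "(\<Sum>b\<in>Basis. y b *\<^sub>R b) $ i = y (ax i)" for i
    proof -
      have "(\<Sum>b\<in>Basis. y b *\<^sub>R b) $ i = (\<Sum>j\<in>UNIV. y (ax j) * (ax j $ i))"
        unfolding Basis using inj by (simp add: sum.reindex sum_component)
      also have "\<dots> = (\<Sum>j\<in>UNIV. if j = i then y (ax j) else 0)"
        by (intro sum.cong) (auto simp: ax_def axis_def)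
      finally show ?thesis by simp
    qed
    then show ?thesis
      unfolding Basis using inj by (simp add: prod.reindex g_def)
  qed
  have meas: "(\<lambda>y. \<Sum>b\<in>Basis. y b *\<^sub>R b) \<in> measurable (\<Pi>\<^sub>M b\<in>Basis. lborel) (borel :: (real^'n) measure)"
    by measurable
  have mf: "(\<lambda>x::real^'n. \<Prod>i\<in>UNIV. f i (x $ i)) \<in> borel_measurable borel"
    by measurable
  show "integrable lborel (\<lambda>x::real^'n. \<Prod>i\<in>UNIV. f i (x $ i))"
    by (subst lborel_eq, subst integrable_distr_eq[OF meas mf])
       (simp only: eq product_integrable_prod[OF finite_Basis g])
  have "(\<integral>x. (\<Prod>i\<in>UNIV. f i (x $ i)) \<partial>(lborel :: (real^'n) measure)) = (\<Prod>b\<in>Basis. integral\<^sup>L lborel (g b))"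
    by (subst lborel_eq, subst integral_distr[OF meas mf])
       (simp only: eq product_integral_prod[OF finite_Basis g])
  also have "\<dots> = (\<Prod>i\<in>UNIV. integral\<^sup>L lborel (f i))"
    unfolding Basis using inj by (simp add: prod.reindex g_def)
  finally show "(\<integral>x. (\<Prod>i\<in>UNIV. f i (x $ i)) \<partial>(lborel :: (real^'n) measure)) = (\<Prod>i\<in>UNIV. integral\<^sup>L lborel (f i))" .
qed

locale brownian_space = complete_filtered_prob_space M F
  for M :: "'w measure" and F :: "real \<Rightarrow> 'w measure" +
  fixes W :: "real \<Rightarrow> 'w \<Rightarrow> real^'n"
  assumes bm: "brownian_motion M F W"
begin

lemma measurable_F_mono: "s \<le> t \<Longrightarrow> f \<in> borel_measurable (F s) \<Longrightarrow> f \<in> borel_measurable (F t)"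
  using measurable_mono[of borel borel "F s" "F t"] sets_F_mono[of s t] space_F by auto

lemma measurable_F_M: "f \<in> borel_measurable (F s) \<Longrightarrow> f \<in> borel_measurable M"
  using measurable_mono[of borel borel "F s" M] sets_F_subset[of s] space_F by auto

lemma measurable_W: "0 \<le> t \<Longrightarrow> W t \<in> borel_measurable (F t)"
  using bm by (auto simp: brownian_motion_def)

lemma measurable_incr:
  assumes "0 \<le> s" "s \<le> t" shows "(\<lambda>\<omega>. W t \<omega> - W s \<omega>) \<in> borel_measurable (F t)"
  using assms measurable_F_mono[OF _ measurable_W, of s t] measurable_W[of t]
  by (intro borel_measurable_diff) auto

text \<open>The density of an increment is a product of one-dimensional normal densities, so every
  mixed moment factorises. The first and second moments below are instances for particular exponents
  \<open>e\<close>.\<close>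

lemma incr_monomial:
  assumes "0 \<le> s" "s < t"
  shows "integrable M (\<lambda>\<omega>. \<Prod>k\<in>UNIV. ((W t \<omega> - W s \<omega>) $ k) ^ e k)"
    and "(\<integral>\<omega>. (\<Prod>k\<in>UNIV. ((W t \<omega> - W s \<omega>) $ k) ^ e k) \<partial>M) =
      (\<Prod>k\<in>UNIV. \<integral>x. normal_density 0 (sqrt (t - s)) x * x ^ e k \<partial>lborel)"
proof -
  let ?d = "\<lambda>x::real^'n. \<Prod>k\<in>UNIV. normal_density 0 (sqrt (t - s)) (x $ k)"
  let ?q = "\<lambda>x::real^'n. \<Prod>k\<in>UNIV. (x $ k) ^ e k"
  have D: "distributed M lborel (\<lambda>\<omega>. W t \<omega> - W s \<omega>) (\<lambda>x. ennreal (?d x))"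
    using bm assms by (auto simp: brownian_motion_def)
  have q: "?q \<in> borel_measurable lborel" by measurable
  have d: "0 \<le> ?d x" for x by (intro prod_nonneg) auto
  have eq: "(\<lambda>x. ?d x * ?q x) = (\<lambda>x. \<Prod>k\<in>UNIV. (\<lambda>y. normal_density 0 (sqrt (t - s)) y * y ^ e k) (x $ k))"
    by (simp only: prod.distrib)
  let ?f = "\<lambda>k y. normal_density 0 (sqrt (t - s)) y * y ^ e k"
  have int: "integrable lborel (?f k)" for k
    using integrable_normal_moment[of "sqrt (t - s)" 0 "e k"] assms by simp
  have "integrable lborel (\<lambda>x. ?d x * ?q x)"
    by (subst eq) (rule integrable_lborel_vec_prod[of ?f, OF int])
  with distributed_integrable[OF D q d] show "integrable M (\<lambda>\<omega>. ?q (W t \<omega> - W s \<omega>))"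
    by (rule iffD1)
  have "(\<integral>\<omega>. ?q (W t \<omega> - W s \<omega>) \<partial>M) = (\<integral>x. ?d x * ?q x \<partial>lborel)"
    by (rule distributed_integral[OF D q d, symmetric])
  also have "\<dots> = (\<Prod>k\<in>UNIV. integral\<^sup>L lborel (?f k))"
    by (subst eq) (rule integral_lborel_vec_prod[of ?f, OF int])
  finally show "(\<integral>\<omega>. ?q (W t \<omega> - W s \<omega>) \<partial>M) = (\<Prod>k\<in>UNIV. integral\<^sup>L lborel (?f k))" .
qed

lemma
  assumes "0 \<le> s" "s \<le> t"
  shows incr_integrable: "integrable M (\<lambda>\<omega>. (W t \<omega> - W s \<omega>) $ i)"
    and incr_mean: "(\<integral>\<omega>. (W t \<omega> - W s \<omega>) $ i \<partial>M) = 0"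
    and incr_mult_integrable: "integrable M (\<lambda>\<omega>. (W t \<omega> - W s \<omega>) $ i * (W t \<omega> - W s \<omega>) $ j)"
    and incr_covariance: "(\<integral>\<omega>. (W t \<omega> - W s \<omega>) $ i * (W t \<omega> - W s \<omega>) $ j \<partial>M) = (if i = j then t - s else 0)"
proof -
  have "integrable M (\<lambda>\<omega>. (W t \<omega> - W s \<omega>) $ i) \<and> (\<integral>\<omega>. (W t \<omega> - W s \<omega>) $ i \<partial>M) = 0 \<and>
    integrable M (\<lambda>\<omega>. (W t \<omega> - W s \<omega>) $ i * (W t \<omega> - W s \<omega>) $ j) \<and>
    (\<integral>\<omega>. (W t \<omega> - W s \<omega>) $ i * (W t \<omega> - W s \<omega>) $ j \<partial>M) = (if i = j then t - s else 0)"
  \<comment> \<open>The definition of Brownian motion speaks of s < t only; for s = t the increment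
    is 0 and all four claims are trivial.\<close>
  proof (cases "s = t")
    case False
    with assms have st: "0 \<le> s" "s < t" by auto
    define m where "m k = (\<integral>x. normal_density 0 (sqrt (t - s)) x * x ^ k \<partial>lborel)" for k
    have m0: "m 0 = 1" using st by (simp add: m_def)
    have m1: "m 1 = 0" using integral_normal_moment_odd[of "sqrt (t - s)" 0 0] st by (simp add: m_def)
    have m2: "m 2 = t - s"
      using integral_normal_moment_even[of "sqrt (t - s)" 0 1] st by (simp add: m_def)
    \<comment> \<open>Exponents of the monomial x_j; the sum of two such vectors gives the product
      x_i x_j.\<close>
    define e where "e j k = (if k = j then 1 else 0 :: nat)" for j k :: 'n
    have p1: "(\<Prod>k\<in>UNIV. (x $ k) ^ e i k) = x $ i" for x :: "real^'n" and i
      by (simp add: e_def if_distrib[of "\<lambda>n. _ ^ n"] cong: if_cong)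
    have p2: "(\<Prod>k\<in>UNIV. (x $ k) ^ (e i k + e j k)) = x $ i * x $ j" for x :: "real^'n"
      by (simp only: power_add prod.distrib p1)
    have "(\<Prod>k\<in>UNIV. m (e i k)) = 0"
      by (rule prod_zero) (auto simp: e_def m1[simplified] intro!: exI[of _ i])
    moreover have "(\<Prod>k\<in>UNIV. m (e i k + e j k)) = (if i = j then t - s else 0)"
    proof (cases "i = j")
      case True
      then have "(\<Prod>k\<in>UNIV. m (e i k + e j k)) = (\<Prod>k\<in>UNIV. if k = j then m 2 else 1)"
        by (intro prod.cong) (auto simp: e_def m0 numeral_2_eq_2)
      with True m2 show ?thesis by simp
    next
      case False
      then have "(\<Prod>k\<in>UNIV. m (e i k + e j k)) = 0"
        by (intro prod_zero) (auto simp: e_def m1[simplified] intro!: exI[of _ i])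
      with False show ?thesis by simp
    qed
    ultimately show ?thesis
      using incr_monomial[OF st, of "e i"] incr_monomial[OF st, of "\<lambda>k. e i k + e j k"]
      unfolding p1 p2 m_def[symmetric] by simp
  qed simp
  then show "integrable M (\<lambda>\<omega>. (W t \<omega> - W s \<omega>) $ i)" "(\<integral>\<omega>. (W t \<omega> - W s \<omega>) $ i \<partial>M) = 0"
    "integrable M (\<lambda>\<omega>. (W t \<omega> - W s \<omega>) $ i * (W t \<omega> - W s \<omega>) $ j)"
    "(\<integral>\<omega>. (W t \<omega> - W s \<omega>) $ i * (W t \<omega> - W s \<omega>) $ j \<partial>M) = (if i = j then t - s else 0)"
    by auto
qed

text \<open>Independence of the increment from \<open>F s\<close>, turned into a product formula.
  The definition gives it for sets; the sigma-algebra of g lies in \<open>F s\<close>, and that of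
  \<open>q \<circ> D\<close> lies in the preimages under D, which already form a
  sigma-algebra.\<close>

lemma
  fixes g :: "'w \<Rightarrow> real" and q :: "real^'n \<Rightarrow> real"
  assumes st: "0 \<le> s" "s \<le> t" and g: "g \<in> borel_measurable (F s)" "integrable M g"
    and q: "q \<in> borel_measurable borel" "integrable M (\<lambda>\<omega>. q (W t \<omega> - W s \<omega>))"
  shows integrable_mult_incr: "integrable M (\<lambda>\<omega>. g \<omega> * q (W t \<omega> - W s \<omega>))"
    and integral_mult_incr: "(\<integral>\<omega>. g \<omega> * q (W t \<omega> - W s \<omega>) \<partial>M) =
      (\<integral>\<omega>. g \<omega> \<partial>M) * (\<integral>\<omega>. q (W t \<omega> - W s \<omega>) \<partial>M)"
proof -
  have "integrable M (\<lambda>\<omega>. g \<omega> * q (W t \<omega> - W s \<omega>)) \<and> (\<integral>\<omega>. g \<omega> * q (W t \<omega> - W s \<omega>) \<partial>M) =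
      (\<integral>\<omega>. g \<omega> \<partial>M) * (\<integral>\<omega>. q (W t \<omega> - W s \<omega>) \<partial>M)"
  proof (cases "s = t")
    case True
    then show ?thesis using g prob_space by simp
  next
    case False
    define D where "D = (\<lambda>\<omega>. W t \<omega> - W s \<omega>)"
    have D[measurable]: "D \<in> borel_measurable M"
      unfolding D_def using measurable_F_M[OF measurable_incr[OF st]] .
    have "indep_set (sets (F s)) {D -` A \<inter> space M | A. A \<in> sets borel}"
      using bm st False by (auto simp: brownian_motion_def D_def)
    then have "indep_set (sigma_sets (space M) {g -` A \<inter> space M | A. A \<in> sets borel})
      (sigma_sets (space M) {(q \<circ> D) -` A \<inter> space M | A. A \<in> sets borel})"
      unfolding indep_sets2_eq
    proof (elim conjE, intro conjI)
      assume H: "sets (F s) \<subseteq> events" "{D -` A \<inter> space M |A. A \<in> sets borel} \<subseteq> events"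
        "\<forall>a\<in>sets (F s). \<forall>b\<in>{D -` A \<inter> space M |A. A \<in> sets borel}. prob (a \<inter> b) = prob a * prob b"
      have 1: "sigma_sets (space M) {g -` A \<inter> space M | A. A \<in> sets borel} \<subseteq> sets (F s)"
      proof -
        have "{g -` A \<inter> space M | A. A \<in> sets borel} \<subseteq> sets (F s)"
          using measurable_sets[OF g(1)] unfolding space_F by blast
        from sets.sigma_sets_subset[OF this] show ?thesis unfolding space_F .
      qed
      have 2: "sigma_sets (space M) {(q \<circ> D) -` A \<inter> space M | A. A \<in> sets borel}
          \<subseteq> {D -` A \<inter> space M |A. A \<in> sets borel}"
      proof -
        have *: "{D -` A \<inter> space M |A. A \<in> sets borel} = sets (vimage_algebra (space M) D borel)"
          by (rule sets_vimage_algebra2[symmetric]) simp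
        have "{(q \<circ> D) -` A \<inter> space M | A. A \<in> sets borel} \<subseteq> {D -` A \<inter> space M |A. A \<in> sets borel}"
        proof clarify
          fix A :: "real set" assume "A \<in> sets borel"
          then show "\<exists>B. (q \<circ> D) -` A \<inter> space M = D -` B \<inter> space M \<and> B \<in> sets borel"
            using q(1) by (intro exI[of _ "q -` A"]) (auto simp: measurable_def)
        qed
        then show ?thesis
          unfolding * using sets.sigma_sets_subset[of _ "vimage_algebra (space M) D borel"] by simp
      qed
      show "sigma_sets (space M) {g -` A \<inter> space M | A. A \<in> sets borel} \<subseteq> events" using 1 H(1) by blast
      show "sigma_sets (space M) {(q \<circ> D) -` A \<inter> space M | A. A \<in> sets borel} \<subseteq> events" using 2 H(2) by blast
      show "\<forall>a\<in>sigma_sets (space M) {g -` A \<inter> space M |A. A \<in> sets borel}.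
          \<forall>b\<in>sigma_sets (space M) {(q \<circ> D) -` A \<inter> space M |A. A \<in> sets borel}. prob (a \<inter> b) = prob a * prob b"
        using 1 2 H(3) by blast
    qed
    then have ind: "indep_var borel g borel (q \<circ> D)"
      unfolding indep_var_eq using measurable_F_M[OF g(1)] measurable_comp[OF D q(1)] by blast
    have "integrable M (q \<circ> D)" using q(2) by (simp add: D_def comp_def)
    from indep_var_lebesgue_integral[OF ind g(2) this] indep_var_integrable[OF ind g(2) this]
    show ?thesis by (simp add: D_def)
  qed
  then show "integrable M (\<lambda>\<omega>. g \<omega> * q (W t \<omega> - W s \<omega>))"
    "(\<integral>\<omega>. g \<omega> * q (W t \<omega> - W s \<omega>) \<partial>M) = (\<integral>\<omega>. g \<omega> \<partial>M) * (\<integral>\<omega>. q (W t \<omega> - W s \<omega>) \<partial>M)"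
    by auto
qed

end

section \<open>Brownian increments with matrix coefficients\<close>

lemma continuous_on_matrix_vector_mult:
  fixes f :: "'a::topological_space \<Rightarrow> real^'m^'n"
  assumes "continuous_on S f" "continuous_on S g"
  shows "continuous_on S (\<lambda>x. f x *v g x)"
  unfolding matrix_vector_mult_def by (intro continuous_intros assms)

lemma borel_measurable_matrix_vector_mult[measurable (raw)]:
  fixes f :: "'a \<Rightarrow> real^'m^'n"
  assumes "f \<in> borel_measurable M" "g \<in> borel_measurable M"
  shows "(\<lambda>x. f x *v g x) \<in> borel_measurable M"
  by (rule borel_measurable_continuous_Pair[OF assms])
     (auto intro!: continuous_on_matrix_vector_mult continuous_intros)

lemma inner_matrix_eq: "(A :: real^'m^'n) \<bullet> B = (\<Sum>k\<in>UNIV. \<Sum>i\<in>UNIV. A $ k $ i * B $ k $ i)"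
  by (simp add: inner_vec_def)

lemma integral_sum_UNIV2:
  fixes f :: "'i::finite \<Rightarrow> 'j::finite \<Rightarrow> 'w \<Rightarrow> real"
  assumes "\<And>i j. integrable M (f i j)"
  shows "(\<integral>\<omega>. (\<Sum>i\<in>UNIV. \<Sum>j\<in>UNIV. f i j \<omega>) \<partial>M) = (\<Sum>i\<in>UNIV. \<Sum>j\<in>UNIV. integral\<^sup>L M (f i j))"
  using assms by (simp add: Bochner_Integration.integral_sum)

context brownian_space
begin

text \<open>Coordinatewise, each term is an integrable \<open>F s\<close>-measurable factor times an
  independent increment of mean 0. Independence also yields integrability, although the coefficients
  may be unbounded.\<close>

lemma integral_inner_incr:
  fixes U :: "'w \<Rightarrow> real^'n" and \<xi> :: "'w \<Rightarrow> real^'n^'n"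
  assumes st: "0 \<le> s" "s \<le> t"
    and U: "U \<in> borel_measurable (F s)" "L2 M U"
    and \<xi>: "\<xi> \<in> borel_measurable (F s)" "L2 M \<xi>"
  shows "integrable M (\<lambda>\<omega>. U \<omega> \<bullet> (\<xi> \<omega> *v (W t \<omega> - W s \<omega>)))"
    and "(\<integral>\<omega>. U \<omega> \<bullet> (\<xi> \<omega> *v (W t \<omega> - W s \<omega>)) \<partial>M) = 0"
proof -
  define D where "D \<omega> = W t \<omega> - W s \<omega>" for \<omega>
  have eq: "U \<omega> \<bullet> (\<xi> \<omega> *v D \<omega>) = (\<Sum>k\<in>UNIV. \<Sum>i\<in>UNIV. U \<omega> $ k * \<xi> \<omega> $ k $ i * D \<omega> $ i)" for \<omega>
    by (simp add: inner_vec_def matrix_vector_mult_def sum_distrib_left mult.assoc)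
  have nth: "(\<lambda>x::real^'n. x $ i) \<in> borel_measurable borel" for i by measurable
  have g: "(\<lambda>\<omega>. U \<omega> $ k * \<xi> \<omega> $ k $ i) \<in> borel_measurable (F s)"
    "integrable M (\<lambda>\<omega>. U \<omega> $ k * \<xi> \<omega> $ k $ i)" for k i
  proof -
    have "(\<lambda>x::real^'n^'n. x $ k $ i) \<in> borel_measurable borel"
      by (intro borel_measurable_continuous_onI continuous_intros)
    from measurable_compose[OF \<xi>(1) this] measurable_compose[OF U(1) nth]
    show "(\<lambda>\<omega>. U \<omega> $ k * \<xi> \<omega> $ k $ i) \<in> borel_measurable (F s)"
      by (rule borel_measurable_times[rotated])
    show "integrable M (\<lambda>\<omega>. U \<omega> $ k * \<xi> \<omega> $ k $ i)"
      by (intro L2_real_mult_integrable L2_component U \<xi>)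
  qed
  have int: "integrable M (\<lambda>\<omega>. U \<omega> $ k * \<xi> \<omega> $ k $ i * D \<omega> $ i)"
    and zero: "(\<integral>\<omega>. U \<omega> $ k * \<xi> \<omega> $ k $ i * D \<omega> $ i \<partial>M) = 0" for k i
    using integrable_mult_incr[OF st g(1)[of k i] g(2)[of k i] nth[of i]]
      integral_mult_incr[OF st g(1)[of k i] g(2)[of k i] nth[of i]]
      incr_integrable[OF st] incr_mean[OF st]
    by (auto simp: D_def)
  show "integrable M (\<lambda>\<omega>. U \<omega> \<bullet> (\<xi> \<omega> *v (W t \<omega> - W s \<omega>)))"
    unfolding D_def[symmetric] eq using int by (intro Bochner_Integration.integrable_sum)
  show "(\<integral>\<omega>. U \<omega> \<bullet> (\<xi> \<omega> *v (W t \<omega> - W s \<omega>)) \<partial>M) = 0"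
    unfolding D_def[symmetric] eq by (simp add: integral_sum_UNIV2[OF int] zero)
qed

text \<open>The isometry on one interval in polarised form: the covariance (t - s) \<delta>_ij
  leaves only i = j in the triple sum, which is the Hilbert-Schmidt inner product. Equal
  coefficients then show that such an integral is square integrable.\<close>

lemma integral_incr_inner_incr:
  fixes \<xi> \<eta> :: "'w \<Rightarrow> real^'n^'n"
  assumes st: "0 \<le> s" "s \<le> t"
    and \<xi>: "\<xi> \<in> borel_measurable (F s)" "L2 M \<xi>"
    and \<eta>: "\<eta> \<in> borel_measurable (F s)" "L2 M \<eta>"
  shows "integrable M (\<lambda>\<omega>. (\<xi> \<omega> *v (W t \<omega> - W s \<omega>)) \<bullet> (\<eta> \<omega> *v (W t \<omega> - W s \<omega>)))"
    and "(\<integral>\<omega>. (\<xi> \<omega> *v (W t \<omega> - W s \<omega>)) \<bullet> (\<eta> \<omega> *v (W t \<omega> - W s \<omega>)) \<partial>M) =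
      (t - s) * (\<integral>\<omega>. \<xi> \<omega> \<bullet> \<eta> \<omega> \<partial>M)"
proof -
  define D where "D \<omega> = W t \<omega> - W s \<omega>" for \<omega>
  define f where "f k i j \<omega> = \<xi> \<omega> $ k $ i * \<eta> \<omega> $ k $ j * (D \<omega> $ i * D \<omega> $ j)" for k i j \<omega>
  have eq: "(\<xi> \<omega> *v D \<omega>) \<bullet> (\<eta> \<omega> *v D \<omega>) = (\<Sum>k\<in>UNIV. \<Sum>i\<in>UNIV. \<Sum>j\<in>UNIV. f k i j \<omega>)" for \<omega>
    unfolding f_def inner_vec_def matrix_vector_mult_def inner_real_def vec_lambda_beta
    by (intro sum.cong refl, subst sum_product, intro sum.cong refl) (simp add: ac_simps)
  have q: "(\<lambda>x::real^'n. x $ i * x $ j) \<in> borel_measurable borel" for i j by measurable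
  have nth: "(\<lambda>x::real^'n^'n. x $ k $ i) \<in> borel_measurable borel" for k i
    by (intro borel_measurable_continuous_onI continuous_intros)
  have g: "(\<lambda>\<omega>. \<xi> \<omega> $ k $ i * \<eta> \<omega> $ k $ j) \<in> borel_measurable (F s)"
    "integrable M (\<lambda>\<omega>. \<xi> \<omega> $ k $ i * \<eta> \<omega> $ k $ j)" for k i j
    using measurable_compose[OF \<xi>(1) nth] measurable_compose[OF \<eta>(1) nth]
    by (intro borel_measurable_times L2_real_mult_integrable L2_component \<xi> \<eta>; simp)+
  have int: "integrable M (f k i j)"
    and val: "integral\<^sup>L M (f k i j) = (if i = j then (\<integral>\<omega>. \<xi> \<omega> $ k $ i * \<eta> \<omega> $ k $ i \<partial>M) * (t - s) else 0)" for k i j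
    using integrable_mult_incr[OF st g(1)[of k i j] g(2)[of k i j] q[of i j]]
      integral_mult_incr[OF st g(1)[of k i j] g(2)[of k i j] q[of i j]]
      incr_mult_integrable[OF st, of i j] incr_covariance[OF st, of i j]
    by (auto simp: D_def f_def[abs_def])
  show "integrable M (\<lambda>\<omega>. (\<xi> \<omega> *v (W t \<omega> - W s \<omega>)) \<bullet> (\<eta> \<omega> *v (W t \<omega> - W s \<omega>)))"
    unfolding D_def[symmetric] eq by (intro Bochner_Integration.integrable_sum int)
  have "(\<integral>\<omega>. (\<xi> \<omega> *v D \<omega>) \<bullet> (\<eta> \<omega> *v D \<omega>) \<partial>M) = (\<Sum>k\<in>UNIV. \<Sum>i\<in>UNIV. \<Sum>j\<in>UNIV. integral\<^sup>L M (f k i j))"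
    unfolding eq by (simp add: int Bochner_Integration.integral_sum)
  also have "\<dots> = (t - s) * (\<Sum>k\<in>UNIV. \<Sum>i\<in>UNIV. (\<integral>\<omega>. \<xi> \<omega> $ k $ i * \<eta> \<omega> $ k $ i \<partial>M))"
    by (simp add: val sum_distrib_left sum_distrib_right mult.commute[of "t - s"])
  also have "(\<Sum>k\<in>UNIV. \<Sum>i\<in>UNIV. (\<integral>\<omega>. \<xi> \<omega> $ k $ i * \<eta> \<omega> $ k $ i \<partial>M)) = (\<integral>\<omega>. \<xi> \<omega> \<bullet> \<eta> \<omega> \<partial>M)"
    unfolding inner_matrix_eq by (subst integral_sum_UNIV2) (auto simp: g)
  finally show "(\<integral>\<omega>. (\<xi> \<omega> *v (W t \<omega> - W s \<omega>)) \<bullet> (\<eta> \<omega> *v (W t \<omega> - W s \<omega>)) \<partial>M) =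
      (t - s) * (\<integral>\<omega>. \<xi> \<omega> \<bullet> \<eta> \<omega> \<partial>M)"
    by (simp add: D_def)
qed

lemma L2_mult_incr:
  fixes \<xi> :: "'w \<Rightarrow> real^'n^'n"
  assumes "0 \<le> s" "s \<le> t" "\<xi> \<in> borel_measurable (F s)" "L2 M \<xi>"
  shows "L2 M (\<lambda>\<omega>. \<xi> \<omega> *v (W t \<omega> - W s \<omega>))"
  unfolding L2_iff_inner_integrable
  using integral_incr_inner_incr(1)[OF assms(1,2) assms(3,4) assms(3,4)]
    measurable_F_M[OF assms(3)] measurable_F_M[OF measurable_incr[OF assms(1,2)]]
  by auto

lemma measurable_mult_incr:
  fixes \<xi> :: "'w \<Rightarrow> real^'n^'n"
  assumes "0 \<le> s" "s \<le> t" "\<xi> \<in> borel_measurable (F s)"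
  shows "(\<lambda>\<omega>. \<xi> \<omega> *v (W t \<omega> - W s \<omega>)) \<in> borel_measurable (F t)"
  using measurable_F_mono[OF assms(2,3)] measurable_incr[OF assms(1,2)] by measurable

text \<open>Both increments are split at the endpoints of the intersection of the two intervals; only
  the common part contributes.\<close>

lemma integral_incr_inner_incr_overlap:
  fixes \<xi> \<eta> :: "'w \<Rightarrow> real^'n^'n"
  assumes ab: "0 \<le> a" "a \<le> b" and cd: "a \<le> c" "c \<le> d"
    and \<xi>: "\<xi> \<in> borel_measurable (F a)" "L2 M \<xi>"
    and \<eta>: "\<eta> \<in> borel_measurable (F c)" "L2 M \<eta>"
  shows "integrable M (\<lambda>\<omega>. (\<xi> \<omega> *v (W b \<omega> - W a \<omega>)) \<bullet> (\<eta> \<omega> *v (W d \<omega> - W c \<omega>)))"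
    and "(\<integral>\<omega>. (\<xi> \<omega> *v (W b \<omega> - W a \<omega>)) \<bullet> (\<eta> \<omega> *v (W d \<omega> - W c \<omega>)) \<partial>M) =
      max 0 (min b d - c) * (\<integral>\<omega>. \<xi> \<omega> \<bullet> \<eta> \<omega> \<partial>M)"
proof -
  let ?D = "\<lambda>s t \<omega>. W t \<omega> - W s \<omega>"
  have L: "L2 M (\<lambda>\<omega>. \<xi> \<omega> *v ?D a b \<omega>)" "L2 M (\<lambda>\<omega>. \<eta> \<omega> *v ?D c d \<omega>)"
    using assms by (auto intro!: L2_mult_incr)
  then show "integrable M (\<lambda>\<omega>. (\<xi> \<omega> *v ?D a b \<omega>) \<bullet> (\<eta> \<omega> *v ?D c d \<omega>))"
    by (rule L2_inner_integrable)
  show "(\<integral>\<omega>. (\<xi> \<omega> *v ?D a b \<omega>) \<bullet> (\<eta> \<omega> *v ?D c d \<omega>) \<partial>M) = max 0 (min b d - c) * (\<integral>\<omega>. \<xi> \<omega> \<bullet> \<eta> \<omega> \<partial>M)"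
  proof (cases "b \<le> c")
    case True
    have "(\<lambda>\<omega>. \<xi> \<omega> *v ?D a b \<omega>) \<in> borel_measurable (F c)"
      by (rule measurable_F_mono[OF True measurable_mult_incr]) (use assms in auto)
    then show ?thesis
      using integral_inner_incr(2)[of c d "\<lambda>\<omega>. \<xi> \<omega> *v ?D a b \<omega>" \<eta>] True assms L by simp
  next
    case False
    define m where "m = min b d"
    have o: "0 \<le> a" "a \<le> c" "c \<le> m" "m \<le> b" "m \<le> d" "0 \<le> c" "0 \<le> m"
      using assms False by (auto simp: m_def)
    have \<xi>c: "\<xi> \<in> borel_measurable (F c)" and \<xi>m: "\<xi> \<in> borel_measurable (F m)"
      and \<eta>m: "\<eta> \<in> borel_measurable (F m)"
      using o by (auto intro: measurable_F_mono[OF _ \<xi>(1)] measurable_F_mono[OF _ \<eta>(1)])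
    have x1: "(\<lambda>\<omega>. \<xi> \<omega> *v ?D a c \<omega>) \<in> borel_measurable (F c)" "L2 M (\<lambda>\<omega>. \<xi> \<omega> *v ?D a c \<omega>)"
      using o \<xi> by (auto intro!: L2_mult_incr measurable_mult_incr)
    have x2: "(\<lambda>\<omega>. \<xi> \<omega> *v ?D c m \<omega>) \<in> borel_measurable (F m)" "L2 M (\<lambda>\<omega>. \<xi> \<omega> *v ?D c m \<omega>)"
      using o \<xi> \<xi>c by (auto intro!: L2_mult_incr measurable_mult_incr)
    have x3: "L2 M (\<lambda>\<omega>. \<xi> \<omega> *v ?D m b \<omega>)"
      using o \<xi> \<xi>m by (auto intro!: L2_mult_incr)
    have y2: "(\<lambda>\<omega>. \<eta> \<omega> *v ?D c m \<omega>) \<in> borel_measurable (F m)" "L2 M (\<lambda>\<omega>. \<eta> \<omega> *v ?D c m \<omega>)"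
      using o \<eta> by (auto intro!: L2_mult_incr measurable_mult_incr)
    have y3: "L2 M (\<lambda>\<omega>. \<eta> \<omega> *v ?D m d \<omega>)"
      using o \<eta> \<eta>m by (auto intro!: L2_mult_incr)
    \<comment> \<open>Since m = min b d, one of the two intervals beyond m is empty and its
      increment is 0.\<close>
    have triv: "(\<xi> \<omega> *v ?D m b \<omega>) \<bullet> (\<eta> \<omega> *v ?D m d \<omega>) = 0" for \<omega>
      by (auto simp: m_def min_def)
    have split: "\<xi> \<omega> *v ?D a b \<omega> = \<xi> \<omega> *v ?D a c \<omega> + \<xi> \<omega> *v ?D c m \<omega> + \<xi> \<omega> *v ?D m b \<omega>"
      "\<eta> \<omega> *v ?D c d \<omega> = \<eta> \<omega> *v ?D c m \<omega> + \<eta> \<omega> *v ?D m d \<omega>" for \<omega>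
      by (simp_all add: matrix_vector_mult_diff_distrib)
    have eq: "(\<xi> \<omega> *v ?D a b \<omega>) \<bullet> (\<eta> \<omega> *v ?D c d \<omega>) =
      (\<xi> \<omega> *v ?D a c \<omega>) \<bullet> (\<eta> \<omega> *v ?D c d \<omega>) +
      ((\<xi> \<omega> *v ?D c m \<omega>) \<bullet> (\<eta> \<omega> *v ?D c m \<omega>) +
       ((\<xi> \<omega> *v ?D c m \<omega>) \<bullet> (\<eta> \<omega> *v ?D m d \<omega>) +
        (\<eta> \<omega> *v ?D c m \<omega>) \<bullet> (\<xi> \<omega> *v ?D m b \<omega>)))" for \<omega>
      using triv[of \<omega>] unfolding split by (simp add: inner_add_left inner_add_right inner_commute)
    have "(\<integral>\<omega>. (\<xi> \<omega> *v ?D a b \<omega>) \<bullet> (\<eta> \<omega> *v ?D c d \<omega>) \<partial>M) =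
      (\<integral>\<omega>. (\<xi> \<omega> *v ?D a c \<omega>) \<bullet> (\<eta> \<omega> *v ?D c d \<omega>) \<partial>M) +
      ((\<integral>\<omega>. (\<xi> \<omega> *v ?D c m \<omega>) \<bullet> (\<eta> \<omega> *v ?D c m \<omega>) \<partial>M) +
       ((\<integral>\<omega>. (\<xi> \<omega> *v ?D c m \<omega>) \<bullet> (\<eta> \<omega> *v ?D m d \<omega>) \<partial>M) +
        (\<integral>\<omega>. (\<eta> \<omega> *v ?D c m \<omega>) \<bullet> (\<xi> \<omega> *v ?D m b \<omega>) \<partial>M)))"
      unfolding eq
      using L2_inner_integrable[OF x1(2) L(2)] L2_inner_integrable[OF x2(2) y2(2)]
        L2_inner_integrable[OF x2(2) y3] L2_inner_integrable[OF y2(2) x3]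
      by (simp only: Bochner_Integration.integral_add Bochner_Integration.integrable_add)
    also have "\<dots> = (m - c) * (\<integral>\<omega>. \<xi> \<omega> \<bullet> \<eta> \<omega> \<partial>M)"
      using integral_inner_incr(2)[OF o(6) cd(2) x1 \<eta>]
        integral_inner_incr(2)[OF o(7) o(5) x2 \<eta>m \<eta>(2)]
        integral_inner_incr(2)[OF o(7) o(4) y2 \<xi>m \<xi>(2)]
        integral_incr_inner_incr(2)[OF o(6,3) \<xi>c \<xi>(2) \<eta>] by simp
    finally show ?thesis using o by (simp add: m_def)
  qed
qed

section \<open>Elementary integrands and the Ito isometry\<close>

text \<open>Finite sums of integrands \<open>\<xi> 1\<^bsub>(a, b]\<^esub>\<close> with \<open>a \<ge> s\<close>, paired with their integrals. Unlike the
  simple processes these are closed under addition without passing to a common partition, and \<open>\<xi>\<close> is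
  only required to be square integrable.\<close>

inductive elementary :: "real \<Rightarrow> (real \<Rightarrow> 'w \<Rightarrow> real^'n^'n) \<Rightarrow> ('w \<Rightarrow> real^'n) \<Rightarrow> bool" for s where
  zero: "elementary s (\<lambda>_ _. 0) (\<lambda>_. 0)"
| step: "elementary s V J \<Longrightarrow> 0 \<le> a \<Longrightarrow> s \<le> a \<Longrightarrow> a \<le> b \<Longrightarrow> \<xi> \<in> borel_measurable (F a) \<Longrightarrow> L2 M \<xi> \<Longrightarrow>
    elementary s (\<lambda>r \<omega>. indicator {a<..b} r *\<^sub>R \<xi> \<omega> + V r \<omega>)
      (\<lambda>\<omega>. \<xi> \<omega> *v (W b \<omega> - W a \<omega>) + J \<omega>)"

lemma elementary_single:
  assumes "0 \<le> a" "s \<le> a" "a \<le> b" "\<xi> \<in> borel_measurable (F a)" "L2 M \<xi>"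
  shows "elementary s (\<lambda>r \<omega>. indicator {a<..b} r *\<^sub>R \<xi> \<omega>) (\<lambda>\<omega>. \<xi> \<omega> *v (W b \<omega> - W a \<omega>))"
  using elementary.step[OF elementary.zero assms] by simp

lemma elementary_add:
  assumes "elementary s V J" "elementary s V' J'"
  shows "elementary s (\<lambda>r \<omega>. V r \<omega> + V' r \<omega>) (\<lambda>\<omega>. J \<omega> + J' \<omega>)"
  using assms(1)
proof induction
  case zero
  then show ?case using assms(2) by simp
next
  case (step V J a b \<xi>)
  from elementary.step[OF step.IH step.hyps(2-6)] show ?case by (simp only: add.assoc)
qed

lemma elementary_uminus:
  assumes "elementary s V J"
  shows "elementary s (\<lambda>r \<omega>. - V r \<omega>) (\<lambda>\<omega>. - J \<omega>)"
  using assms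
proof induction
  case zero
  then show ?case using elementary.zero by simp
next
  case (step V J a b \<xi>)
  have neg: "(- A) *v x = - (A *v x)" for A :: "real^'n^'n" and x
    by (simp add: matrix_vector_mult_def vec_eq_iff sum_negf)
  have "(\<lambda>\<omega>. - \<xi> \<omega>) \<in> borel_measurable (F a)" using step by auto
  from elementary.step[OF step.IH step.hyps(2-4) this L2_uminus[OF step.hyps(6)]] show ?case
    by (simp add: neg)
qed

lemma elementary_diff:
  assumes "elementary s V J" "elementary s V' J'"
  shows "elementary s (\<lambda>r \<omega>. V r \<omega> - V' r \<omega>) (\<lambda>\<omega>. J \<omega> - J' \<omega>)"
  using elementary_add[OF assms(1) elementary_uminus[OF assms(2)]] by simp

lemma elementary_integral_L2: "elementary s V J \<Longrightarrow> L2 M J"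
  by (induction rule: elementary.induct) (auto intro: L2_zero L2_add L2_mult_incr)

lemma elementary_measurable:
  assumes "elementary s V J" shows "(\<lambda>(r, \<omega>). V r \<omega>) \<in> borel_measurable (lborel \<Otimes>\<^sub>M M)"
  using assms
proof induction
  case (step V J a b \<xi>)
  have [measurable]: "\<xi> \<in> borel_measurable M" using step by (auto dest: measurable_F_M)
  show ?case using step.IH by measurable
qed simp

text \<open>Every interval starts at some a \<ge> s, so U is known at time a and each summand is
  orthogonal to it; this is the purpose of the index s of \<open>elementary\<close>.\<close>

lemma elementary_orthogonal:
  assumes "elementary s V J" "0 \<le> s" "U \<in> borel_measurable (F s)" "L2 M U"
  shows "(\<integral>\<omega>. U \<omega> \<bullet> J \<omega> \<partial>M) = 0"
  using assms(1)
proof induction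
  case (step V J a b \<xi>)
  have "U \<in> borel_measurable (F a)" using measurable_F_mono[OF step(3) assms(3)] .
  note * = integral_inner_incr[OF step(2,4) this assms(4) step(5,6)]
  show ?case
    using * step.IH L2_inner_integrable[OF assms(4) elementary_integral_L2[OF step(1)]]
    by (simp add: inner_add_right)
qed simp

text \<open>The isometry as a relation between two integrands paired with their integrals. The
  bilinear form, with the integrability facts included, makes it additive in each argument and so
  reduces it to single intervals.\<close>

definition isometric ::
  "(real \<Rightarrow> 'w \<Rightarrow> real^'n^'n) \<Rightarrow> ('w \<Rightarrow> real^'n) \<Rightarrow> (real \<Rightarrow> 'w \<Rightarrow> real^'n^'n) \<Rightarrow> ('w \<Rightarrow> real^'n) \<Rightarrow> bool"
where
  "isometric V J V' J' \<longleftrightarrow> (\<forall>r. integrable M (\<lambda>\<omega>. V r \<omega> \<bullet> V' r \<omega>)) \<and>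
     integrable lborel (\<lambda>r. \<integral>\<omega>. V r \<omega> \<bullet> V' r \<omega> \<partial>M) \<and> integrable M (\<lambda>\<omega>. J \<omega> \<bullet> J' \<omega>) \<and>
     (\<integral>\<omega>. J \<omega> \<bullet> J' \<omega> \<partial>M) = (\<integral>r. (\<integral>\<omega>. V r \<omega> \<bullet> V' r \<omega> \<partial>M) \<partial>lborel)"

lemma isometric_zero: "isometric (\<lambda>_ _. 0) (\<lambda>_. 0) V J"
  by (simp add: isometric_def)

lemma isometric_commute: "isometric V J V' J' \<Longrightarrow> isometric V' J' V J"
  by (simp add: isometric_def inner_commute)

lemma isometric_add:
  "isometric V1 J1 V J \<Longrightarrow> isometric V2 J2 V J \<Longrightarrow>
    isometric (\<lambda>r \<omega>. V1 r \<omega> + V2 r \<omega>) (\<lambda>\<omega>. J1 \<omega> + J2 \<omega>) V J"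
  by (simp add: isometric_def inner_add_left)

text \<open>Both sides equal the length of the intersection of the two intervals times the expected
  inner product of the coefficients.\<close>

lemma isometric_single:
  assumes ab: "0 \<le> a" "a \<le> b" and cd: "0 \<le> c" "c \<le> d"
    and \<xi>: "\<xi> \<in> borel_measurable (F a)" "L2 M \<xi>"
    and \<eta>: "\<eta> \<in> borel_measurable (F c)" "L2 M \<eta>"
  shows "isometric (\<lambda>r \<omega>. indicator {a<..b} r *\<^sub>R \<xi> \<omega>) (\<lambda>\<omega>. \<xi> \<omega> *v (W b \<omega> - W a \<omega>))
    (\<lambda>r \<omega>. indicator {c<..d} r *\<^sub>R \<eta> \<omega>) (\<lambda>\<omega>. \<eta> \<omega> *v (W d \<omega> - W c \<omega>))"
proof -
  \<comment> \<open>Restated for arbitrary endpoints with a \<le> c, so that symmetry settles the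
    other order.\<close>
  have *: "isometric (\<lambda>r \<omega>. indicator {a<..b} r *\<^sub>R \<xi> \<omega>) (\<lambda>\<omega>. \<xi> \<omega> *v (W b \<omega> - W a \<omega>))
      (\<lambda>r \<omega>. indicator {c<..d} r *\<^sub>R \<eta> \<omega>) (\<lambda>\<omega>. \<eta> \<omega> *v (W d \<omega> - W c \<omega>))"
    if "0 \<le> a" "a \<le> b" "a \<le> c" "c \<le> d" "\<xi> \<in> borel_measurable (F a)" "L2 M \<xi>"
      "\<eta> \<in> borel_measurable (F c)" "L2 M \<eta>"
    for a b c d :: real and \<xi> \<eta> :: "'w \<Rightarrow> real^'n^'n"
  proof -
    have eq: "(indicator {a<..b} r *\<^sub>R \<xi> \<omega>) \<bullet> (indicator {c<..d} r *\<^sub>R \<eta> \<omega>) =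
      indicator {c<..min b d} r * (\<xi> \<omega> \<bullet> \<eta> \<omega>)" for r \<omega>
      using that by (auto simp: indicator_def)
    have m: "measure lborel {c<..min b d} = max 0 (min b d - c)"
      by (cases "c \<le> min b d") (auto simp: max_def)
    have i: "integrable lborel (indicat_real {c<..min b d})"
      using emeasure_bounded_finite[of "{c<..min b d}"] by (intro integrable_real_indicator) auto
    show ?thesis
      unfolding isometric_def eq
      using integral_incr_inner_incr_overlap[OF that] L2_inner_integrable[OF that(6,8)] i
      by (simp add: m)
  qed
  show ?thesis
  proof (cases "a \<le> c")
    case True
    then show ?thesis using * assms by auto
  next
    case False
    then show ?thesis using assms by (intro isometric_commute[OF *]) auto
  qed
qed

lemma elementary_isometric:
  assumes "elementary s V J" "elementary s' V' J'" shows "isometric V J V' J'"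
  using assms(1)
proof induction
  case (step V J a b \<xi>)
  \<comment> \<open>The inner induction runs over the second integrand for one fixed summand of the
    first; the outer one then adds these summands up.\<close>
  have "isometric V' J' (\<lambda>r \<omega>. indicator {a<..b} r *\<^sub>R \<xi> \<omega>) (\<lambda>\<omega>. \<xi> \<omega> *v (W b \<omega> - W a \<omega>))"
    using assms(2)
  proof induction
    case (step V' J' c d \<eta>)
    show ?case
      by (rule isometric_add[OF isometric_single step.IH])
         (use step.hyps \<open>0 \<le> a\<close> \<open>a \<le> b\<close> \<open>\<xi> \<in> _\<close> \<open>L2 M \<xi>\<close> in auto)
  qed (rule isometric_zero)
  from isometric_add[OF isometric_commute[OF this] step.IH] show ?case .
qed (rule isometric_zero)

lemma pair_sigma_finite_lborel_M: "pair_sigma_finite (lborel :: real measure) M"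
  by unfold_locales

text \<open>The diagonal case, rewritten with nonnegative integrals and with the expectation
  outside, the form in which \<open>has_ito_integral\<close> measures distances.\<close>

lemma elementary_isometry:
  assumes "elementary s V J"
  shows "(\<integral>\<^sup>+\<omega>. ennreal ((norm (J \<omega>))\<^sup>2) \<partial>M) = (\<integral>\<^sup>+\<omega>. (\<integral>\<^sup>+r. ennreal ((norm (V r \<omega>))\<^sup>2) \<partial>lborel) \<partial>M)"
proof -
  interpret P: pair_sigma_finite "lborel :: real measure" M by (rule pair_sigma_finite_lborel_M)
  have [measurable]: "(\<lambda>(r, \<omega>). V r \<omega>) \<in> borel_measurable (lborel \<Otimes>\<^sub>M M)"
    using assms by (rule elementary_measurable)
  have iso: "isometric V J V J" by (rule elementary_isometric[OF assms assms])
  have "(\<integral>\<^sup>+\<omega>. (\<integral>\<^sup>+r. ennreal ((norm (V r \<omega>))\<^sup>2) \<partial>lborel) \<partial>M) =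
    (\<integral>\<^sup>+r. (\<integral>\<^sup>+\<omega>. ennreal ((norm (V r \<omega>))\<^sup>2) \<partial>M) \<partial>lborel)"
    by (rule P.Fubini') measurable
  also have "\<dots> = (\<integral>\<^sup>+r. ennreal (\<integral>\<omega>. V r \<omega> \<bullet> V r \<omega> \<partial>M) \<partial>lborel)"
    using iso unfolding isometric_def power2_norm_eq_inner
    by (intro nn_integral_cong nn_integral_eq_integral) auto
  also have "\<dots> = ennreal (\<integral>r. (\<integral>\<omega>. V r \<omega> \<bullet> V r \<omega> \<partial>M) \<partial>lborel)"
    using iso unfolding isometric_def by (intro nn_integral_eq_integral) auto
  also have "\<dots> = ennreal (\<integral>\<omega>. J \<omega> \<bullet> J \<omega> \<partial>M)" using iso by (simp add: isometric_def)
  also have "\<dots> = (\<integral>\<^sup>+\<omega>. ennreal ((norm (J \<omega>))\<^sup>2) \<partial>M)"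
    using iso unfolding isometric_def power2_norm_eq_inner
    by (intro nn_integral_eq_integral[symmetric]) auto
  finally show ?thesis by simp
qed

text \<open>Approximants of the integral up to t need not have s as a partition point; cutting them
  at s separates what is comparable with the integral up to s from what is orthogonal to the past of
  s.\<close>

lemma elementary_split:
  assumes "elementary 0 V J" "0 \<le> s"
  shows "\<exists>J1 J2. elementary 0 (\<lambda>r \<omega>. indicator {..s} r *\<^sub>R V r \<omega>) J1 \<and>
    elementary s (\<lambda>r \<omega>. indicator {s<..} r *\<^sub>R V r \<omega>) J2 \<and> J = (\<lambda>\<omega>. J1 \<omega> + J2 \<omega>)"
  using assms(1)
proof induction
  case zero
  show ?case by (rule exI[of _ "\<lambda>_. 0"], rule exI[of _ "\<lambda>_. 0"]) (simp add: elementary.zero)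
next
  case (step V J a b \<xi>)
  from step.IH obtain J1 J2 where IH: "elementary 0 (\<lambda>r \<omega>. indicator {..s} r *\<^sub>R V r \<omega>) J1"
    "elementary s (\<lambda>r \<omega>. indicator {s<..} r *\<^sub>R V r \<omega>) J2" "J = (\<lambda>\<omega>. J1 \<omega> + J2 \<omega>)" by auto
  let ?V = "\<lambda>r \<omega>. indicator {a<..b} r *\<^sub>R \<xi> \<omega> + V r \<omega>"
  show ?case
  proof (cases "s \<le> a")
    case True
    have eq: "(\<lambda>r \<omega>. indicator {..s} r *\<^sub>R ?V r \<omega>) = (\<lambda>r \<omega>. indicator {..s} r *\<^sub>R V r \<omega>)"
      "(\<lambda>r \<omega>. indicator {s<..} r *\<^sub>R ?V r \<omega>) = (\<lambda>r \<omega>. indicator {a<..b} r *\<^sub>R \<xi> \<omega> + indicator {s<..} r *\<^sub>R V r \<omega>)"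
      using True by (auto simp: fun_eq_iff indicator_def)
    show ?thesis
      unfolding eq IH(3)
      by (rule exI[of _ J1], rule exI[of _ "\<lambda>\<omega>. \<xi> \<omega> *v (W b \<omega> - W a \<omega>) + J2 \<omega>"])
         (use IH(1) elementary.step[OF IH(2) step.hyps(2) True step.hyps(4-6)] in \<open>auto simp: add_ac\<close>)
  next
    case False
    \<comment> \<open>If b \<le> s, then p = b and q = s, so the piece after s is empty; otherwise p
      = s and q = b. Either way the two increments add up to the one over (a, b].\<close>
    define p where "p = min s b"
    define q where "q = max s b"
    have o: "0 \<le> a" "a \<le> p" "s \<le> q" using False step.hyps by (auto simp: p_def q_def)
    have eq: "(\<lambda>r \<omega>. indicator {..s} r *\<^sub>R ?V r \<omega>) =
        (\<lambda>r \<omega>. indicator {a<..p} r *\<^sub>R \<xi> \<omega> + indicator {..s} r *\<^sub>R V r \<omega>)"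
      "(\<lambda>r \<omega>. indicator {s<..} r *\<^sub>R ?V r \<omega>) =
        (\<lambda>r \<omega>. indicator {s<..q} r *\<^sub>R \<xi> \<omega> + indicator {s<..} r *\<^sub>R V r \<omega>)"
      using False by (auto simp: fun_eq_iff indicator_def p_def q_def)
    have W: "W b \<omega> - W a \<omega> = (W p \<omega> - W a \<omega>) + (W q \<omega> - W s \<omega>)" for \<omega>
      by (auto simp: p_def q_def min_def max_def)
    have \<xi>s: "\<xi> \<in> borel_measurable (F s)" using False step.hyps by (auto intro: measurable_F_mono[of a])
    show ?thesis
      unfolding eq IH(3) W
      by (rule exI[of _ "\<lambda>\<omega>. \<xi> \<omega> *v (W p \<omega> - W a \<omega>) + J1 \<omega>"],
          rule exI[of _ "\<lambda>\<omega>. \<xi> \<omega> *v (W q \<omega> - W s \<omega>) + J2 \<omega>"])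
         (use elementary.step[OF IH(1) o(1,1,2) step.hyps(5,6)]
           elementary.step[OF IH(2) assms(2) order_refl o(3) \<xi>s step.hyps(6)]
          in \<open>auto simp: add_ac matrix_vector_right_distrib\<close>)
  qed
qed

section \<open>Simple processes as elementary integrands\<close>

lemma simple_process_mono:
  assumes "simple_process M F t n \<tau> \<xi>" "i \<le> j" "j \<le> n" shows "\<tau> i \<le> \<tau> j"
  using assms(2,3)
proof (induction j)
  case (Suc j)
  then show ?case using assms(1) by (cases "i = Suc j") (auto simp: simple_process_def intro: order_trans)
qed simp

lemma simple_process_elementary:
  assumes "simple_process M F t n \<tau> \<xi>"
  shows "elementary 0 (simple_process_val n \<tau> \<xi>) (simple_ito_integral W n \<tau> \<xi>)"
proof -
  have "elementary 0 (\<lambda>s \<omega>. \<Sum>i<k. indicator {\<tau> i<..\<tau> (Suc i)} s *\<^sub>R \<xi> i \<omega>)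
    (\<lambda>\<omega>. \<Sum>i<k. \<xi> i \<omega> *v (W (\<tau> (Suc i)) \<omega> - W (\<tau> i) \<omega>))" if "k \<le> n" for k
    using that
  proof (induction k)
    case 0
    show ?case using elementary.zero by simp
  next
    case (Suc k)
    have 0: "0 \<le> \<tau> k" using simple_process_mono[OF assms, of 0 k] Suc.prems assms
      by (auto simp: simple_process_def)
    have le: "\<tau> k \<le> \<tau> (Suc k)" and \<xi>: "\<xi> k \<in> borel_measurable (F (\<tau> k))"
      using assms Suc.prems by (auto simp: simple_process_def)
    obtain B where B: "\<And>\<omega>. \<omega> \<in> space M \<Longrightarrow> norm (\<xi> k \<omega>) \<le> B"
      using assms Suc.prems unfolding simple_process_def by (metis Suc_le_lessD)
    have "L2 M (\<xi> k)"
    proof (rule L2_bound)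
      show "integrable M (\<lambda>_. B\<^sup>2)" by simp
      show "AE \<omega> in M. (norm (\<xi> k \<omega>))\<^sup>2 \<le> B\<^sup>2" by (intro AE_I2 power_mono B) auto
    qed (rule measurable_F_M[OF \<xi>])
    from elementary.step[OF Suc.IH 0 0 le \<xi> this] Suc.prems show ?case
      by (simp add: add.commute)
  qed
  from this[of n] show ?thesis
    by (simp add: simple_process_val_def[abs_def] simple_ito_integral_def[abs_def])
qed

text \<open>Lets the time integrals over [0, t] in \<open>has_ito_integral\<close> be read as
  integrals over the whole line, as in the isometry.\<close>

lemma simple_process_val_eq_0:
  assumes "simple_process M F t n \<tau> \<xi>" "r \<notin> {0<..t}"
  shows "simple_process_val n \<tau> \<xi> r \<omega> = 0"
  unfolding simple_process_val_def
proof (rule sum.neutral, rule ballI)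
  fix i assume "i \<in> {..<n}"
  then have "0 \<le> \<tau> i" "\<tau> (Suc i) \<le> t"
    using simple_process_mono[OF assms(1), of 0 i] simple_process_mono[OF assms(1), of "Suc i" n] assms(1)
    by (auto simp: simple_process_def)
  with assms(2) show "indicator {\<tau> i<..\<tau> (Suc i)} r *\<^sub>R \<xi> i \<omega> = 0"
    by (auto simp: indicator_def)
qed

end

section \<open>Increments of the Ito integral\<close>

text \<open>Cauchy-Schwarz and a passage to the limit in one: for a fixed weight c the remainder
  \<open>r m / c\<close> vanishes as m grows, and only then is c chosen small.\<close>

lemma tendsto_0_of_sq_integral:
  fixes u v x :: real
  assumes "\<And>c m. 0 < c \<Longrightarrow> 2 * \<bar>x\<bar> \<le> c * u + r m / c" "r \<longlonglongrightarrow> 0" "0 \<le> u"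
  shows "x = 0"
proof (rule ccontr)
  assume "x \<noteq> 0"
  \<comment> \<open>With this weight c u is at most |x|, which contradicts 2 |x| \<le> c u.\<close>
  define c where "c = \<bar>x\<bar> / (u + 1)"
  have c: "0 < c" using \<open>x \<noteq> 0\<close> assms(3) by (simp add: c_def)
  have "(\<lambda>m. c * u + r m / c) \<longlonglongrightarrow> c * u + 0 / c"
    using assms(2) c by (intro tendsto_intros) auto
  then have "2 * \<bar>x\<bar> \<le> c * u + 0 / c"
    by (rule LIMSEQ_le_const) (use assms(1)[OF c] in auto)
  also have "c * u \<le> \<bar>x\<bar>" using assms(3) by (simp add: c_def field_simps)
  finally show False using \<open>x \<noteq> 0\<close> by simp
qed

context brownian_space
begin

text \<open>Progressive measurability only concerns times in [0, t]; freezing the process outside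
  gives joint measurability on the whole line without changing it on [0, t]. This makes Fubini
  applicable to the integrand.\<close>

lemma progressive_clip_measurable:
  fixes H :: "real \<Rightarrow> 'w \<Rightarrow> 'b::euclidean_space"
  assumes "progressively_measurable_upto F t H" "0 \<le> t"
  shows "(\<lambda>(r, \<omega>). H (max 0 (min t r)) \<omega>) \<in> borel_measurable (lborel \<Otimes>\<^sub>M M)"
proof -
  have H: "(\<lambda>(r, \<omega>). H r \<omega>) \<in> borel_measurable (restrict_space borel {0..t} \<Otimes>\<^sub>M F t)"
    using assms by (auto simp: progressively_measurable_upto_def)
  have id: "(\<lambda>x. x) \<in> measurable M (F t)"
    using sets_F_subset[of t] sets.sets_into_space[of _ M] by (auto simp: measurable_def space_F Int_absorb2)
  have clip: "(\<lambda>r::real. max 0 (min t r)) \<in> measurable lborel (restrict_space borel {0..t})"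
    using assms(2) by (intro measurable_restrict_space2) auto
  have "(\<lambda>z. (max 0 (min t (fst z)), snd z)) \<in> measurable (lborel \<Otimes>\<^sub>M M) (restrict_space borel {0..t} \<Otimes>\<^sub>M F t)"
    by (intro measurable_Pair measurable_compose[OF measurable_fst clip] measurable_compose[OF measurable_snd id])
  from measurable_compose[OF this H] show ?thesis by (simp add: case_prod_beta')
qed

lemma nn_integral_lborel_M:
  fixes g :: "real \<Rightarrow> 'w \<Rightarrow> 'b::euclidean_space"
  assumes [measurable]: "(\<lambda>z. g (fst z) (snd z)) \<in> borel_measurable (lborel \<Otimes>\<^sub>M M)"
  shows "(\<integral>\<^sup>+\<omega>. (\<integral>\<^sup>+r. ennreal ((norm (g r \<omega>))\<^sup>2) \<partial>lborel) \<partial>M) =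
    (\<integral>\<^sup>+z. ennreal ((norm (g (fst z) (snd z)))\<^sup>2) \<partial>(lborel \<Otimes>\<^sub>M M))"
proof -
  interpret P: pair_sigma_finite "lborel :: real measure" M by (rule pair_sigma_finite_lborel_M)
  show ?thesis
    by (subst P.nn_integral_snd[symmetric]) auto
qed

lemma nn_integral_Fubini_set:
  fixes g :: "real \<Rightarrow> 'w \<Rightarrow> 'b::euclidean_space"
  assumes [measurable]: "(\<lambda>z. g (fst z) (snd z)) \<in> borel_measurable (lborel \<Otimes>\<^sub>M M)"
    and [measurable]: "A \<in> sets borel"
  shows "(\<integral>\<^sup>+\<omega>. (\<integral>\<^sup>+r\<in>A. ennreal ((norm (g r \<omega>))\<^sup>2) \<partial>lborel) \<partial>M) =
    (\<integral>\<^sup>+r\<in>A. (\<integral>\<^sup>+\<omega>. ennreal ((norm (g r \<omega>))\<^sup>2) \<partial>M) \<partial>lborel)"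
proof -
  interpret P: pair_sigma_finite "lborel :: real measure" M by (rule pair_sigma_finite_lborel_M)
  have "(\<integral>\<^sup>+\<omega>. (\<integral>\<^sup>+r\<in>A. ennreal ((norm (g r \<omega>))\<^sup>2) \<partial>lborel) \<partial>M) =
    (\<integral>\<^sup>+r. (\<integral>\<^sup>+\<omega>. ennreal ((norm (g r \<omega>))\<^sup>2) * indicator A r \<partial>M) \<partial>lborel)"
    by (rule P.Fubini') (simp add: case_prod_beta')
  also have "\<dots> = (\<integral>\<^sup>+r\<in>A. (\<integral>\<^sup>+\<omega>. ennreal ((norm (g r \<omega>))\<^sup>2) \<partial>M) \<partial>lborel)"
    by (intro nn_integral_cong) (auto simp: indicator_def)
  finally show ?thesis .
qed

text \<open>Splitting at \<open>s\<close> gives integrands living on \<open>(s, t]\<close> that approximate \<open>H - \<zeta>\<close> there: the part of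
  the approximation of \<open>It\<close> up to time \<open>s\<close> differs from the approximation of \<open>Is\<close> by little, because
  both approximate \<open>H\<close> on \<open>[0, s]\<close>.\<close>

lemma ito_increment_approximation:
  fixes H :: "real \<Rightarrow> 'w \<Rightarrow> real^'n^'n"
  assumes st: "0 \<le> s" "s \<le> t"
    and Is: "has_ito_integral M F W H s Is" and It: "has_ito_integral M F W H t It"
    and \<zeta>: "\<zeta> \<in> borel_measurable (F s)" "L2 M \<zeta>"
  shows "\<exists>V J. (\<forall>m. elementary s (V m) (J m)) \<and>
    (\<lambda>m. \<integral>\<^sup>+\<omega>. ennreal ((norm (It \<omega> - Is \<omega> - \<zeta> \<omega> *v (W t \<omega> - W s \<omega>) - J m \<omega>))\<^sup>2) \<partial>M) \<longlonglongrightarrow> 0 \<and>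
    (\<exists>q. q \<longlonglongrightarrow> 0 \<and> (\<forall>m. (\<integral>\<^sup>+\<omega>. ennreal ((norm (J m \<omega>))\<^sup>2) \<partial>M) \<le>
      2 * (\<integral>\<^sup>+\<omega>. (\<integral>\<^sup>+r\<in>{s<..t}. ennreal ((norm (H r \<omega> - \<zeta> \<omega>))\<^sup>2) \<partial>lborel) \<partial>M) + q m))"
proof -
  let ?N = "lborel \<Otimes>\<^sub>M M"
  let ?n = "\<lambda>f. \<integral>\<^sup>+z. ennreal ((norm (f z))\<^sup>2) \<partial>?N"
  let ?e = "\<lambda>f. \<integral>\<^sup>+\<omega>. ennreal ((norm (f \<omega>))\<^sup>2) \<partial>M"
  have t: "0 \<le> t" using st by simp
  obtain n \<tau> \<xi> where sp: "\<And>m. simple_process M F t (n m) (\<tau> m) (\<xi> m)"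
    and cv: "(\<lambda>m. \<integral>\<^sup>+\<omega>. (\<integral>\<^sup>+r\<in>{0..t}.
        ennreal ((norm (simple_process_val (n m) (\<tau> m) (\<xi> m) r \<omega> - H r \<omega>))\<^sup>2) \<partial>lborel) \<partial>M) \<longlonglongrightarrow> 0"
    and ci: "(\<lambda>m. ?e (\<lambda>\<omega>. simple_ito_integral W (n m) (\<tau> m) (\<xi> m) \<omega> - It \<omega>)) \<longlonglongrightarrow> 0"
    using It unfolding has_ito_integral_def by blast
  obtain n' \<tau>' \<xi>' where sp': "\<And>m. simple_process M F s (n' m) (\<tau>' m) (\<xi>' m)"
    and cv': "(\<lambda>m. \<integral>\<^sup>+\<omega>. (\<integral>\<^sup>+r\<in>{0..s}.
        ennreal ((norm (simple_process_val (n' m) (\<tau>' m) (\<xi>' m) r \<omega> - H r \<omega>))\<^sup>2) \<partial>lborel) \<partial>M) \<longlonglongrightarrow> 0"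
    and ci': "(\<lambda>m. ?e (\<lambda>\<omega>. simple_ito_integral W (n' m) (\<tau>' m) (\<xi>' m) \<omega> - Is \<omega>)) \<longlonglongrightarrow> 0"
    using Is unfolding has_ito_integral_def by blast
  define V where "V m = simple_process_val (n m) (\<tau> m) (\<xi> m)" for m
  define J where "J m = simple_ito_integral W (n m) (\<tau> m) (\<xi> m)" for m
  define V' where "V' m = simple_process_val (n' m) (\<tau>' m) (\<xi>' m)" for m
  define J' where "J' m = simple_ito_integral W (n' m) (\<tau>' m) (\<xi>' m)" for m
  have el: "elementary 0 (V m) (J m)" for m
    unfolding V_def J_def by (rule simple_process_elementary[OF sp])
  have el': "elementary 0 (V' m) (J' m)" for m
    unfolding V'_def J'_def by (rule simple_process_elementary[OF sp'])
  have ex: "\<exists>J1 J2. elementary 0 (\<lambda>r \<omega>. indicator {..s} r *\<^sub>R V m r \<omega>) J1 \<and>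
    elementary s (\<lambda>r \<omega>. indicator {s<..} r *\<^sub>R V m r \<omega>) J2 \<and> J m = (\<lambda>\<omega>. J1 \<omega> + J2 \<omega>)" for m
    by (rule elementary_split[OF el st(1)])
  from choice[OF allI[OF ex]] obtain J1 where J1: "\<forall>m. \<exists>J2. elementary 0 (\<lambda>r \<omega>. indicator {..s} r *\<^sub>R V m r \<omega>) (J1 m) \<and>
    elementary s (\<lambda>r \<omega>. indicator {s<..} r *\<^sub>R V m r \<omega>) J2 \<and> J m = (\<lambda>\<omega>. J1 m \<omega> + J2 \<omega>)" ..
  from choice[OF J1] obtain J2 where J2: "\<forall>m. elementary 0 (\<lambda>r \<omega>. indicator {..s} r *\<^sub>R V m r \<omega>) (J1 m) \<and>
    elementary s (\<lambda>r \<omega>. indicator {s<..} r *\<^sub>R V m r \<omega>) (J2 m) \<and> J m = (\<lambda>\<omega>. J1 m \<omega> + J2 m \<omega>)" ..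
  from J2 have el1: "\<And>m. elementary 0 (\<lambda>r \<omega>. indicator {..s} r *\<^sub>R V m r \<omega>) (J1 m)"
    and el2: "\<And>m. elementary s (\<lambda>r \<omega>. indicator {s<..} r *\<^sub>R V m r \<omega>) (J2 m)"
    and J: "\<And>m. J m = (\<lambda>\<omega>. J1 m \<omega> + J2 m \<omega>)"
    by simp_all
  define h where "h r \<omega> = H (max 0 (min t r)) \<omega>" for r \<omega>
  \<comment> \<open>\<open>k\<close> and \<open>k'\<close> are the integrand on [0, t] and on
    [0, s], the targets of \<open>v\<close> and \<open>v'\<close>; \<open>g\<close> is the target on
    (s, t] after subtracting \<zeta>.\<close>
  define k where "k z = indicator {0..t} (fst z) *\<^sub>R h (fst z) (snd z)" for z
  define k' where "k' z = indicator {0..s} (fst z) *\<^sub>R h (fst z) (snd z)" for z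
  define v where "v m z = V m (fst z) (snd z)" for m z
  define v' where "v' m z = V' m (fst z) (snd z)" for m z
  define g where "g z = indicator {s<..t} (fst z) *\<^sub>R (h (fst z) (snd z) - \<zeta> (snd z))" for z
  have h: "h r \<omega> = H r \<omega>" if "r \<in> {0..t}" for r \<omega> using that by (simp add: h_def)
  have [measurable]: "(\<lambda>z. h (fst z) (snd z)) \<in> borel_measurable ?N"
    using progressive_clip_measurable[of t H] It t by (simp add: has_ito_integral_def h_def case_prod_beta')
  have [measurable]: "v m \<in> borel_measurable ?N" "v' m \<in> borel_measurable ?N" for m
    using elementary_measurable[OF el] elementary_measurable[OF el']
    by (simp_all add: v_def[abs_def] v'_def[abs_def] case_prod_beta')
  have [measurable]: "\<zeta> \<in> borel_measurable M" by (rule L2_measurable[OF \<zeta>(2)])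
  have [measurable]: "k \<in> borel_measurable ?N" "k' \<in> borel_measurable ?N" "g \<in> borel_measurable ?N"
    unfolding k_def[abs_def] k'_def[abs_def] g_def[abs_def] by measurable
  have V0: "V m r \<omega> = 0" if "r \<notin> {0..t}" for m r \<omega>
    unfolding V_def by (rule simple_process_val_eq_0[OF sp]) (use that in auto)
  have V0': "V' m r \<omega> = 0" if "r \<notin> {0..s}" for m r \<omega>
    unfolding V'_def by (rule simple_process_val_eq_0[OF sp']) (use that in auto)
  have c1: "(\<lambda>m. ?n (\<lambda>z. v m z - k z)) \<longlonglongrightarrow> 0"
  proof -
    have "?n (\<lambda>z. v m z - k z) = (\<integral>\<^sup>+\<omega>. (\<integral>\<^sup>+r. ennreal ((norm (V m r \<omega> - indicator {0..t} r *\<^sub>R h r \<omega>))\<^sup>2) \<partial>lborel) \<partial>M)" for m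
      using nn_integral_lborel_M[of "\<lambda>r \<omega>. V m r \<omega> - indicator {0..t} r *\<^sub>R h r \<omega>"]
      unfolding v_def[symmetric] k_def[symmetric] by simp
    also have "\<dots> m = (\<integral>\<^sup>+\<omega>. (\<integral>\<^sup>+r\<in>{0..t}. ennreal ((norm (V m r \<omega> - H r \<omega>))\<^sup>2) \<partial>lborel) \<partial>M)" for m
      by (intro nn_integral_cong) (auto simp: indicator_def V0 h)
    finally show ?thesis using cv by (simp add: V_def)
  qed
  have c2: "(\<lambda>m. ?n (\<lambda>z. v' m z - k' z)) \<longlonglongrightarrow> 0"
  proof -
    have "?n (\<lambda>z. v' m z - k' z) = (\<integral>\<^sup>+\<omega>. (\<integral>\<^sup>+r. ennreal ((norm (V' m r \<omega> - indicator {0..s} r *\<^sub>R h r \<omega>))\<^sup>2) \<partial>lborel) \<partial>M)" for m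
      using nn_integral_lborel_M[of "\<lambda>r \<omega>. V' m r \<omega> - indicator {0..s} r *\<^sub>R h r \<omega>"]
      unfolding v'_def[symmetric] k'_def[symmetric] by simp
    also have "\<dots> m = (\<integral>\<^sup>+\<omega>. (\<integral>\<^sup>+r\<in>{0..s}. ennreal ((norm (V' m r \<omega> - H r \<omega>))\<^sup>2) \<partial>lborel) \<partial>M)" for m
      using st by (intro nn_integral_cong) (auto simp: indicator_def V0' h)
    finally show ?thesis using cv' by (simp add: V'_def)
  qed
  have Gg: "(\<integral>\<^sup>+\<omega>. (\<integral>\<^sup>+r\<in>{s<..t}. ennreal ((norm (H r \<omega> - \<zeta> \<omega>))\<^sup>2) \<partial>lborel) \<partial>M) = ?n g"
  proof -
    have "?n g = (\<integral>\<^sup>+\<omega>. (\<integral>\<^sup>+r. ennreal ((norm (indicator {s<..t} r *\<^sub>R (h r \<omega> - \<zeta> \<omega>)))\<^sup>2) \<partial>lborel) \<partial>M)"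
      using nn_integral_lborel_M[of "\<lambda>r \<omega>. indicator {s<..t} r *\<^sub>R (h r \<omega> - \<zeta> \<omega>)"]
      unfolding g_def[symmetric] by simp
    also have "\<dots> = (\<integral>\<^sup>+\<omega>. (\<integral>\<^sup>+r\<in>{s<..t}. ennreal ((norm (H r \<omega> - \<zeta> \<omega>))\<^sup>2) \<partial>lborel) \<partial>M)"
      using st by (intro nn_integral_cong) (auto simp: indicator_def h)
    finally show ?thesis by simp
  qed
  \<comment> \<open>The witness for the integrals: the part of \<open>J m\<close> after s minus the
    integral of \<zeta> over (s, t], so that its integrand approximates \<open>g\<close>.\<close>
  define E where "E m \<omega> = J2 m \<omega> - \<zeta> \<omega> *v (W t \<omega> - W s \<omega>)" for m \<omega>
  have elE: "elementary s (\<lambda>r \<omega>. indicator {s<..} r *\<^sub>R V m r \<omega> - indicator {s<..t} r *\<^sub>R \<zeta> \<omega>) (E m)" for m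
    unfolding E_def[abs_def]
    by (rule elementary_diff[OF el2 elementary_single[OF st(1) order_refl st(2) \<zeta>]])
  have meas[measurable]: "It \<in> borel_measurable M" "Is \<in> borel_measurable M" "J m \<in> borel_measurable M"
     "J' m \<in> borel_measurable M" "J1 m \<in> borel_measurable M" "J2 m \<in> borel_measurable M" for m
    using Is It elementary_integral_L2[OF el] elementary_integral_L2[OF el'] elementary_integral_L2[OF el1]
      elementary_integral_L2[OF el2] by (auto simp: has_ito_integral_def L2_def)
  have small: "?n (\<lambda>z. indicator A (fst z) *\<^sub>R (v m z - k z)) \<le> ?n (\<lambda>z. v m z - k z)" for m and A :: "real set"
    by (intro nn_integral_mono) (auto simp: indicator_def)
  have R: "?e (\<lambda>\<omega>. It \<omega> - Is \<omega> - \<zeta> \<omega> *v (W t \<omega> - W s \<omega>) - E m \<omega>) \<le>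
      2 * ?e (\<lambda>\<omega>. J m \<omega> - It \<omega>) + 2 * (2 * (2 * ?n (\<lambda>z. v m z - k z) + 2 * ?n (\<lambda>z. v' m z - k' z)) +
        2 * ?e (\<lambda>\<omega>. J' m \<omega> - Is \<omega>))" for m
  proof -
    have "?e (\<lambda>\<omega>. J1 m \<omega> - J' m \<omega>) =
      (\<integral>\<^sup>+\<omega>. (\<integral>\<^sup>+r. ennreal ((norm (indicator {..s} r *\<^sub>R V m r \<omega> - V' m r \<omega>))\<^sup>2) \<partial>lborel) \<partial>M)"
      by (rule elementary_isometry[OF elementary_diff[OF el1 el']])
    also have "\<dots> = ?n (\<lambda>z. indicator {..s} (fst z) *\<^sub>R v m z - v' m z)"
      using nn_integral_lborel_M[of "\<lambda>r \<omega>. indicator {..s} r *\<^sub>R V m r \<omega> - V' m r \<omega>"]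
      unfolding v_def[symmetric] v'_def[symmetric] by simp
    \<comment> \<open>Cutting \<open>k\<close> at s gives \<open>k'\<close>, so both can be inserted
      without changing the difference.\<close>
    also have "\<dots> = ?n (\<lambda>z. indicator {..s} (fst z) *\<^sub>R (v m z - k z) - (v' m z - k' z))"
      using st by (intro nn_integral_cong) (auto simp: indicator_def k_def k'_def)
    also have "\<dots> \<le> 2 * ?n (\<lambda>z. indicator {..s} (fst z) *\<^sub>R (v m z - k z)) + 2 * ?n (\<lambda>z. v' m z - k' z)"
      by (intro nn_integral_norm_sq_diff_le) measurable
    also have "\<dots> \<le> 2 * ?n (\<lambda>z. v m z - k z) + 2 * ?n (\<lambda>z. v' m z - k' z)"
      by (intro add_mono mult_left_mono small) auto
    finally have 1: "?e (\<lambda>\<omega>. J1 m \<omega> - J' m \<omega>) \<le> 2 * ?n (\<lambda>z. v m z - k z) + 2 * ?n (\<lambda>z. v' m z - k' z)" .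
    \<comment> \<open>The terms with \<zeta> cancel and J = J1 + J2, so the remainder is (It - J) +
      (J1 - J') + (J' - Is).\<close>
    have "?e (\<lambda>\<omega>. It \<omega> - Is \<omega> - \<zeta> \<omega> *v (W t \<omega> - W s \<omega>) - E m \<omega>) =
      ?e (\<lambda>\<omega>. ((J1 m \<omega> - J' m \<omega>) + (J' m \<omega> - Is \<omega>)) - (J m \<omega> - It \<omega>))"
      by (simp add: E_def J algebra_simps)
    also have "\<dots> \<le> 2 * ?e (\<lambda>\<omega>. (J1 m \<omega> - J' m \<omega>) + (J' m \<omega> - Is \<omega>)) + 2 * ?e (\<lambda>\<omega>. J m \<omega> - It \<omega>)"
      by (intro nn_integral_norm_sq_diff_le) measurable
    also have "\<dots> \<le> 2 * (2 * ?e (\<lambda>\<omega>. J1 m \<omega> - J' m \<omega>) + 2 * ?e (\<lambda>\<omega>. J' m \<omega> - Is \<omega>)) + 2 * ?e (\<lambda>\<omega>. J m \<omega> - It \<omega>)"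
      by (intro add_mono mult_left_mono nn_integral_norm_sq_add_le) auto
    also have "\<dots> \<le> 2 * (2 * (2 * ?n (\<lambda>z. v m z - k z) + 2 * ?n (\<lambda>z. v' m z - k' z)) + 2 * ?e (\<lambda>\<omega>. J' m \<omega> - Is \<omega>))
       + 2 * ?e (\<lambda>\<omega>. J m \<omega> - It \<omega>)"
      by (intro add_mono mult_left_mono 1) auto
    finally show ?thesis by (simp only: add.commute)
  qed
  have lim: "(\<lambda>m. 2 * ?e (\<lambda>\<omega>. J m \<omega> - It \<omega>) + 2 * (2 * (2 * ?n (\<lambda>z. v m z - k z) + 2 * ?n (\<lambda>z. v' m z - k' z)) +
        2 * ?e (\<lambda>\<omega>. J' m \<omega> - Is \<omega>))) \<longlonglongrightarrow> 2 * 0 + 2 * (2 * (2 * 0 + 2 * 0) + 2 * 0)"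
    using c1 c2 ci ci' unfolding J_def[symmetric] J'_def[symmetric]
    by (intro tendsto_add ennreal_tendsto_cmult) auto
  have R0: "(\<lambda>m. ?e (\<lambda>\<omega>. It \<omega> - Is \<omega> - \<zeta> \<omega> *v (W t \<omega> - W s \<omega>) - E m \<omega>)) \<longlonglongrightarrow> 0"
    by (rule tendsto_sandwich[OF _ _ tendsto_const, of 0]) (use R lim in auto)
  have Q: "?e (E m) \<le> 2 * ?n g + 2 * ?n (\<lambda>z. v m z - k z)" for m
  proof -
    have "?e (E m) = (\<integral>\<^sup>+\<omega>. (\<integral>\<^sup>+r. ennreal ((norm (indicator {s<..} r *\<^sub>R V m r \<omega> - indicator {s<..t} r *\<^sub>R \<zeta> \<omega>))\<^sup>2) \<partial>lborel) \<partial>M)"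
      by (rule elementary_isometry[OF elE])
    also have "\<dots> = ?n (\<lambda>z. indicator {s<..} (fst z) *\<^sub>R v m z - indicator {s<..t} (fst z) *\<^sub>R \<zeta> (snd z))"
      using nn_integral_lborel_M[of "\<lambda>r \<omega>. indicator {s<..} r *\<^sub>R V m r \<omega> - indicator {s<..t} r *\<^sub>R \<zeta> \<omega>"]
      unfolding v_def[symmetric] by simp
    \<comment> \<open>After s, \<open>k\<close> is the integrand on (s, t]; adding and subtracting
      it isolates \<open>g\<close>.\<close>
    also have "\<dots> = ?n (\<lambda>z. g z + indicator {s<..} (fst z) *\<^sub>R (v m z - k z))"
      using st by (intro nn_integral_cong) (auto simp: indicator_def k_def g_def)
    also have "\<dots> \<le> 2 * ?n g + 2 * ?n (\<lambda>z. indicator {s<..} (fst z) *\<^sub>R (v m z - k z))"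
      by (intro nn_integral_norm_sq_add_le) measurable
    also have "\<dots> \<le> 2 * ?n g + 2 * ?n (\<lambda>z. v m z - k z)"
      by (intro add_mono mult_left_mono small) auto
    finally show ?thesis .
  qed
  have "(\<lambda>m. 2 * ?n (\<lambda>z. v m z - k z)) \<longlonglongrightarrow> 2 * 0"
    using c1 by (intro ennreal_tendsto_cmult) auto
  then show ?thesis
    using elE R0 Q unfolding Gg
    by (intro exI[of _ "\<lambda>m r \<omega>. indicator {s<..} r *\<^sub>R V m r \<omega> - indicator {s<..t} r *\<^sub>R \<zeta> \<omega>"] exI[of _ E] conjI
          exI[of _ "\<lambda>m. 2 * ?n (\<lambda>z. v m z - k z)"]) auto
qed

text \<open>What survives the limit of elementary integrals. The constant 4 is 2 times 2: one factor
  from splitting L into L - J m and J m, the other already present in the bound for J m.\<close>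

lemma
  fixes H :: "real \<Rightarrow> 'w \<Rightarrow> real^'n^'n" and \<zeta> :: "'w \<Rightarrow> real^'n^'n" and It Is :: "'w \<Rightarrow> real^'n"
  assumes st: "0 \<le> s" "s \<le> t"
    and Is: "has_ito_integral M F W H s Is" and It: "has_ito_integral M F W H t It"
    and \<zeta>: "\<zeta> \<in> borel_measurable (F s)" "L2 M \<zeta>"
  defines "L \<equiv> \<lambda>\<omega>. It \<omega> - Is \<omega> - \<zeta> \<omega> *v (W t \<omega> - W s \<omega>)"
  shows ito_increment_L2: "L2 M L"
    and ito_increment_bound: "(\<integral>\<^sup>+\<omega>. ennreal ((norm (L \<omega>))\<^sup>2) \<partial>M) \<le>
      4 * (\<integral>\<^sup>+\<omega>. (\<integral>\<^sup>+r\<in>{s<..t}. ennreal ((norm (H r \<omega> - \<zeta> \<omega>))\<^sup>2) \<partial>lborel) \<partial>M)"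
    and ito_increment_orthogonal: "\<And>U. U \<in> borel_measurable (F s) \<Longrightarrow> L2 M U \<Longrightarrow> (\<integral>\<omega>. U \<omega> \<bullet> L \<omega> \<partial>M) = 0"
proof -
  let ?e = "\<lambda>f. \<integral>\<^sup>+\<omega>. ennreal ((norm (f \<omega>))\<^sup>2) \<partial>M"
  define G where "G = (\<integral>\<^sup>+\<omega>. (\<integral>\<^sup>+r\<in>{s<..t}. ennreal ((norm (H r \<omega> - \<zeta> \<omega>))\<^sup>2) \<partial>lborel) \<partial>M)"
  obtain V J q where el: "\<And>m. elementary s (V m) (J m)"
    and R: "(\<lambda>m. ?e (\<lambda>\<omega>. L \<omega> - J m \<omega>)) \<longlonglongrightarrow> 0"
    and q: "q \<longlonglongrightarrow> 0" and Q: "\<And>m. ?e (J m) \<le> 2 * G + q m"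
    using ito_increment_approximation[OF st Is It \<zeta>] unfolding L_def G_def by blast
  have J: "L2 M (J m)" for m by (rule elementary_integral_L2[OF el])
  have [measurable]: "J m \<in> borel_measurable M" for m by (rule L2_measurable[OF J])
  have [measurable]: "L \<in> borel_measurable M"
    unfolding L_def using Is It L2_measurable[OF L2_mult_incr[OF st \<zeta>]]
    by (auto simp: has_ito_integral_def)
  \<comment> \<open>By definition the integrals are just measurable; a finite distance to one square
    integrable \<open>J m\<close> makes L square integrable.\<close>
  have "eventually (\<lambda>m. ?e (\<lambda>\<omega>. L \<omega> - J m \<omega>) < 1) sequentially"
    using R by (rule order_tendstoD) simp
  then obtain m where "?e (\<lambda>\<omega>. L \<omega> - J m \<omega>) < 1"
    by (auto simp: eventually_sequentially)
  then have "L2 M (\<lambda>\<omega>. L \<omega> - J m \<omega>)"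
    by (intro L2_I_nn_integral) (auto intro: less_trans[OF _ ennreal_one_less_top])
  from L2_add[OF this J[of m]] show L: "L2 M L" by simp
  have LJ: "L2 M (\<lambda>\<omega>. L \<omega> - J m \<omega>)" for m by (intro L2_diff L J)
  have "?e L \<le> 2 * ?e (\<lambda>\<omega>. L \<omega> - J m \<omega>) + 2 * (2 * G + q m)" for m
  proof -
    have "?e L = ?e (\<lambda>\<omega>. (L \<omega> - J m \<omega>) + J m \<omega>)" by simp
    also have "\<dots> \<le> 2 * ?e (\<lambda>\<omega>. L \<omega> - J m \<omega>) + 2 * ?e (J m)"
      by (intro nn_integral_norm_sq_add_le) measurable
    also have "\<dots> \<le> 2 * ?e (\<lambda>\<omega>. L \<omega> - J m \<omega>) + 2 * (2 * G + q m)"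
      by (intro add_left_mono mult_left_mono Q) auto
    finally show ?thesis .
  qed
  moreover have "(\<lambda>m. 2 * ?e (\<lambda>\<omega>. L \<omega> - J m \<omega>) + 2 * (2 * G + q m)) \<longlonglongrightarrow> 2 * 0 + 2 * (2 * G + 0)"
    using R q by (intro tendsto_add ennreal_tendsto_cmult tendsto_const) auto
  ultimately have "?e L \<le> 2 * 0 + 2 * (2 * G + 0)"
    by (intro LIMSEQ_le_const) auto
  also have "\<dots> = 4 * G" by (simp add: mult.assoc[symmetric])
  finally show "?e L \<le> 4 * (\<integral>\<^sup>+\<omega>. (\<integral>\<^sup>+r\<in>{s<..t}. ennreal ((norm (H r \<omega> - \<zeta> \<omega>))\<^sup>2) \<partial>lborel) \<partial>M)"
    by (simp add: G_def)
  fix U :: "'w \<Rightarrow> real^'n" assume U: "U \<in> borel_measurable (F s)" "L2 M U"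
  have "(\<lambda>m. ennreal (\<integral>\<omega>. (norm (L \<omega> - J m \<omega>))\<^sup>2 \<partial>M)) \<longlonglongrightarrow> ennreal 0"
    using R by (simp add: L2_nn_integral[OF LJ])
  then have r: "(\<lambda>m. \<integral>\<omega>. (norm (L \<omega> - J m \<omega>))\<^sup>2 \<partial>M) \<longlonglongrightarrow> 0"
    by (subst (asm) tendsto_ennreal_iff) auto
  show "(\<integral>\<omega>. U \<omega> \<bullet> L \<omega> \<partial>M) = 0"
  proof (rule tendsto_0_of_sq_integral[OF _ r])
    fix c :: real and m assume c: "0 < c"
    have "(\<integral>\<omega>. U \<omega> \<bullet> L \<omega> \<partial>M) = (\<integral>\<omega>. U \<omega> \<bullet> (L \<omega> - J m \<omega>) \<partial>M) + (\<integral>\<omega>. U \<omega> \<bullet> J m \<omega> \<partial>M)"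
      using L2_inner_integrable[OF U(2) LJ[of m]] L2_inner_integrable[OF U(2) J[of m]]
      by (subst Bochner_Integration.integral_add[symmetric]) (auto simp: inner_add_right[symmetric])
    then have "2 * \<bar>\<integral>\<omega>. U \<omega> \<bullet> L \<omega> \<partial>M\<bar> = 2 * \<bar>\<integral>\<omega>. U \<omega> \<bullet> (L \<omega> - J m \<omega>) \<partial>M\<bar>"
      using elementary_orthogonal[OF el st(1) U, of m] by simp
    also have "\<dots> \<le> (\<integral>\<omega>. 2 * \<bar>U \<omega> \<bullet> (L \<omega> - J m \<omega>)\<bar> \<partial>M)"
      using integral_abs_bound[of M "\<lambda>\<omega>. U \<omega> \<bullet> (L \<omega> - J m \<omega>)"] by simp
    also have "\<dots> \<le> (\<integral>\<omega>. c * (norm (U \<omega>))\<^sup>2 + (norm (L \<omega> - J m \<omega>))\<^sup>2 / c \<partial>M)"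
    proof (rule integral_mono)
      show "2 * \<bar>U \<omega> \<bullet> (L \<omega> - J m \<omega>)\<bar> \<le> c * (norm (U \<omega>))\<^sup>2 + (norm (L \<omega> - J m \<omega>))\<^sup>2 / c" for \<omega>
        using norm_add_sq_weighted_le[OF c, of "U \<omega>" "L \<omega> - J m \<omega>"]
          norm_add_sq_weighted_le[OF c, of "- U \<omega>" "L \<omega> - J m \<omega>"] by (auto simp: abs_if)
    qed (use L2_inner_integrable[OF U(2) LJ[of m]] L2_integrable_norm_sq[OF U(2)] L2_integrable_norm_sq[OF LJ[of m]] in auto)
    also have "\<dots> = c * (\<integral>\<omega>. (norm (U \<omega>))\<^sup>2 \<partial>M) + (\<integral>\<omega>. (norm (L \<omega> - J m \<omega>))\<^sup>2 \<partial>M) / c"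
      using L2_integrable_norm_sq[OF U(2)] L2_integrable_norm_sq[OF LJ[of m]] by simp
    finally show "2 * \<bar>\<integral>\<omega>. U \<omega> \<bullet> L \<omega> \<partial>M\<bar> \<le> c * (\<integral>\<omega>. (norm (U \<omega>))\<^sup>2 \<partial>M) + (\<integral>\<omega>. (norm (L \<omega> - J m \<omega>))\<^sup>2 \<partial>M) / c" .
  qed simp
qed

end

section \<open>Moments of the solution\<close>

text \<open>The time integral along a path need not be measurable in \<omega>, because J is
  measurable at each time and continuous along almost every path only. The majorant \<open>N\<close>
  replaces it: discretised in time J is jointly measurable, the liminf recovers |J t|^2 along
  continuous paths, and Fatou's lemma bounds its expectation.\<close>

lemma (in prob_space) paths_sq_integral_bound:
  fixes J :: "real \<Rightarrow> 'a \<Rightarrow> 'b::euclidean_space"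
  assumes "0 \<le> T" and meas: "\<And>t. t \<in> {0..T} \<Longrightarrow> J t \<in> borel_measurable M"
    and cont: "AE \<omega> in M. continuous_on {0..T} (\<lambda>t. J t \<omega>)"
    and bound: "\<And>t. t \<in> {0..T} \<Longrightarrow> (\<integral>\<^sup>+\<omega>. ennreal ((norm (J t \<omega>))\<^sup>2) \<partial>M) \<le> K"
  shows "\<exists>N\<in>borel_measurable M.
    (AE \<omega> in M. (\<integral>\<^sup>+t\<in>{0..T}. ennreal ((norm (J t \<omega>))\<^sup>2) \<partial>lborel) \<le> N \<omega>) \<and>
    (\<integral>\<^sup>+\<omega>. N \<omega> \<partial>M) \<le> ennreal T * K"
proof -
  interpret P: pair_sigma_finite M "lborel :: real measure" by unfold_locales
  \<comment> \<open>Rounds t down to the grid of mesh 1 / (n + 1); \<open>clip\<close> then keeps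
    the time inside [0, T], where J is controlled.\<close>
  define d where "d n t = of_int \<lfloor>t * real (Suc n)\<rfloor> / real (Suc n)" for n :: nat and t :: real
  define clip where "clip t = max 0 (min T t)" for t :: real
  have clip: "clip t \<in> {0..T}" for t using \<open>0 \<le> T\<close> by (auto simp: clip_def)
  have d_le: "d n t \<le> t" for n t
  proof -
    have "real_of_int \<lfloor>t * real (Suc n)\<rfloor> \<le> t * real (Suc n)" by (rule of_int_floor_le)
    then show ?thesis unfolding d_def by (subst pos_divide_le_eq) auto
  qed
  have d_ge: "t - 1 / real (Suc n) \<le> d n t" for n t
  proof -
    have "t * real (Suc n) - 1 \<le> real_of_int \<lfloor>t * real (Suc n)\<rfloor>" by linarith
    then have "(t * real (Suc n) - 1) / real (Suc n) \<le> d n t"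
      unfolding d_def by (intro divide_right_mono) auto
    then show ?thesis by (simp add: diff_divide_distrib)
  qed
  have d_lim: "(\<lambda>n. d n t) \<longlonglongrightarrow> t" for t
  proof (rule tendsto_sandwich[OF _ _ _ tendsto_const])
    show "(\<lambda>n. t - 1 / real (Suc n)) \<longlonglongrightarrow> t"
      using tendsto_diff[OF tendsto_const LIMSEQ_inverse_real_of_nat, of t] by (simp add: inverse_eq_divide)
  qed (use d_le d_ge in auto)
  define G where "G n z = ennreal ((norm (J (clip (d n (snd z))) (fst z)))\<^sup>2) * indicator {0..T} (snd z)"
    for n and z :: "'a \<times> real"
  have [measurable]: "G n \<in> borel_measurable (M \<Otimes>\<^sub>M lborel)" for n
  proof -
    \<comment> \<open>Only countably many grid times occur, so measurability at each of them
      suffices.\<close>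
    have "(\<lambda>z. J (clip (of_int \<lfloor>snd z * real (Suc n)\<rfloor> / real (Suc n))) (fst z)) \<in> borel_measurable (M \<Otimes>\<^sub>M lborel)"
    proof (rule measurable_compose_countable[where f = "\<lambda>i z. J (clip (of_int i / real (Suc n))) (fst z)"])
      show "(\<lambda>z. J (clip (of_int i / real (Suc n))) (fst z)) \<in> borel_measurable (M \<Otimes>\<^sub>M lborel)" for i
        by (rule measurable_compose[OF measurable_fst meas[OF clip]])
    qed measurable
    then show ?thesis unfolding G_def[abs_def] d_def by measurable
  qed
  define N where "N \<omega> = (\<integral>\<^sup>+t. liminf (\<lambda>n. G n (\<omega>, t)) \<partial>lborel)" for \<omega>
  have N: "N \<in> borel_measurable M" unfolding N_def[abs_def] by measurable
  have "(\<integral>\<^sup>+\<omega>. N \<omega> \<partial>M) = (\<integral>\<^sup>+z. liminf (\<lambda>n. G n z) \<partial>(M \<Otimes>\<^sub>M lborel))"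
    unfolding N_def by (rule lborel.nn_integral_fst) measurable
  also have "\<dots> \<le> liminf (\<lambda>n. \<integral>\<^sup>+z. G n z \<partial>(M \<Otimes>\<^sub>M lborel))"
    by (rule nn_integral_liminf) measurable
  also have "\<dots> \<le> liminf (\<lambda>n. ennreal T * K)"
  proof (rule Liminf_mono, rule always_eventually, rule allI)
    fix n
    have "(\<integral>\<^sup>+z. G n z \<partial>(M \<Otimes>\<^sub>M lborel)) = (\<integral>\<^sup>+t. (\<integral>\<^sup>+\<omega>. G n (\<omega>, t) \<partial>M) \<partial>lborel)"
      by (rule P.nn_integral_snd[symmetric]) measurable
    also have "\<dots> \<le> (\<integral>\<^sup>+t. K * indicator {0..T} t \<partial>lborel)"
      by (intro nn_integral_mono) (auto simp: G_def indicator_def intro!: bound clip)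
    also have "\<dots> = ennreal T * K"
      using \<open>0 \<le> T\<close> by (simp add: nn_integral_cmult_indicator mult.commute)
    finally show "(\<integral>\<^sup>+z. G n z \<partial>(M \<Otimes>\<^sub>M lborel)) \<le> ennreal T * K" .
  qed
  also have "\<dots> = ennreal T * K" by (simp add: Liminf_const)
  finally have int: "(\<integral>\<^sup>+\<omega>. N \<omega> \<partial>M) \<le> ennreal T * K" .
  have "AE \<omega> in M. (\<integral>\<^sup>+t\<in>{0..T}. ennreal ((norm (J t \<omega>))\<^sup>2) \<partial>lborel) \<le> N \<omega>"
    using cont
  proof eventually_elim
    case (elim \<omega>)
    show ?case unfolding N_def
    proof (rule nn_integral_mono)
      fix t :: real
      show "ennreal ((norm (J t \<omega>))\<^sup>2) * indicator {0..T} t \<le> liminf (\<lambda>n. G n (\<omega>, t))"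
      proof (cases "t \<in> {0..T}")
        case True
        have "(\<lambda>n. clip (d n t)) \<longlonglongrightarrow> clip t"
          unfolding clip_def by (intro tendsto_intros d_lim)
        also have "clip t = t" using True by (simp add: clip_def)
        finally have "(\<lambda>n. J (clip (d n t)) \<omega>) \<longlonglongrightarrow> J t \<omega>"
          by (rule continuous_on_tendsto_compose[OF elim]) (use True clip in auto)
        then have "(\<lambda>n. ennreal ((norm (J (clip (d n t)) \<omega>))\<^sup>2)) \<longlonglongrightarrow> ennreal ((norm (J t \<omega>))\<^sup>2)"
          by (intro tendsto_ennrealI tendsto_intros)
        from lim_imp_Liminf[OF _ this] show ?thesis using True by (simp add: G_def)
      qed simp
    qed
  qed
  with N int show ?thesis by blast
qed

section \<open>The solution, its drift and its stochastic part\<close>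

locale mckean_vlasov = brownian_space M F W
  for M :: "'w measure" and F :: "real \<Rightarrow> 'w measure" and W :: "real \<Rightarrow> 'w \<Rightarrow> real^'n" +
  fixes b :: "real^'n \<Rightarrow> (real^'n) measure \<Rightarrow> real^'n"
    and \<sigma> :: "real^'n \<Rightarrow> (real^'n) measure \<Rightarrow> real^'n^'n"
    and T :: real and X\<^sub>0 :: "'w \<Rightarrow> real^'n" and X :: "real \<Rightarrow> 'w \<Rightarrow> real^'n"
    and c0 a b' :: real
  assumes const_pos: "0 < c0" "0 < a" "0 < b'"
    and growth_b: "\<And>x \<mu>. \<mu> \<in> P2 \<Longrightarrow> (norm (b x \<mu>))\<^sup>2 \<le> c0 * (1 + (norm x)\<^sup>2 + second_moment \<mu>)"
    and growth_\<sigma>: "\<And>x \<mu>. \<mu> \<in> P2 \<Longrightarrow> (norm (\<sigma> x \<mu>))\<^sup>2 \<le> c0 * (1 + (norm x)\<^sup>2 + second_moment \<mu>)"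
    and lip_b: "\<And>x y \<mu> \<nu>. \<mu> \<in> P2 \<Longrightarrow> \<nu> \<in> P2 \<Longrightarrow>
      (norm (b x \<mu> - b y \<nu>))\<^sup>2 \<le> a * (norm (x - y))\<^sup>2 + b' * (W2 \<mu> \<nu>)\<^sup>2"
    and lip_\<sigma>: "\<And>x y \<mu> \<nu>. \<mu> \<in> P2 \<Longrightarrow> \<nu> \<in> P2 \<Longrightarrow>
      (norm (\<sigma> x \<mu> - \<sigma> y \<nu>))\<^sup>2 \<le> a * (norm (x - y))\<^sup>2 + b' * (W2 \<mu> \<nu>)\<^sup>2"
    and T_pos: "0 < T"
    and X0_meas: "X\<^sub>0 \<in> borel_measurable (F 0)"
    and X0_L2: "L2 M X\<^sub>0"
    and sol: "mckean_vlasov_solution M F W b \<sigma> T X\<^sub>0 X"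
begin

definition drift :: "real \<Rightarrow> 'w \<Rightarrow> real^'n" where "drift r \<omega> = b (X r \<omega>) (law M (X r))"
definition diffusion :: "real \<Rightarrow> 'w \<Rightarrow> real^'n^'n" where "diffusion r \<omega> = \<sigma> (X r \<omega>) (law M (X r))"

text \<open>The solution provides, at each time separately, some version of the stochastic integral.
  The choices at different times are unrelated, so \<open>ito_part\<close> comes with no path
  properties.\<close>

definition ito_part :: "real \<Rightarrow> 'w \<Rightarrow> real^'n" where
  "ito_part t = (SOME Z. has_ito_integral M F W diffusion t Z \<and>
     (AE \<omega> in M. X t \<omega> = X\<^sub>0 \<omega> + set_lebesgue_integral lborel {0..t} (\<lambda>s. drift s \<omega>) + Z \<omega>))"

lemma X_measurable: "t \<in> {0..T} \<Longrightarrow> X t \<in> borel_measurable (F t)"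
  and X_continuous: "AE \<omega> in M. continuous_on {0..T} (\<lambda>t. X t \<omega>)"
  and X_law: "t \<in> {0..T} \<Longrightarrow> law M (X t) \<in> P2"
  and X_0: "AE \<omega> in M. X 0 \<omega> = X\<^sub>0 \<omega>"
  using sol by (auto simp: mckean_vlasov_solution_def)

lemma X_L2: "t \<in> {0..T} \<Longrightarrow> L2 M (X t)"
  by (rule L2_of_law_in_P2[OF measurable_F_M[OF X_measurable] X_law])

lemma
  assumes "t \<in> {0..T}"
  shows ito_part_ito: "has_ito_integral M F W diffusion t (ito_part t)"
    and X_eq: "AE \<omega> in M. X t \<omega> = X\<^sub>0 \<omega> + set_lebesgue_integral lborel {0..t} (\<lambda>s. drift s \<omega>) + ito_part t \<omega>"
proof -
  have "\<exists>Z. has_ito_integral M F W diffusion t Z \<and>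
     (AE \<omega> in M. X t \<omega> = X\<^sub>0 \<omega> + set_lebesgue_integral lborel {0..t} (\<lambda>s. drift s \<omega>) + Z \<omega>)"
    using sol assms unfolding mckean_vlasov_solution_def drift_def diffusion_def[abs_def] by blast
  from someI_ex[OF this] show "has_ito_integral M F W diffusion t (ito_part t)"
    "AE \<omega> in M. X t \<omega> = X\<^sub>0 \<omega> + set_lebesgue_integral lborel {0..t} (\<lambda>s. drift s \<omega>) + ito_part t \<omega>"
    unfolding ito_part_def by auto
qed

lemma drift_integrable: "integrable (lborel \<Otimes>\<^sub>M M) (\<lambda>z. indicator {0..T} (fst z) *\<^sub>R drift (fst z) (snd z))"
proof -
  have "set_integrable (lborel \<Otimes>\<^sub>M M) ({0..T} \<times> space M) (\<lambda>(s, \<omega>). drift s \<omega>)"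
    using sol by (simp add: mckean_vlasov_solution_def drift_def)
  then show ?thesis
    unfolding set_integrable_def
    by (rule Bochner_Integration.integrable_cong[THEN iffD1, rotated 2])
       (auto simp: space_pair_measure indicator_def)
qed

lemma drift_measurable: "(\<lambda>z. indicator {0..T} (fst z) *\<^sub>R drift (fst z) (snd z)) \<in> borel_measurable (lborel \<Otimes>\<^sub>M M)"
  using drift_integrable by (rule borel_measurable_integrable)

lemma drift_paths_integrable: "AE \<omega> in M. set_integrable lborel {0..T} (\<lambda>r. drift r \<omega>)"
proof -
  interpret P: pair_sigma_finite "lborel :: real measure" M by (rule pair_sigma_finite_lborel_M)
  show ?thesis unfolding set_integrable_def
    by (rule P.AE_integrable_snd) (use drift_integrable in \<open>simp add: case_prod_beta'\<close>)
qed

lemma drift_integral_measurable: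
  assumes "t \<in> {0..T}"
  shows "(\<lambda>\<omega>. set_lebesgue_integral lborel {0..t} (\<lambda>r. drift r \<omega>)) \<in> borel_measurable M"
proof -
  have [measurable]: "(\<lambda>z. indicator {0..T} (snd z) *\<^sub>R drift (snd z) (fst z)) \<in> borel_measurable (M \<Otimes>\<^sub>M lborel)"
    using measurable_compose[OF measurable_pair_swap' drift_measurable] by (simp add: case_prod_beta')
  have "(\<lambda>\<omega>. set_lebesgue_integral lborel {0..t} (\<lambda>r. drift r \<omega>)) =
    (\<lambda>\<omega>. set_lebesgue_integral lborel {0..t} (\<lambda>r. indicator {0..T} r *\<^sub>R drift r \<omega>))"
    using assms by (intro ext set_lebesgue_integral_cong) auto
  also have "\<dots> \<in> borel_measurable M"
    unfolding set_lebesgue_integral_def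
    by (rule lborel.borel_measurable_lebesgue_integral)
       (simp only: case_prod_beta', measurable)
  finally show ?thesis .
qed

definition diffusion_energy :: ennreal where
  "diffusion_energy = (\<integral>\<^sup>+\<omega>. (\<integral>\<^sup>+r\<in>{0..T}. ennreal ((norm (diffusion r \<omega>))\<^sup>2) \<partial>lborel) \<partial>M)"

lemma diffusion_energy_finite: "diffusion_energy < \<infinity>"
  using ito_part_ito[of T] T_pos by (simp add: has_ito_integral_def diffusion_energy_def)

text \<open>Gives the increment estimates a starting point: with s = 0 they become estimates of the
  integral itself.\<close>

lemma ito_integral_0: "has_ito_integral M F W diffusion 0 (\<lambda>_. 0)"
proof -
  have "progressively_measurable_upto F 0 diffusion"
    using ito_part_ito[of 0] T_pos by (simp add: has_ito_integral_def)
  moreover have "(\<integral>\<^sup>+s\<in>{0..0}. f s \<partial>lborel) = 0" for f :: "real \<Rightarrow> ennreal"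
    using nn_integral_null_set[of "{0..0}" lborel f] by (simp add: null_sets_def)
  moreover have "simple_process M F 0 0 (\<lambda>_. 0) (\<lambda>_ _. 0)"
    by (simp add: simple_process_def)
  ultimately show ?thesis
    unfolding has_ito_integral_def
    by (intro conjI exI[of _ "\<lambda>_. 0"] exI[of _ "\<lambda>_ _. 0"] exI[of _ "\<lambda>_ _ _. 0"])
       (auto simp: simple_ito_integral_def)
qed

lemma ito_part_bound: assumes "t \<in> {0..T}" shows "(\<integral>\<^sup>+\<omega>. ennreal ((norm (ito_part t \<omega>))\<^sup>2) \<partial>M) \<le> 4 * diffusion_energy"
proof -
  have "(\<integral>\<^sup>+\<omega>. ennreal ((norm (ito_part t \<omega> - 0 - 0 *v (W t \<omega> - W 0 \<omega>)))\<^sup>2) \<partial>M) \<le>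
      4 * (\<integral>\<^sup>+\<omega>. (\<integral>\<^sup>+r\<in>{0<..t}. ennreal ((norm (diffusion r \<omega> - 0))\<^sup>2) \<partial>lborel) \<partial>M)"
    using assms by (intro ito_increment_bound ito_integral_0 ito_part_ito) (auto intro: L2_zero)
  also have "\<dots> \<le> 4 * diffusion_energy"
    unfolding diffusion_energy_def using assms by (intro mult_left_mono nn_integral_mono) (auto simp: indicator_def)
  finally show ?thesis by simp
qed

text \<open>Another version of \<open>ito_part t\<close> at each t, read off from the equation. It
  inherits continuous paths from X and the drift integral, as a pathwise Gronwall argument
  requires.\<close>

definition ito_path :: "real \<Rightarrow> 'w \<Rightarrow> real^'n" where
  "ito_path t \<omega> = X t \<omega> - X\<^sub>0 \<omega> - set_lebesgue_integral lborel {0..t} (\<lambda>s. drift s \<omega>)"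

lemma X0_measurable: "X\<^sub>0 \<in> borel_measurable M"
  by (rule measurable_F_M[OF X0_meas])

lemma ito_path_measurable: "t \<in> {0..T} \<Longrightarrow> ito_path t \<in> borel_measurable M"
  unfolding ito_path_def[abs_def]
  by (intro borel_measurable_diff drift_integral_measurable X0_measurable measurable_F_M[OF X_measurable])

lemma ito_path_eq_ito_part: "t \<in> {0..T} \<Longrightarrow> AE \<omega> in M. ito_path t \<omega> = ito_part t \<omega>"
  by (drule X_eq, erule eventually_mono) (simp add: ito_path_def)

lemma ito_path_bound:
  assumes "t \<in> {0..T}" shows "(\<integral>\<^sup>+\<omega>. ennreal ((norm (ito_path t \<omega>))\<^sup>2) \<partial>M) \<le> 4 * diffusion_energy"
proof -
  have "(\<integral>\<^sup>+\<omega>. ennreal ((norm (ito_path t \<omega>))\<^sup>2) \<partial>M) = (\<integral>\<^sup>+\<omega>. ennreal ((norm (ito_part t \<omega>))\<^sup>2) \<partial>M)"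
    using ito_path_eq_ito_part[OF assms] by (intro nn_integral_cong_AE) auto
  with ito_part_bound[OF assms] show ?thesis by simp
qed

lemma set_integrable_initial:
  fixes f :: "real \<Rightarrow> 'b::euclidean_space"
  assumes "set_integrable lborel {0..T} f" "t \<in> {0..T}" shows "set_integrable lborel {0..t} f"
  by (rule set_integrable_subset[OF assms(1)]) (use assms(2) in auto)

lemma ito_path_continuous: "AE \<omega> in M. continuous_on {0..T} (\<lambda>t. ito_path t \<omega>)"
  using X_continuous drift_paths_integrable
proof eventually_elim
  case (elim \<omega>)
  have "continuous_on {0..T} (\<lambda>t. integral {0..t} (\<lambda>s. drift s \<omega>))"
    by (rule indefinite_integral_continuous_1[OF set_borel_integral_eq_integral(1)[OF elim(2)]])
  then have "continuous_on {0..T} (\<lambda>t. X t \<omega> - X\<^sub>0 \<omega> - integral {0..t} (\<lambda>s. drift s \<omega>))"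
    by (intro continuous_intros elim)
  moreover have "ito_path t \<omega> = X t \<omega> - X\<^sub>0 \<omega> - integral {0..t} (\<lambda>s. drift s \<omega>)" if "t \<in> {0..T}" for t
    unfolding ito_path_def by (subst set_borel_integral_eq_integral(2)[OF set_integrable_initial[OF elim(2) that]]) simp
  ultimately show ?case using continuous_on_cong[OF refl] by (metis (no_types, lifting))
qed

section \<open>Second moments of the solution, uniformly in time\<close>

lemma lip_b_law:
  assumes "\<mu> \<in> P2" "W2 \<mu> \<mu> = 0"
  shows "norm (b x \<mu> - b y \<mu>) \<le> sqrt a * norm (x - y)"
proof -
  have "(norm (b x \<mu> - b y \<mu>))\<^sup>2 \<le> (sqrt a * norm (x - y))\<^sup>2"
    using lip_b[OF assms(1,1), of x y] assms(2) const_pos by (simp add: power_mult_distrib)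
  then show ?thesis by (rule power2_le_imp_le) (use const_pos in simp)
qed

lemma W2_law_self: "t \<in> {0..T} \<Longrightarrow> W2 (law M (X t)) (law M (X t)) = 0"
  using W2_sq_law_le[OF prob_space_axioms, of "X t" "X t"] measurable_F_M[OF X_measurable, of t] by simp

text \<open>A uniform bound on the second moments is not part of the notion of solution. Fixing one good path
  \<open>\<omega>0\<close>, the Lipschitz condition bounds the drift along any other path by a deterministic integrable
  function and the norm of that path, so that Gronwall's inequality applies path by path, where
  integrability holds by continuity.\<close>

lemma path_bound:
  "\<exists>Gb\<ge>0. AE \<omega> in M. \<forall>t\<in>{0..T}. norm (X t \<omega>) \<le> norm (X\<^sub>0 \<omega>) + norm (ito_path t \<omega>) + Gb +
     sqrt a * (exp (sqrt a * T) * integral {0..T} (\<lambda>t. norm (X\<^sub>0 \<omega>) + norm (ito_path t \<omega>) + Gb))"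
proof -
  define c where "c = sqrt a"
  have c: "0 \<le> c" using const_pos by (simp add: c_def)
  \<comment> \<open>On a probability space an almost sure property holds at some point.\<close>
  have "\<exists>\<omega>0. continuous_on {0..T} (\<lambda>t. X t \<omega>0) \<and> set_integrable lborel {0..T} (\<lambda>r. drift r \<omega>0)"
  proof (rule ccontr)
    assume *: "\<not> ?thesis"
    have "AE \<omega> in M. False" using X_continuous drift_paths_integrable by eventually_elim (use * in blast)
    then show False by simp
  qed
  then obtain \<omega>0 where \<omega>0: "continuous_on {0..T} (\<lambda>t. X t \<omega>0)" "set_integrable lborel {0..T} (\<lambda>r. drift r \<omega>0)"
    by blast
  \<comment> \<open>Both paths see the same law at time r, so their drifts differ by at most c |X r
    \<omega> - X r \<omega>0|; \<open>Gf\<close> collects what depends on \<omega>0 only. The growth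
    condition would instead bring in the second moment at time r, which is not yet bounded in
    r.\<close>
  define Gf where "Gf r = norm (drift r \<omega>0) + c * norm (X r \<omega>0)" for r
  have Gf_nn: "0 \<le> Gf r" for r using c by (simp add: Gf_def)
  have "set_integrable lborel {0..T} (\<lambda>r. norm (drift r \<omega>0))" by (rule set_integrable_norm[OF \<omega>0(2)])
  then have "(\<lambda>r. norm (drift r \<omega>0)) integrable_on {0..T}" by (rule set_borel_integral_eq_integral(1))
  moreover have "(\<lambda>r. c * norm (X r \<omega>0)) integrable_on {0..T}"
    by (intro integrable_continuous_interval continuous_intros \<omega>0(1))
  ultimately have Gf: "Gf integrable_on {0..T}"
    unfolding Gf_def[abs_def] by (rule integrable_add)
  define Gb where "Gb = integral {0..T} Gf"
  have Gb: "0 \<le> Gb" unfolding Gb_def by (rule integral_nonneg[OF Gf Gf_nn])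
  have "AE \<omega> in M. \<forall>t\<in>{0..T}. norm (X t \<omega>) \<le> norm (X\<^sub>0 \<omega>) + norm (ito_path t \<omega>) + Gb +
     c * (exp (c * T) * integral {0..T} (\<lambda>t. norm (X\<^sub>0 \<omega>) + norm (ito_path t \<omega>) + Gb))"
    using X_continuous ito_path_continuous drift_paths_integrable
  proof eventually_elim
    case (elim \<omega>)
    define \<phi> where "\<phi> t = norm (X t \<omega>)" for t
    define \<psi> where "\<psi> t = norm (X\<^sub>0 \<omega>) + norm (ito_path t \<omega>) + Gb" for t
    have cont: "continuous_on {0..T} \<phi>" "continuous_on {0..T} \<psi>"
      unfolding \<phi>_def \<psi>_def by (intro continuous_intros elim)+
    have le: "\<phi> t \<le> \<psi> t + c * integral {0..t} \<phi>" if t: "t \<in> {0..T}" for t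
    proof -
      have sub: "{0..t} \<subseteq> {0..T}" using t by auto
      note Bt = set_borel_integral_eq_integral[OF set_integrable_initial[OF elim(3) t]]
      have Gt: "Gf integrable_on {0..t}" by (rule integrable_on_subinterval[OF Gf sub])
      have \<phi>t: "(\<lambda>r. c * \<phi> r) integrable_on {0..t}"
        by (intro integrable_continuous_interval continuous_intros continuous_on_subset[OF cont(1) sub])
      have "norm (integral {0..t} (\<lambda>r. drift r \<omega>)) \<le> integral {0..t} (\<lambda>r. Gf r + c * \<phi> r)"
      proof (rule Henstock_Kurzweil_Integration.integral_norm_bound_integral[OF Bt(1) integrable_add[OF Gt \<phi>t]])
        fix r assume "r \<in> {0..t}"
        then have r: "r \<in> {0..T}" using sub by auto
        have "norm (drift r \<omega> - drift r \<omega>0) \<le> c * norm (X r \<omega> - X r \<omega>0)"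
          unfolding drift_def c_def using lip_b_law[OF X_law[OF r]] W2_law_self[OF r] by simp
        also have "\<dots> \<le> c * (norm (X r \<omega>) + norm (X r \<omega>0))"
          by (intro mult_left_mono norm_triangle_ineq4 c)
        finally show "norm (drift r \<omega>) \<le> Gf r + c * \<phi> r"
          using norm_triangle_ineq2[of "drift r \<omega>" "drift r \<omega>0"] by (simp add: Gf_def \<phi>_def algebra_simps)
      qed
      also have "\<dots> = integral {0..t} Gf + c * integral {0..t} \<phi>"
        using Gt \<phi>t by (simp add: Henstock_Kurzweil_Integration.integral_add)
      also have "integral {0..t} Gf \<le> Gb"
        unfolding Gb_def by (rule integral_subset_le[OF sub Gt Gf]) (simp add: Gf_nn)
      finally have drift: "norm (set_lebesgue_integral lborel {0..t} (\<lambda>s. drift s \<omega>)) \<le> Gb + c * integral {0..t} \<phi>"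
        by (simp add: Bt(2))
      have "X t \<omega> = X\<^sub>0 \<omega> + ito_path t \<omega> + set_lebesgue_integral lborel {0..t} (\<lambda>s. drift s \<omega>)"
        by (simp add: ito_path_def)
      then have "\<phi> t \<le> norm (X\<^sub>0 \<omega>) + norm (ito_path t \<omega>) + norm (set_lebesgue_integral lborel {0..t} (\<lambda>s. drift s \<omega>))"
        unfolding \<phi>_def by (metis add_mono_thms_linordered_semiring(3) norm_triangle_ineq norm_triangle_le)
      with drift show ?thesis by (simp add: \<psi>_def)
    qed
    show ?case
    proof
      fix t assume t: "t \<in> {0..T}"
      have "integral {0..t} \<phi> \<le> exp (c * T) * integral {0..T} \<psi>"
        by (rule gronwall_pathwise[OF cont _ _ c le t]) (use Gb in \<open>auto simp: \<phi>_def \<psi>_def\<close>)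
      then have "\<psi> t + c * integral {0..t} \<phi> \<le> \<psi> t + c * (exp (c * T) * integral {0..T} \<psi>)"
        by (intro add_left_mono mult_left_mono c)
      with le[OF t] show "norm (X t \<omega>) \<le> norm (X\<^sub>0 \<omega>) + norm (ito_path t \<omega>) + Gb +
          c * (exp (c * T) * integral {0..T} (\<lambda>t. norm (X\<^sub>0 \<omega>) + norm (ito_path t \<omega>) + Gb))"
        by (simp add: \<phi>_def \<psi>_def[abs_def])
    qed
  qed
  with Gb show ?thesis unfolding c_def by blast
qed

text \<open>Squares the pathwise bound and takes expectations. Besides the initial value and
  constants, that bound contains only \<open>ito_path\<close>, whose moments are controlled by the
  energy of the diffusion.\<close>

lemma moment_bound_nn:
  "\<exists>K<top. \<forall>t\<in>{0..T}. (\<integral>\<^sup>+\<omega>. ennreal ((norm (X t \<omega>))\<^sup>2) \<partial>M) \<le> K"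
proof -
  obtain Gb where Gb: "0 \<le> Gb" and path: "AE \<omega> in M. \<forall>t\<in>{0..T}. norm (X t \<omega>) \<le> norm (X\<^sub>0 \<omega>) + norm (ito_path t \<omega>) + Gb +
     sqrt a * (exp (sqrt a * T) * integral {0..T} (\<lambda>t. norm (X\<^sub>0 \<omega>) + norm (ito_path t \<omega>) + Gb))"
    using path_bound by blast
  obtain N where N[measurable]: "N \<in> borel_measurable M"
    and JN: "AE \<omega> in M. (\<integral>\<^sup>+t\<in>{0..T}. ennreal ((norm (ito_path t \<omega>))\<^sup>2) \<partial>lborel) \<le> N \<omega>"
    and N_int: "(\<integral>\<^sup>+\<omega>. N \<omega> \<partial>M) \<le> ennreal T * (4 * diffusion_energy)"
    using paths_sq_integral_bound[OF less_imp_le[OF T_pos] ito_path_measurable ito_path_continuous ito_path_bound] by blast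
  have [measurable]: "X\<^sub>0 \<in> borel_measurable M" by (rule X0_measurable)
  define c where "c = sqrt a * exp (sqrt a * T)"
  \<comment> \<open>Dominates the coefficients 1, c and 1 + c T that occur in the pathwise
    bound.\<close>
  define A where "A = 1 + c * (T + 1)"
  have c: "0 \<le> c" using const_pos by (simp add: c_def)
  have A: "1 \<le> A" "c \<le> A" "1 + c * T \<le> A" using c T_pos by (auto simp: A_def algebra_simps)
  define C where "C = ennreal (4 * A\<^sup>2)"
  \<comment> \<open>The 4 A^2 in \<open>C\<close> comes from squaring a sum of four terms. The last
    summand bounds the squared time integral of |ito_path|: Cauchy-Schwarz in time gives one factor
    T, integrating the uniform bound over [0, T] the other.\<close>
  define K where "K = C * ((\<integral>\<^sup>+\<omega>. ennreal ((norm (X\<^sub>0 \<omega>))\<^sup>2) \<partial>M) + ennreal (Gb\<^sup>2) + 4 * diffusion_energy +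
    ennreal T * (ennreal T * (4 * diffusion_energy)))"
  have "(\<integral>\<^sup>+\<omega>. ennreal ((norm (X t \<omega>))\<^sup>2) \<partial>M) \<le> K" if t: "t \<in> {0..T}" for t
  proof -
    have [measurable]: "ito_path t \<in> borel_measurable M" by (rule ito_path_measurable[OF t])
    have "AE \<omega> in M. ennreal ((norm (X t \<omega>))\<^sup>2) \<le>
      C * (ennreal ((norm (X\<^sub>0 \<omega>))\<^sup>2) + ennreal (Gb\<^sup>2) + ennreal ((norm (ito_path t \<omega>))\<^sup>2) + ennreal T * N \<omega>)"
      using path JN ito_path_continuous
    proof eventually_elim
      case (elim \<omega>)
      define Z where "Z = integral {0..T} (\<lambda>t. norm (ito_path t \<omega>))"
      have cont: "continuous_on {0..T} (\<lambda>t. norm (ito_path t \<omega>))" by (intro continuous_intros elim)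
      have sint: "set_integrable lborel {0..T} (\<lambda>t. norm (ito_path t \<omega>))"
        by (rule borel_integrable_atLeastAtMost'[OF cont])
      have Z: "Z = set_lebesgue_integral lborel {0..T} (\<lambda>t. norm (ito_path t \<omega>))"
        unfolding Z_def by (rule set_borel_integral_eq_integral(2)[OF sint, symmetric])
      have Z0: "0 \<le> Z" unfolding Z_def
        by (rule integral_nonneg) (auto intro: integrable_continuous_interval cont)
      have "ennreal (Z\<^sup>2) \<le> ennreal T * (\<integral>\<^sup>+t\<in>{0..T}. ennreal ((norm (norm (ito_path t \<omega>)))\<^sup>2) \<partial>lborel)"
        using norm_integral_sq_le[OF _ _ T_pos sint] T_pos Z Z0 by simp
      also have "\<dots> \<le> ennreal T * N \<omega>" using elim(2) by (intro mult_left_mono) auto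
      finally have ZN: "ennreal (Z\<^sup>2) \<le> ennreal T * N \<omega>" .
      have "integral {0..T} (\<lambda>t. norm (X\<^sub>0 \<omega>) + norm (ito_path t \<omega>) + Gb) =
        integral {0..T} (\<lambda>t. (norm (X\<^sub>0 \<omega>) + Gb) + norm (ito_path t \<omega>))" by (simp add: add_ac)
      also have "\<dots> = T * (norm (X\<^sub>0 \<omega>) + Gb) + Z"
        unfolding Z_def using cont T_pos
        by (subst Henstock_Kurzweil_Integration.integral_add) (auto intro: integrable_continuous_interval)
      finally have "norm (X t \<omega>) \<le> norm (X\<^sub>0 \<omega>) + norm (ito_path t \<omega>) + Gb + c * (T * (norm (X\<^sub>0 \<omega>) + Gb) + Z)"
        using elim(1)[rule_format, OF t] by (simp add: c_def mult.assoc)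
      also have "\<dots> = (1 + c * T) * norm (X\<^sub>0 \<omega>) + (1 + c * T) * Gb + 1 * norm (ito_path t \<omega>) + c * Z"
        by (simp add: algebra_simps)
      also have "\<dots> \<le> A * norm (X\<^sub>0 \<omega>) + A * Gb + A * norm (ito_path t \<omega>) + A * Z"
        using A Gb Z0 by (intro add_mono mult_right_mono) auto
      finally have "norm (X t \<omega>) \<le> A * (norm (X\<^sub>0 \<omega>) + Gb + norm (ito_path t \<omega>) + Z)"
        by (simp add: algebra_simps)
      then have "(norm (X t \<omega>))\<^sup>2 \<le> (A * (norm (X\<^sub>0 \<omega>) + Gb + norm (ito_path t \<omega>) + Z))\<^sup>2"
        by (rule power_mono) simp
      also have "\<dots> \<le> A\<^sup>2 * (4 * ((norm (X\<^sub>0 \<omega>))\<^sup>2 + Gb\<^sup>2 + (norm (ito_path t \<omega>))\<^sup>2 + Z\<^sup>2))"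
        unfolding power_mult_distrib by (intro mult_left_mono sum4_sq_le) simp
      finally have "ennreal ((norm (X t \<omega>))\<^sup>2) \<le> ennreal ((4 * A\<^sup>2) * ((norm (X\<^sub>0 \<omega>))\<^sup>2 + Gb\<^sup>2 + (norm (ito_path t \<omega>))\<^sup>2 + Z\<^sup>2))"
        by (intro ennreal_leI) (simp add: algebra_simps)
      also have "\<dots> = C * (ennreal ((norm (X\<^sub>0 \<omega>))\<^sup>2) + ennreal (Gb\<^sup>2) + ennreal ((norm (ito_path t \<omega>))\<^sup>2) + ennreal (Z\<^sup>2))"
        unfolding C_def by (subst ennreal_mult) (auto simp: ennreal_plus)
      also have "\<dots> \<le> C * (ennreal ((norm (X\<^sub>0 \<omega>))\<^sup>2) + ennreal (Gb\<^sup>2) + ennreal ((norm (ito_path t \<omega>))\<^sup>2) + ennreal T * N \<omega>)"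
        by (intro mult_left_mono add_left_mono ZN) auto
      finally show ?case .
    qed
    then have "(\<integral>\<^sup>+\<omega>. ennreal ((norm (X t \<omega>))\<^sup>2) \<partial>M) \<le> (\<integral>\<^sup>+\<omega>.
      C * (ennreal ((norm (X\<^sub>0 \<omega>))\<^sup>2) + ennreal (Gb\<^sup>2) + ennreal ((norm (ito_path t \<omega>))\<^sup>2) + ennreal T * N \<omega>) \<partial>M)"
      by (rule nn_integral_mono_AE)
    also have "\<dots> = C * ((\<integral>\<^sup>+\<omega>. ennreal ((norm (X\<^sub>0 \<omega>))\<^sup>2) \<partial>M) + ennreal (Gb\<^sup>2) +
        (\<integral>\<^sup>+\<omega>. ennreal ((norm (ito_path t \<omega>))\<^sup>2) \<partial>M) + ennreal T * (\<integral>\<^sup>+\<omega>. N \<omega> \<partial>M))"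
      by (simp add: nn_integral_cmult nn_integral_add emeasure_space_1)
    also have "\<dots> \<le> K"
      unfolding K_def by (intro mult_left_mono add_mono add_left_mono ito_path_bound t N_int) auto
    finally show ?thesis .
  qed
  moreover have "K < top"
    using diffusion_energy_finite L2_nn_integral[OF X0_L2] unfolding K_def C_def
    by (auto simp: ennreal_mult_less_top)
  ultimately show ?thesis by blast
qed

lemma moment_bound: "\<exists>K\<ge>0. \<forall>t\<in>{0..T}. (\<integral>\<omega>. (norm (X t \<omega>))\<^sup>2 \<partial>M) \<le> K"
proof -
  obtain K where K: "K < top" "\<And>t. t \<in> {0..T} \<Longrightarrow> (\<integral>\<^sup>+\<omega>. ennreal ((norm (X t \<omega>))\<^sup>2) \<partial>M) \<le> K"
    using moment_bound_nn by blast
  have "(\<integral>\<omega>. (norm (X t \<omega>))\<^sup>2 \<partial>M) \<le> enn2real K" if "t \<in> {0..T}" for t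
    by (rule L2_integral_le_of_nn_integral_le[OF X_L2[OF that]]) (use K that in auto)
  then show ?thesis by (intro exI[of _ "enn2real K"]) auto
qed

end

section \<open>The error of the Euler-Maruyama scheme\<close>

text \<open>The distance of the laws is a constant, and its square is at most the expected squared
  distance of the random variables; so the measure argument contributes the same quantity as the
  space argument, with b' in place of a.\<close>

lemma nn_integral_lipschitz_coeff_le:
  fixes f :: "'a::euclidean_space \<Rightarrow> 'a measure \<Rightarrow> 'b::real_normed_vector"
  assumes "prob_space M" and L2: "L2 M \<xi>" "L2 M \<eta>" and "0 \<le> a" "0 \<le> b'"
    and lip: "\<And>x y \<mu> \<nu>. \<mu> \<in> P2 \<Longrightarrow> \<nu> \<in> P2 \<Longrightarrow>
      (norm (f x \<mu> - f y \<nu>))\<^sup>2 \<le> a * (norm (x - y))\<^sup>2 + b' * (W2 \<mu> \<nu>)\<^sup>2"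
  shows "(\<integral>\<^sup>+\<omega>. ennreal ((norm (f (\<xi> \<omega>) (law M \<xi>) - f (\<eta> \<omega>) (law M \<eta>)))\<^sup>2) \<partial>M) \<le>
    ennreal ((a + b') * (\<integral>\<omega>. (norm (\<xi> \<omega> - \<eta> \<omega>))\<^sup>2 \<partial>M))"
proof -
  interpret prob_space M by fact
  let ?D = "\<integral>\<omega>. (norm (\<xi> \<omega> - \<eta> \<omega>))\<^sup>2 \<partial>M"
  have int: "integrable M (\<lambda>\<omega>. (norm (\<xi> \<omega> - \<eta> \<omega>))\<^sup>2)"
    by (intro L2_integrable_norm_sq L2_diff L2)
  have "(\<integral>\<^sup>+\<omega>. ennreal ((norm (f (\<xi> \<omega>) (law M \<xi>) - f (\<eta> \<omega>) (law M \<eta>)))\<^sup>2) \<partial>M) \<le>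
    (\<integral>\<^sup>+\<omega>. ennreal (a * (norm (\<xi> \<omega> - \<eta> \<omega>))\<^sup>2 + b' * ?D) \<partial>M)"
  proof (intro nn_integral_mono ennreal_leI)
    fix \<omega>
    have "(norm (f (\<xi> \<omega>) (law M \<xi>) - f (\<eta> \<omega>) (law M \<eta>)))\<^sup>2 \<le>
      a * (norm (\<xi> \<omega> - \<eta> \<omega>))\<^sup>2 + b' * (W2 (law M \<xi>) (law M \<eta>))\<^sup>2"
      by (intro lip law_in_P2 L2 assms(1))
    also have "\<dots> \<le> a * (norm (\<xi> \<omega> - \<eta> \<omega>))\<^sup>2 + b' * ?D"
      by (intro add_left_mono mult_left_mono W2_sq_law_le assms L2_measurable)
    finally show "(norm (f (\<xi> \<omega>) (law M \<xi>) - f (\<eta> \<omega>) (law M \<eta>)))\<^sup>2 \<le>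
      a * (norm (\<xi> \<omega> - \<eta> \<omega>))\<^sup>2 + b' * ?D" .
  qed
  also have "\<dots> = ennreal (\<integral>\<omega>. a * (norm (\<xi> \<omega> - \<eta> \<omega>))\<^sup>2 + b' * ?D \<partial>M)"
    using int assms(4,5) by (intro nn_integral_eq_integral) auto
  also have "(\<integral>\<omega>. a * (norm (\<xi> \<omega> - \<eta> \<omega>))\<^sup>2 + b' * ?D \<partial>M) = (a + b') * ?D"
    using int by (simp add: prob_space algebra_simps)
  finally show ?thesis .
qed

text \<open>The second moment of the law is E|\<xi>|^2 itself, hence the factor 2.\<close>

lemma nn_integral_growth_coeff_le:
  fixes f :: "'a::euclidean_space \<Rightarrow> 'a measure \<Rightarrow> 'b::real_normed_vector"
  assumes "prob_space M" and L2: "L2 M \<xi>" and "0 \<le> c"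
    and growth: "\<And>x \<mu>. \<mu> \<in> P2 \<Longrightarrow> (norm (f x \<mu>))\<^sup>2 \<le> c * (1 + (norm x)\<^sup>2 + second_moment \<mu>)"
  shows "(\<integral>\<^sup>+\<omega>. ennreal ((norm (f (\<xi> \<omega>) (law M \<xi>)))\<^sup>2) \<partial>M) \<le>
    ennreal (c * (1 + 2 * (\<integral>\<omega>. (norm (\<xi> \<omega>))\<^sup>2 \<partial>M)))"
proof -
  interpret prob_space M by fact
  let ?m = "\<integral>\<omega>. (norm (\<xi> \<omega>))\<^sup>2 \<partial>M"
  have int: "integrable M (\<lambda>\<omega>. (norm (\<xi> \<omega>))\<^sup>2)"
    by (intro L2_integrable_norm_sq L2)
  have "(\<integral>\<^sup>+\<omega>. ennreal ((norm (f (\<xi> \<omega>) (law M \<xi>)))\<^sup>2) \<partial>M) \<le>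
    (\<integral>\<^sup>+\<omega>. ennreal (c * (1 + (norm (\<xi> \<omega>))\<^sup>2 + ?m)) \<partial>M)"
    using growth[OF law_in_P2[OF assms(1) L2]]
    by (intro nn_integral_mono ennreal_leI) (simp add: second_moment_law[OF L2_measurable[OF L2]])
  also have "\<dots> = ennreal (\<integral>\<omega>. c * (1 + (norm (\<xi> \<omega>))\<^sup>2 + ?m) \<partial>M)"
    using int assms(3) by (intro nn_integral_eq_integral) auto
  also have "(\<integral>\<omega>. c * (1 + (norm (\<xi> \<omega>))\<^sup>2 + ?m) \<partial>M) = c * (1 + 2 * ?m)"
    using int by (simp add: prob_space algebra_simps)
  finally show ?thesis .
qed

text \<open>For a fixed law the Wasserstein term vanishes, and the coefficient is Lipschitz in space
  with constant sqrt a.\<close>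

lemma lipschitz_coeff_measurable:
  fixes f :: "'a::euclidean_space \<Rightarrow> 'a measure \<Rightarrow> 'b::real_normed_vector"
  assumes "prob_space M" and L2: "L2 M \<xi>" and "0 \<le> a"
    and lip: "\<And>x y \<mu> \<nu>. \<mu> \<in> P2 \<Longrightarrow> \<nu> \<in> P2 \<Longrightarrow>
      (norm (f x \<mu> - f y \<nu>))\<^sup>2 \<le> a * (norm (x - y))\<^sup>2 + b' * (W2 \<mu> \<nu>)\<^sup>2"
  shows "(\<lambda>x. f x (law M \<xi>)) \<in> borel_measurable borel"
proof (rule borel_measurable_continuous_onI, rule lipschitz_on_continuous_on, rule lipschitz_onI)
  fix x y
  have "(W2 (law M \<xi>) (law M \<xi>))\<^sup>2 \<le> 0"
    using W2_sq_law_le[OF assms(1) L2_measurable[OF L2] L2_measurable[OF L2]] by simp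
  then have "(norm (f x (law M \<xi>) - f y (law M \<xi>)))\<^sup>2 \<le> (sqrt a * norm (x - y))\<^sup>2"
    using lip[OF law_in_P2[OF assms(1) L2] law_in_P2[OF assms(1) L2], of x y] \<open>0 \<le> a\<close>
    by (simp add: power_mult_distrib)
  then show "dist (f x (law M \<xi>)) (f y (law M \<xi>)) \<le> sqrt a * dist x y"
    unfolding dist_norm by (rule power2_le_imp_le) (use \<open>0 \<le> a\<close> in simp)
qed (use \<open>0 \<le> a\<close> in simp)

section \<open>Increments of the solution over a short interval\<close>

context mckean_vlasov
begin

lemma drift_increment_bound:
  assumes st: "0 \<le> s" "s < t" "t \<le> T" and v[measurable]: "v \<in> borel_measurable M"
    and q: "\<And>r. r \<in> {s<..t} \<Longrightarrow> (\<integral>\<^sup>+\<omega>. ennreal ((norm (drift r \<omega> - v \<omega>))\<^sup>2) \<partial>M) \<le> ennreal q" "0 \<le> q"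
  shows "(\<integral>\<^sup>+\<omega>. ennreal ((norm (X t \<omega> - X s \<omega> - (ito_part t \<omega> - ito_part s \<omega>) - (t - s) *\<^sub>R v \<omega>))\<^sup>2) \<partial>M) \<le> ennreal ((t - s)\<^sup>2 * q)"
proof -
  let ?A = "{s<..t}"
  have st': "s \<in> {0..T}" "t \<in> {0..T}" using st by auto
  \<comment> \<open>Joint measurability of the drift is known on [0, T], hence the cut-off; on (s,
    t] nothing changes.\<close>
  define g where "g r \<omega> = indicator {0..T} r *\<^sub>R drift r \<omega> - v \<omega>" for r \<omega>
  have gB: "g r \<omega> = drift r \<omega> - v \<omega>" if "r \<in> ?A" for r \<omega> using that st by (simp add: g_def)
  have gm: "(\<lambda>z. g (fst z) (snd z)) \<in> borel_measurable (lborel \<Otimes>\<^sub>M M)"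
    unfolding g_def using drift_measurable by measurable
  have [measurable]: "(\<lambda>z. g (snd z) (fst z)) \<in> borel_measurable (M \<Otimes>\<^sub>M lborel)"
    using measurable_compose[OF measurable_pair_swap' gm] by (simp add: case_prod_beta')
  have em: "emeasure lborel ?A = ennreal (t - s)" using st by simp
  have "AE \<omega> in M. ennreal ((norm (X t \<omega> - X s \<omega> - (ito_part t \<omega> - ito_part s \<omega>) - (t - s) *\<^sub>R v \<omega>))\<^sup>2) \<le>
    ennreal (t - s) * (\<integral>\<^sup>+r\<in>?A. ennreal ((norm (g r \<omega>))\<^sup>2) \<partial>lborel)"
    using X_eq[OF st'(2)] X_eq[OF st'(1)] drift_paths_integrable
  proof eventually_elim
    case (elim \<omega>)
    have "X t \<omega> = X\<^sub>0 \<omega> + set_lebesgue_integral lborel {0..t} (\<lambda>s. drift s \<omega>) + ito_part t \<omega>"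
      "X s \<omega> = X\<^sub>0 \<omega> + set_lebesgue_integral lborel {0..s} (\<lambda>s. drift s \<omega>) + ito_part s \<omega>"
      using elim(1,2) st by auto
    moreover have i: "set_integrable lborel {0..s} (\<lambda>r. drift r \<omega>)" "set_integrable lborel ?A (\<lambda>r. drift r \<omega>)"
      by (rule set_integrable_subset[OF elim(3)]; use st in auto)+
    have disj: "{0..s} \<inter> ?A = {}" by auto
    have "{0..t} = {0..s} \<union> ?A" using st by auto
    then have "set_lebesgue_integral lborel {0..t} (\<lambda>r. drift r \<omega>) =
      set_lebesgue_integral lborel {0..s} (\<lambda>r. drift r \<omega>) + set_lebesgue_integral lborel ?A (\<lambda>r. drift r \<omega>)"
      using set_integral_Un[OF disj i] by simp
    moreover have iv: "set_integrable lborel ?A (\<lambda>r. v \<omega>)"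
      unfolding set_integrable_def using st by (intro integrable_scaleR_left) auto
    have "set_lebesgue_integral lborel ?A (\<lambda>r. v \<omega>) = (t - s) *\<^sub>R v \<omega>"
      unfolding set_lebesgue_integral_def using st by simp
    then have "set_lebesgue_integral lborel ?A (\<lambda>r. drift r \<omega> - v \<omega>) =
      set_lebesgue_integral lborel ?A (\<lambda>r. drift r \<omega>) - (t - s) *\<^sub>R v \<omega>"
      using set_integral_diff(2)[OF i(2) iv] by simp
    ultimately have eq: "X t \<omega> - X s \<omega> - (ito_part t \<omega> - ito_part s \<omega>) - (t - s) *\<^sub>R v \<omega> = set_lebesgue_integral lborel ?A (\<lambda>r. drift r \<omega> - v \<omega>)"
      by simp
    have "ennreal ((norm (set_lebesgue_integral lborel ?A (\<lambda>r. drift r \<omega> - v \<omega>)))\<^sup>2) \<le>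
      ennreal (t - s) * (\<integral>\<^sup>+r\<in>?A. ennreal ((norm (drift r \<omega> - v \<omega>))\<^sup>2) \<partial>lborel)"
      by (rule norm_integral_sq_le[OF _ em _ set_integral_diff(1)[OF i(2) iv]]) (use st in auto)
    also have "(\<integral>\<^sup>+r\<in>?A. ennreal ((norm (drift r \<omega> - v \<omega>))\<^sup>2) \<partial>lborel) = (\<integral>\<^sup>+r\<in>?A. ennreal ((norm (g r \<omega>))\<^sup>2) \<partial>lborel)"
      by (intro nn_integral_cong) (auto simp: indicator_def gB)
    finally show ?case unfolding eq .
  qed
  then have "(\<integral>\<^sup>+\<omega>. ennreal ((norm (X t \<omega> - X s \<omega> - (ito_part t \<omega> - ito_part s \<omega>) - (t - s) *\<^sub>R v \<omega>))\<^sup>2) \<partial>M) \<le>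
    (\<integral>\<^sup>+\<omega>. ennreal (t - s) * (\<integral>\<^sup>+r\<in>?A. ennreal ((norm (g r \<omega>))\<^sup>2) \<partial>lborel) \<partial>M)"
    by (rule nn_integral_mono_AE)
  also have "\<dots> = ennreal (t - s) * (\<integral>\<^sup>+\<omega>. (\<integral>\<^sup>+r\<in>?A. ennreal ((norm (g r \<omega>))\<^sup>2) \<partial>lborel) \<partial>M)"
    by (rule nn_integral_cmult) (rule lborel.borel_measurable_nn_integral, simp add: case_prod_beta')
  also have "\<dots> = ennreal (t - s) * (\<integral>\<^sup>+r\<in>?A. (\<integral>\<^sup>+\<omega>. ennreal ((norm (g r \<omega>))\<^sup>2) \<partial>M) \<partial>lborel)"
    by (subst nn_integral_Fubini_set[OF gm]) auto
  also have "\<dots> \<le> ennreal (t - s) * (\<integral>\<^sup>+r. ennreal q * indicator ?A r \<partial>lborel)"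
    by (intro mult_left_mono nn_integral_mono) (auto simp: indicator_def gB intro!: q)
  also have "\<dots> = ennreal ((t - s)\<^sup>2 * q)"
    using st q(2) by (simp add: nn_integral_cmult_indicator ennreal_mult[symmetric] power2_eq_square mult_ac)
  finally show ?thesis .
qed

text \<open>Only one factor t - s arises, from integrating q over the interval, against two for the
  drift; the 4 is the constant of \<open>ito_increment_bound\<close>.\<close>

lemma diffusion_increment_bound:
  assumes st: "0 \<le> s" "s < t" "t \<le> T" and \<zeta>: "\<zeta> \<in> borel_measurable (F s)" "L2 M \<zeta>"
    and q: "\<And>r. r \<in> {s<..t} \<Longrightarrow> (\<integral>\<^sup>+\<omega>. ennreal ((norm (diffusion r \<omega> - \<zeta> \<omega>))\<^sup>2) \<partial>M) \<le> ennreal q" "0 \<le> q"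
  shows "(\<integral>\<^sup>+\<omega>. ennreal ((norm (ito_part t \<omega> - ito_part s \<omega> - \<zeta> \<omega> *v (W t \<omega> - W s \<omega>)))\<^sup>2) \<partial>M) \<le> ennreal (4 * (t - s) * q)"
proof -
  let ?A = "{s<..t}"
  have st': "s \<in> {0..T}" "t \<in> {0..T}" using st by auto
  have [measurable]: "\<zeta> \<in> borel_measurable M" by (rule L2_measurable[OF \<zeta>(2)])
  define g where "g r \<omega> = diffusion (max 0 (min t r)) \<omega> - \<zeta> \<omega>" for r \<omega>
  have gS: "g r \<omega> = diffusion r \<omega> - \<zeta> \<omega>" if "r \<in> ?A" for r \<omega> using that st by (simp add: g_def)
  have "(\<lambda>z. diffusion (max 0 (min t (fst z))) (snd z)) \<in> borel_measurable (lborel \<Otimes>\<^sub>M M)"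
    using progressive_clip_measurable[of t diffusion] ito_part_ito[OF st'(2)] st
    by (simp add: has_ito_integral_def case_prod_beta')
  then have gm: "(\<lambda>z. g (fst z) (snd z)) \<in> borel_measurable (lborel \<Otimes>\<^sub>M M)"
    unfolding g_def by measurable
  have "(\<integral>\<^sup>+\<omega>. ennreal ((norm (ito_part t \<omega> - ito_part s \<omega> - \<zeta> \<omega> *v (W t \<omega> - W s \<omega>)))\<^sup>2) \<partial>M) \<le>
      4 * (\<integral>\<^sup>+\<omega>. (\<integral>\<^sup>+r\<in>?A. ennreal ((norm (diffusion r \<omega> - \<zeta> \<omega>))\<^sup>2) \<partial>lborel) \<partial>M)"
    using st by (intro ito_increment_bound ito_part_ito st' \<zeta>) auto
  also have "(\<integral>\<^sup>+\<omega>. (\<integral>\<^sup>+r\<in>?A. ennreal ((norm (diffusion r \<omega> - \<zeta> \<omega>))\<^sup>2) \<partial>lborel) \<partial>M) =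
    (\<integral>\<^sup>+\<omega>. (\<integral>\<^sup>+r\<in>?A. ennreal ((norm (g r \<omega>))\<^sup>2) \<partial>lborel) \<partial>M)"
    by (intro nn_integral_cong) (auto simp: indicator_def gS)
  also have "\<dots> = (\<integral>\<^sup>+r\<in>?A. (\<integral>\<^sup>+\<omega>. ennreal ((norm (g r \<omega>))\<^sup>2) \<partial>M) \<partial>lborel)"
    by (subst nn_integral_Fubini_set[OF gm]) auto
  also have "4 * \<dots> \<le> 4 * (\<integral>\<^sup>+r. ennreal q * indicator ?A r \<partial>lborel)"
    by (intro mult_left_mono nn_integral_mono) (auto simp: indicator_def gS intro!: q)
  also have "\<dots> = ennreal (4 * (t - s) * q)"
  proof -
    define l where "l = t - s"
    have "0 \<le> l" "emeasure lborel ?A = ennreal l" using st by (auto simp: l_def)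
    then show ?thesis
      unfolding l_def[symmetric] using q(2) by (simp add: nn_integral_cmult_indicator ennreal_mult mult_ac)
  qed
  finally show ?thesis .
qed

lemma increment_L2:
  assumes "0 \<le> s" "s \<le> t" "t \<le> T"
  shows "L2 M (\<lambda>\<omega>. ito_part t \<omega> - ito_part s \<omega>)"
proof -
  have "L2 M (\<lambda>\<omega>. ito_part t \<omega> - ito_part s \<omega> - 0 *v (W t \<omega> - W s \<omega>))"
    using assms by (intro ito_increment_L2[where H = diffusion] ito_part_ito) (auto intro: L2_zero)
  then show ?thesis by simp
qed

lemma X_increment_bound:
  "\<exists>K\<ge>0. \<forall>s t. 0 \<le> s \<and> s \<le> t \<and> t \<le> T \<and> t - s \<le> 1 \<longrightarrow>
    (\<integral>\<omega>. (norm (X t \<omega> - X s \<omega>))\<^sup>2 \<partial>M) \<le> K * (t - s)"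
proof -
  obtain m where m: "0 \<le> m" "\<And>t. t \<in> {0..T} \<Longrightarrow> (\<integral>\<omega>. (norm (X t \<omega>))\<^sup>2 \<partial>M) \<le> m"
    using moment_bound by blast
  define q where "q = c0 * (1 + 2 * m)"
  have q: "0 \<le> q" using m(1) const_pos by (simp add: q_def)
  have le: "ennreal (c0 * (1 + 2 * (\<integral>\<omega>. (norm (X r \<omega>))\<^sup>2 \<partial>M))) \<le> ennreal q" if "r \<in> {0..T}" for r
    unfolding q_def using m(2)[OF that] const_pos by (intro ennreal_leI mult_left_mono) auto
  have Bq: "(\<integral>\<^sup>+\<omega>. ennreal ((norm (drift r \<omega> - 0))\<^sup>2) \<partial>M) \<le> ennreal q" if "r \<in> {0..T}" for r
    using nn_integral_growth_coeff_le[OF prob_space_axioms X_L2[OF that] _ growth_b] le[OF that] const_pos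
    unfolding drift_def by (simp add: order_trans)
  have Sq: "(\<integral>\<^sup>+\<omega>. ennreal ((norm (diffusion r \<omega> - 0))\<^sup>2) \<partial>M) \<le> ennreal q" if "r \<in> {0..T}" for r
    using nn_integral_growth_coeff_le[OF prob_space_axioms X_L2[OF that] _ growth_\<sigma>] le[OF that] const_pos
    unfolding diffusion_def by (simp add: order_trans)
  \<comment> \<open>The constant 10 is 2 + 8: twice the drift bound, where (t - s)^2 \<le> t - s
    because t - s \<le> 1, plus twice the bound 4 (t - s) q.\<close>
  have "(\<integral>\<omega>. (norm (X t \<omega> - X s \<omega>))\<^sup>2 \<partial>M) \<le> 10 * q * (t - s)"
    if st: "0 \<le> s" "s \<le> t" "t \<le> T" "t - s \<le> 1" for s t
  proof (cases "s = t")
    case False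
    then have st': "s < t" "s \<in> {0..T}" "t \<in> {0..T}" using st by auto
    have L: "L2 M (\<lambda>\<omega>. X t \<omega> - X s \<omega>)" "L2 M (\<lambda>\<omega>. ito_part t \<omega> - ito_part s \<omega>)"
      by (intro L2_diff X_L2 st' increment_L2 st)+
    have L': "L2 M (\<lambda>\<omega>. X t \<omega> - X s \<omega> - (ito_part t \<omega> - ito_part s \<omega>))" by (rule L2_diff[OF L])
    have "(\<integral>\<^sup>+\<omega>. ennreal ((norm (X t \<omega> - X s \<omega> - (ito_part t \<omega> - ito_part s \<omega>) - (t - s) *\<^sub>R 0))\<^sup>2) \<partial>M) \<le> ennreal ((t - s)\<^sup>2 * q)"
      using st st' by (intro drift_increment_bound q Bq) auto
    then have 1: "(\<integral>\<omega>. (norm (X t \<omega> - X s \<omega> - (ito_part t \<omega> - ito_part s \<omega>)))\<^sup>2 \<partial>M) \<le> (t - s)\<^sup>2 * q"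
      using q by (intro L2_integral_le_of_nn_integral_le[OF L']) auto
    have "(\<integral>\<^sup>+\<omega>. ennreal ((norm (ito_part t \<omega> - ito_part s \<omega> - 0 *v (W t \<omega> - W s \<omega>)))\<^sup>2) \<partial>M) \<le> ennreal (4 * (t - s) * q)"
      using st st' by (intro diffusion_increment_bound q Sq L2_zero) auto
    then have 2: "(\<integral>\<omega>. (norm (ito_part t \<omega> - ito_part s \<omega>))\<^sup>2 \<partial>M) \<le> 4 * (t - s) * q"
      using q st by (intro L2_integral_le_of_nn_integral_le[OF L(2)]) auto
    have "(\<integral>\<omega>. (norm (X t \<omega> - X s \<omega>))\<^sup>2 \<partial>M) \<le>
      (\<integral>\<omega>. 2 * (norm (X t \<omega> - X s \<omega> - (ito_part t \<omega> - ito_part s \<omega>)))\<^sup>2 + 2 * (norm (ito_part t \<omega> - ito_part s \<omega>))\<^sup>2 \<partial>M)"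
    proof (rule integral_mono)
      show "(norm (X t \<omega> - X s \<omega>))\<^sup>2 \<le> 2 * (norm (X t \<omega> - X s \<omega> - (ito_part t \<omega> - ito_part s \<omega>)))\<^sup>2 + 2 * (norm (ito_part t \<omega> - ito_part s \<omega>))\<^sup>2" for \<omega>
        using norm_add_sq_le[of "X t \<omega> - X s \<omega> - (ito_part t \<omega> - ito_part s \<omega>)" "ito_part t \<omega> - ito_part s \<omega>"] by simp
    qed (use L2_integrable_norm_sq[OF L(1)] L2_integrable_norm_sq[OF L(2)] L2_integrable_norm_sq[OF L'] in auto)
    also have "\<dots> = 2 * (\<integral>\<omega>. (norm (X t \<omega> - X s \<omega> - (ito_part t \<omega> - ito_part s \<omega>)))\<^sup>2 \<partial>M) + 2 * (\<integral>\<omega>. (norm (ito_part t \<omega> - ito_part s \<omega>))\<^sup>2 \<partial>M)"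
      using L2_integrable_norm_sq[OF L(2)] L2_integrable_norm_sq[OF L'] by simp
    also have "\<dots> \<le> 2 * ((t - s)\<^sup>2 * q) + 2 * (4 * (t - s) * q)" using 1 2 by simp
    also have "(t - s)\<^sup>2 * q \<le> (t - s) * q"
      using st q by (intro mult_right_mono) (auto simp: power2_eq_square mult_left_le)
    finally show ?thesis by (simp add: algebra_simps)
  qed simp
  then show ?thesis using q by (intro exI[of _ "10 * q"]) auto
qed

section \<open>The scheme and its error\<close>

abbreviation Y :: "real \<Rightarrow> nat \<Rightarrow> 'w \<Rightarrow> real^'n" where
  "Y \<equiv> euler_maruyama M W b \<sigma> X\<^sub>0"

lemma
  assumes "L2 M \<xi>" "\<xi> \<in> borel_measurable (F s)"
  shows b_law_measurable: "(\<lambda>\<omega>. b (\<xi> \<omega>) (law M \<xi>)) \<in> borel_measurable (F s)"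
    and \<sigma>_law_measurable: "(\<lambda>\<omega>. \<sigma> (\<xi> \<omega>) (law M \<xi>)) \<in> borel_measurable (F s)"
    and b_law_L2: "L2 M (\<lambda>\<omega>. b (\<xi> \<omega>) (law M \<xi>))"
    and \<sigma>_law_L2: "L2 M (\<lambda>\<omega>. \<sigma> (\<xi> \<omega>) (law M \<xi>))"
proof -
  have a: "0 \<le> a" and c0: "0 \<le> c0" using const_pos by auto
  show *: "(\<lambda>\<omega>. b (\<xi> \<omega>) (law M \<xi>)) \<in> borel_measurable (F s)"
    by (rule measurable_compose[OF assms(2) lipschitz_coeff_measurable[OF prob_space_axioms assms(1) a lip_b]])
  show **: "(\<lambda>\<omega>. \<sigma> (\<xi> \<omega>) (law M \<xi>)) \<in> borel_measurable (F s)"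
    by (rule measurable_compose[OF assms(2) lipschitz_coeff_measurable[OF prob_space_axioms assms(1) a lip_\<sigma>]])
  show "L2 M (\<lambda>\<omega>. b (\<xi> \<omega>) (law M \<xi>))"
    using nn_integral_growth_coeff_le[OF prob_space_axioms assms(1) c0 growth_b]
    by (intro L2_I_nn_integral measurable_F_M[OF *]) (auto intro: le_less_trans)
  show "L2 M (\<lambda>\<omega>. \<sigma> (\<xi> \<omega>) (law M \<xi>))"
    using nn_integral_growth_coeff_le[OF prob_space_axioms assms(1) c0 growth_\<sigma>]
    by (intro L2_I_nn_integral measurable_F_M[OF **]) (auto intro: le_less_trans)
qed

text \<open>Adaptedness makes the error at a grid point known there, hence orthogonal to the later
  stochastic increment; square integrability puts the law of the scheme in \<open>P2\<close>, where
  the conditions on the coefficients hold.\<close>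

lemma Y_adapted_L2:
  assumes "0 < h" shows "Y h k \<in> borel_measurable (F (real k * h)) \<and> L2 M (Y h k)"
proof (induction k)
  case 0
  show ?case using X0_meas X0_L2 by simp
next
  case (Suc k)
  let ?s = "real k * h" and ?t = "real (Suc k) * h" and ?Y = "Y h k"
  have st: "0 \<le> ?s" "?s \<le> ?t" using assms by (auto simp: algebra_simps)
  have Y: "?Y \<in> borel_measurable (F ?s)" "L2 M ?Y" using Suc.IH by auto
  note \<sigma> = \<sigma>_law_measurable[OF Y(2,1)] \<sigma>_law_L2[OF Y(2,1)]
  have eq: "Y h (Suc k) = (\<lambda>\<omega>. ?Y \<omega> + h *\<^sub>R b (?Y \<omega>) (law M ?Y) + \<sigma> (?Y \<omega>) (law M ?Y) *v (W ?t \<omega> - W ?s \<omega>))"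
    by (simp add: Let_def)
  have "(\<lambda>\<omega>. ?Y \<omega> + h *\<^sub>R b (?Y \<omega>) (law M ?Y)) \<in> borel_measurable (F ?s)"
    by (intro borel_measurable_add borel_measurable_scaleR borel_measurable_const Y b_law_measurable)
  from borel_measurable_add[OF measurable_F_mono[OF st(2) this] measurable_mult_incr[OF st \<sigma>(1)]]
  show ?case unfolding eq
    by (intro conjI L2_add L2_scaleR Y b_law_L2[OF Y(2,1)] L2_mult_incr st \<sigma>)
qed

lemma error_recursion:
  assumes K: "0 \<le> K" "\<And>s t. 0 \<le> s \<Longrightarrow> s \<le> t \<Longrightarrow> t \<le> T \<Longrightarrow> t - s \<le> 1 \<Longrightarrow>
      (\<integral>\<omega>. (norm (X t \<omega> - X s \<omega>))\<^sup>2 \<partial>M) \<le> K * (t - s)"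
    and h: "0 < h" "h < 1" "real (Suc k) * h \<le> T"
  defines "u \<equiv> \<lambda>k. \<integral>\<omega>. (norm (X (real k * h) \<omega> - Y h k \<omega>))\<^sup>2 \<partial>M"
  shows "u (Suc k) \<le> (1 + h * (1 + 22 * (a + b'))) * u k + 22 * (a + b') * K * h\<^sup>2"
proof -
  define s where "s = real k * h"
  define t where "t = real (Suc k) * h"
  have ts: "t - s = h" by (simp add: s_def t_def algebra_simps)
  have st: "0 \<le> s" "s < t" "t \<le> T" "s \<in> {0..T}" "t \<in> {0..T}"
  proof -
    show "t \<le> T" using h(3) by (simp add: t_def)
    show "0 \<le> s" using h(1) by (simp add: s_def)
    show "s < t" using h(1) ts by simp
    with \<open>0 \<le> s\<close> \<open>t \<le> T\<close> show "s \<in> {0..T}" "t \<in> {0..T}" by auto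
  qed
  have Y: "Y h k \<in> borel_measurable (F s)" "L2 M (Y h k)"
    using Y_adapted_L2[OF h(1), of k] by (auto simp: s_def)
  define bY where "bY \<omega> = b (Y h k \<omega>) (law M (Y h k))" for \<omega>
  define \<sigma>Y where "\<sigma>Y \<omega> = \<sigma> (Y h k \<omega>) (law M (Y h k))" for \<omega>
  have bY: "L2 M bY" unfolding bY_def[abs_def] by (rule b_law_L2[OF Y(2,1)])
  have \<sigma>Y: "\<sigma>Y \<in> borel_measurable (F s)" "L2 M \<sigma>Y"
    unfolding \<sigma>Y_def[abs_def] by (rule \<sigma>_law_measurable[OF Y(2,1)], rule \<sigma>_law_L2[OF Y(2,1)])
  define e where "e \<omega> = X s \<omega> - Y h k \<omega>" for \<omega>
  define A where "A \<omega> = X t \<omega> - X s \<omega> - (ito_part t \<omega> - ito_part s \<omega>) - (t - s) *\<^sub>R bY \<omega>" for \<omega>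
  define L where "L \<omega> = ito_part t \<omega> - ito_part s \<omega> - \<sigma>Y \<omega> *v (W t \<omega> - W s \<omega>)" for \<omega>
  have e: "e \<in> borel_measurable (F s)" "L2 M e"
    unfolding e_def[abs_def] by (intro borel_measurable_diff X_measurable Y L2_diff X_L2 st)+
  have A: "L2 M A"
    unfolding A_def[abs_def] by (intro L2_diff L2_scaleR X_L2 increment_L2 bY st less_imp_le[OF st(2)])
  have L: "L2 M L" and eL: "(\<integral>\<omega>. e \<omega> \<bullet> L \<omega> \<partial>M) = 0"
    unfolding L_def[abs_def]
    using st by (auto intro!: ito_increment_L2[where H = diffusion] ito_increment_orthogonal[where H = diffusion] ito_part_ito \<sigma>Y e)
  have us: "u k = (\<integral>\<omega>. (norm (e \<omega>))\<^sup>2 \<partial>M)" by (simp add: u_def e_def s_def)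
  have ut: "u (Suc k) = (\<integral>\<omega>. (norm (e \<omega> + A \<omega> + L \<omega>))\<^sup>2 \<partial>M)"
  proof -
    have "Y h (Suc k) \<omega> = Y h k \<omega> + h *\<^sub>R bY \<omega> + \<sigma>Y \<omega> *v (W t \<omega> - W s \<omega>)" for \<omega>
      by (simp add: Let_def bY_def \<sigma>Y_def s_def t_def)
    then have "X t \<omega> - Y h (Suc k) \<omega> = e \<omega> + A \<omega> + L \<omega>" for \<omega>
      by (simp add: e_def A_def L_def ts del: euler_maruyama.simps)
    then show ?thesis by (simp only: u_def t_def[symmetric])
  qed
  have u0: "0 \<le> u k" by (simp add: us)
  \<comment> \<open>A bound, uniform over the step, for the mean square difference between the
    coefficients along X and their frozen values: X r - Y is split into X r - X s and e.\<close>
  define Q where "Q = (a + b') * (2 * (K * h) + 2 * u k)"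
  have Q: "0 \<le> Q" using const_pos K(1) h u0 by (simp add: Q_def)
  have XY: "(a + b') * (\<integral>\<omega>. (norm (X r \<omega> - Y h k \<omega>))\<^sup>2 \<partial>M) \<le> Q" if r: "r \<in> {s<..t}" for r
    unfolding Q_def
  proof (rule mult_left_mono)
    have r': "r \<in> {0..T}" using r st by auto
    have D: "L2 M (\<lambda>\<omega>. X r \<omega> - X s \<omega>)" by (intro L2_diff X_L2 r' st)
    have "(\<integral>\<omega>. (norm (X r \<omega> - Y h k \<omega>))\<^sup>2 \<partial>M) \<le> (\<integral>\<omega>. 2 * (norm (X r \<omega> - X s \<omega>))\<^sup>2 + 2 * (norm (e \<omega>))\<^sup>2 \<partial>M)"
    proof (rule integral_mono)
      show "(norm (X r \<omega> - Y h k \<omega>))\<^sup>2 \<le> 2 * (norm (X r \<omega> - X s \<omega>))\<^sup>2 + 2 * (norm (e \<omega>))\<^sup>2" for \<omega>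
        using norm_add_sq_le[of "X r \<omega> - X s \<omega>" "e \<omega>"] by (simp add: e_def)
    qed (use L2_integrable_norm_sq[OF D] L2_integrable_norm_sq[OF e(2)]
         L2_integrable_norm_sq[OF L2_diff[OF X_L2[OF r'] Y(2)]] in auto)
    also have "\<dots> = 2 * (\<integral>\<omega>. (norm (X r \<omega> - X s \<omega>))\<^sup>2 \<partial>M) + 2 * u k"
      using L2_integrable_norm_sq[OF D] L2_integrable_norm_sq[OF e(2)] by (simp add: us)
    also have "(\<integral>\<omega>. (norm (X r \<omega> - X s \<omega>))\<^sup>2 \<partial>M) \<le> K * (r - s)"
      using r st h ts by (intro K) auto
    also have "K * (r - s) \<le> K * h" using r ts K(1) by (intro mult_left_mono) auto
    finally show "(\<integral>\<omega>. (norm (X r \<omega> - Y h k \<omega>))\<^sup>2 \<partial>M) \<le> 2 * (K * h) + 2 * u k" by simp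
  qed (use const_pos in simp)
  have a: "0 \<le> a" "0 \<le> b'" using const_pos by auto
  have "(\<integral>\<^sup>+\<omega>. ennreal ((norm (A \<omega>))\<^sup>2) \<partial>M) \<le> ennreal ((t - s)\<^sup>2 * Q)"
    unfolding A_def
  proof (rule drift_increment_bound[OF st(1-3) L2_measurable[OF bY] _ Q])
    fix r assume r: "r \<in> {s<..t}"
    then have "r \<in> {0..T}" using st by auto
    from nn_integral_lipschitz_coeff_le[OF prob_space_axioms X_L2[OF this] Y(2) a lip_b] XY[OF r]
    show "(\<integral>\<^sup>+\<omega>. ennreal ((norm (drift r \<omega> - bY \<omega>))\<^sup>2) \<partial>M) \<le> ennreal Q"
      unfolding drift_def bY_def by (meson ennreal_leI order_trans)
  qed
  then have A2: "(\<integral>\<omega>. (norm (A \<omega>))\<^sup>2 \<partial>M) \<le> h\<^sup>2 * Q"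
    unfolding ts using Q by (intro L2_integral_le_of_nn_integral_le[OF A]) auto
  have "(\<integral>\<^sup>+\<omega>. ennreal ((norm (L \<omega>))\<^sup>2) \<partial>M) \<le> ennreal (4 * (t - s) * Q)"
    unfolding L_def
  proof (rule diffusion_increment_bound[OF st(1-3) \<sigma>Y _ Q])
    fix r assume r: "r \<in> {s<..t}"
    then have "r \<in> {0..T}" using st by auto
    from nn_integral_lipschitz_coeff_le[OF prob_space_axioms X_L2[OF this] Y(2) a lip_\<sigma>] XY[OF r]
    show "(\<integral>\<^sup>+\<omega>. ennreal ((norm (diffusion r \<omega> - \<sigma>Y \<omega>))\<^sup>2) \<partial>M) \<le> ennreal Q"
      unfolding diffusion_def \<sigma>Y_def by (meson ennreal_leI order_trans)
  qed
  then have L2': "(\<integral>\<omega>. (norm (L \<omega>))\<^sup>2 \<partial>M) \<le> 4 * h * Q"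
    unfolding ts using Q h by (intro L2_integral_le_of_nn_integral_le[OF L]) auto
  have int: "integrable M (\<lambda>\<omega>. (norm (e \<omega>))\<^sup>2)" "integrable M (\<lambda>\<omega>. (norm (A \<omega>))\<^sup>2)"
    "integrable M (\<lambda>\<omega>. (norm (L \<omega>))\<^sup>2)" "integrable M (\<lambda>\<omega>. e \<omega> \<bullet> L \<omega>)"
    by (intro L2_integrable_norm_sq L2_inner_integrable e A L)+
  \<comment> \<open>Young's inequality with weight h for e and A produces 1 + h and 1 / h; the
    pairing of e with L is kept as it is, since its integral vanishes.\<close>
  have "u (Suc k) \<le> (\<integral>\<omega>. (1 + h) * (norm (e \<omega>))\<^sup>2 + (1 / h + 2) * (norm (A \<omega>))\<^sup>2 + 2 * (e \<omega> \<bullet> L \<omega>) +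
      2 * (norm (L \<omega>))\<^sup>2 \<partial>M)"
    unfolding ut
  proof (rule integral_mono)
    fix \<omega>
    have "(norm (e \<omega> + A \<omega> + L \<omega>))\<^sup>2 =
      (norm (e \<omega>))\<^sup>2 + 2 * (e \<omega> \<bullet> A \<omega>) + 2 * (e \<omega> \<bullet> L \<omega>) + (norm (A \<omega> + L \<omega>))\<^sup>2"
      by (simp add: power2_norm_eq_inner inner_add_left inner_add_right inner_commute)
    with norm_add_sq_weighted_le[OF h(1), of "e \<omega>" "A \<omega>"] norm_add_sq_le[of "A \<omega>" "L \<omega>"]
    show "(norm (e \<omega> + A \<omega> + L \<omega>))\<^sup>2 \<le> (1 + h) * (norm (e \<omega>))\<^sup>2 + (1 / h + 2) * (norm (A \<omega>))\<^sup>2 + 2 * (e \<omega> \<bullet> L \<omega>) +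
      2 * (norm (L \<omega>))\<^sup>2"
      by (simp add: algebra_simps)
  qed (use int L2_integrable_norm_sq[OF L2_add[OF L2_add[OF e(2) A] L]] in auto)
  also have "\<dots> = (1 + h) * u k + (1 / h + 2) * (\<integral>\<omega>. (norm (A \<omega>))\<^sup>2 \<partial>M) + 2 * (\<integral>\<omega>. (norm (L \<omega>))\<^sup>2 \<partial>M)"
    using int eL by (simp add: us)
  also have "\<dots> \<le> (1 + h) * u k + (1 / h + 2) * (h\<^sup>2 * Q) + 2 * (4 * h * Q)"
    using A2 L2' h by (intro add_mono mult_left_mono) auto
  also have "(1 / h + 2) * (h\<^sup>2 * Q) = h * Q + 2 * h * (h * Q)"
    using h by (simp add: power2_eq_square field_simps)
  also have "2 * h * (h * Q) \<le> 2 * 1 * (h * Q)"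
    using h Q by (intro mult_right_mono) auto
  \<comment> \<open>11 = 1 + 2 + 8: h Q and 2 h Q from A, using h < 1, and 8 h Q from L. The factor
    2 inside Q makes it 22.\<close>
  finally have "u (Suc k) \<le> (1 + h) * u k + 11 * (h * Q)" by (simp add: mult.commute)
  also have "\<dots> = (1 + h * (1 + 22 * (a + b'))) * u k + 22 * (a + b') * K * h\<^sup>2"
    by (simp add: Q_def power2_eq_square algebra_simps)
  finally show ?thesis .
qed

lemma euler_maruyama_error:
  "\<exists>C>0. \<forall>h\<in>{0<..<1}.
    (SUP k\<in>{1..nat \<lfloor>T / h\<rfloor>}. \<integral>\<^sup>+\<omega>. ennreal ((norm (X (real k * h) \<omega> - Y h k \<omega>))\<^sup>2) \<partial>M) \<le> ennreal (C * h)"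
proof -
  obtain K where K: "0 \<le> K" "\<And>s t. 0 \<le> s \<Longrightarrow> s \<le> t \<Longrightarrow> t \<le> T \<Longrightarrow> t - s \<le> 1 \<Longrightarrow>
      (\<integral>\<omega>. (norm (X t \<omega> - X s \<omega>))\<^sup>2 \<partial>M) \<le> K * (t - s)"
    using X_increment_bound by blast
  define C1 where "C1 = 1 + 22 * (a + b')"
  define C2 where "C2 = 22 * (a + b') * K"
  have C: "0 \<le> C1" "0 \<le> C2" using const_pos K(1) by (auto simp: C1_def C2_def)
  \<comment> \<open>The product is the Gronwall bound with k h replaced by T; the summand 1 makes C
    positive.\<close>
  define C where "C = T * C2 * exp (C1 * T) + 1"
  have "(\<integral>\<^sup>+\<omega>. ennreal ((norm (X (real k * h) \<omega> - Y h k \<omega>))\<^sup>2) \<partial>M) \<le> ennreal (C * h)"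
    if h: "0 < h" "h < 1" and k: "k \<le> nat \<lfloor>T / h\<rfloor>" for h k
  proof -
    have le: "real j * h \<le> T" if "j \<le> nat \<lfloor>T / h\<rfloor>" for j
    proof -
      have "real j \<le> T / h" using that h T_pos by (simp add: le_nat_floor le_nat_iff le_floor_iff)
      then show ?thesis using h by (simp add: field_simps)
    qed
    define u where "u k = (\<integral>\<omega>. (norm (X (real k * h) \<omega> - Y h k \<omega>))\<^sup>2 \<partial>M)" for k
    \<comment> \<open>X and the scheme agree at time 0 almost surely only, hence an argument on the
      integrals.\<close>
    have "u 0 = (\<integral>\<omega>. 0 \<partial>M)"
      unfolding u_def
    proof (rule integral_cong_AE)
      have "L2 M (\<lambda>\<omega>. X (real 0 * h) \<omega> - Y h 0 \<omega>)"
        using T_pos by (intro L2_diff X_L2) (auto intro: X0_L2)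
      from L2_integrable_norm_sq[OF this]
      show "(\<lambda>\<omega>. (norm (X (real 0 * h) \<omega> - Y h 0 \<omega>))\<^sup>2) \<in> borel_measurable M" by auto
      show "AE \<omega> in M. (norm (X (real 0 * h) \<omega> - Y h 0 \<omega>))\<^sup>2 = 0" using X_0 by eventually_elim simp
    qed simp
    then have "u k \<le> real k * (C2 * h\<^sup>2) * exp (h * C1 * real k)"
    proof (intro gronwall_discrete[where n = "nat \<lfloor>T / h\<rfloor>"])
      fix j assume "j < nat \<lfloor>T / h\<rfloor>"
      then have "real (Suc j) * h \<le> T" by (intro le) simp
      from error_recursion[OF K h this] show "u (Suc j) \<le> (1 + h * C1) * u j + C2 * h\<^sup>2"
        unfolding u_def C1_def C2_def .
    qed (use C h k in auto)
    \<comment> \<open>One power of h joins k, where k h \<le> T; the other is the rate.\<close>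
    also have "\<dots> = (real k * h) * C2 * exp (C1 * (real k * h)) * h"
      by (simp add: power2_eq_square mult_ac)
    also have "\<dots> \<le> T * C2 * exp (C1 * T) * h"
      using le[OF k] C h T_pos by (intro mult_right_mono mult_mono) (auto intro: mult_left_mono)
    also have "\<dots> \<le> C * h" using h by (simp add: C_def)
    finally have "u k \<le> C * h" .
    moreover have "L2 M (\<lambda>\<omega>. X (real k * h) \<omega> - Y h k \<omega>)"
      using le[OF k] h Y_adapted_L2[OF h(1), of k] by (intro L2_diff X_L2) auto
    ultimately show ?thesis by (simp add: L2_nn_integral u_def ennreal_leI)
  qed
  moreover have "0 < C" using C T_pos unfolding C_def by (intro add_nonneg_pos mult_nonneg_nonneg) auto
  ultimately show ?thesis by (intro exI[of _ C]) (auto intro!: SUP_least)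
qed

end

text \<open>The error is a nonnegative integral, so a square that is not integrable would count as
  infinite and not as 0. For h > T no grid point is compared and the supremum in
  \<open>ennreal\<close> is 0.\<close>

theorem theorem2p1:
  fixes M :: "'w measure" and F :: "real \<Rightarrow> 'w measure"
    and W :: "real \<Rightarrow> 'w \<Rightarrow> real^'n"
    and b :: "real^'n \<Rightarrow> (real^'n) measure \<Rightarrow> real^'n"
    and \<sigma> :: "real^'n \<Rightarrow> (real^'n) measure \<Rightarrow> real^'n^'n"
    and T :: real and X\<^sub>0 :: "'w \<Rightarrow> real^'n" and X :: "real \<Rightarrow> 'w \<Rightarrow> real^'n"
  assumes "complete_filtered_prob_space M F"
    and "brownian_motion M F W"
    and "continuous_coeff b" and "continuous_coeff \<sigma>"
    and "dissipative_coeffs b \<sigma>"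
    and "growth_lipschitz_coeffs b \<sigma>"
    and "T > 0"
    and "X\<^sub>0 \<in> borel_measurable (F 0)"
    and "integrable M (\<lambda>\<omega>. (norm (X\<^sub>0 \<omega>))\<^sup>2)"
    and "mckean_vlasov_solution M F W b \<sigma> T X\<^sub>0 X"
  shows "\<exists>C>0. \<forall>h\<in>{0<..<1}.
    (SUP k\<in>{1..nat \<lfloor>T / h\<rfloor>}.
       \<integral>\<^sup>+\<omega>. ennreal ((norm (X (real k * h) \<omega> - euler_maruyama M W b \<sigma> X\<^sub>0 h k \<omega>))\<^sup>2) \<partial>M)
    \<le> ennreal (C * h)"
proof -
  interpret complete_filtered_prob_space M F by fact
  interpret brownian_space M F W by unfold_locales fact
  obtain c0 a b' :: real where c: "c0 > 0" "a > 0" "b' > 0"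
    and growth: "\<And>x \<mu>. \<mu> \<in> P2 \<Longrightarrow> max ((norm (b x \<mu>))\<^sup>2) ((norm (\<sigma> x \<mu>))\<^sup>2)
            \<le> c0 * (1 + (norm x)\<^sup>2 + second_moment \<mu>)"
    and lip: "\<And>x y \<mu> \<nu>. \<mu> \<in> P2 \<Longrightarrow> \<nu> \<in> P2 \<Longrightarrow>
          max ((norm (b x \<mu> - b y \<nu>))\<^sup>2) ((norm (\<sigma> x \<mu> - \<sigma> y \<nu>))\<^sup>2)
            \<le> a * (norm (x - y))\<^sup>2 + b' * (W2 \<mu> \<nu>)\<^sup>2"
    using \<open>growth_lipschitz_coeffs b \<sigma>\<close> unfolding growth_lipschitz_coeffs_def by blast
  have "L2 M X\<^sub>0"
    using measurable_F_M[OF \<open>X\<^sub>0 \<in> borel_measurable (F 0)\<close>] assms(9) by (simp add: L2_def)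
  then interpret mckean_vlasov M F W b \<sigma> T X\<^sub>0 X c0 a b'
    by unfold_locales (use c growth lip assms in auto)
  show ?thesis by (rule euler_maruyama_error)
qed

end
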